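(* Let $K_0$ be a finitely generated abelian group and let $\mathbb{K}[T_1,\dots,T_r]$ be $K_0$-graded by $\deg(T_i)=w_i\in K_0$. Set $\overline{Z}_0=\mathbb{K}^r$, $H_0=\mathrm{Spec}\,\mathbb{K}[K_0]$, and suppose that $\widehat{Z}_0\to Z_0=\widehat{Z}_0/\!\!/H_0$ are the data of a toric Cox construction, given by a map of fans $\widehat{\Sigma}_0\to\Sigma_0$ in lattices $F_0=\mathbb{Z}^r$ and $N_0$, where $\Sigma_0$ is simplicial and $\widehat{\Sigma}_0$ is a maximal projectable fan. Let $f_0\in\mathbb{K}[T_1,\dots,T_r]$ be $K_0$-homogeneous such that $\mathbb{K}[T_1,\dots,T_r]/\langle f_0\rangle$ is a normal factorially $K_0$-graded algebra in which the classes of $T_1,\dots,T_r$ are pairwise nonassociated $K_0$-prime elements. Let $v_1,\dots,v_r$ be the primitive generators of the rays of $\Sigma_0$, suppose $\sigma_0=\mathrm{cone}(v_1,\dots,v_d)\in\Sigma_0$ with $2\le d\le r$, and let $\Sigma_1$ be the stellar subdivision of $\Sigma_0$ at a primitive vector $v_\infty\in\sigma_0^\circ$ of index $m_\infty$, with $m_\infty v_\infty=a_1v_1+\dots+a_dv_d$, $a_i\in\mathbb{Z}_{\ge0}$. Suppose that $f_0$ is admissible and let $$f_1:=\frac{f_0(T_\infty^{a_1}T_1,\dots,T_\infty^{a_d}T_d,T_{d+1},\dots,T_r)}{T_\infty^{k_0}}\in\mathbb{K}[T_1,\dots,T_r,T_\infty];$$ in $f_1$ only powers $T_\infty^{lm_\infty}$,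 $l\ge0$, of $T_\infty$ occur, and $f_1(T_1,\dots,T_r,\sqrt[m_\infty]{T_\infty})$ denotes the polynomial obtained by replacing each $T_\infty^{lm_\infty}$ with $T_\infty^l$. Then the ring $$R:=\mathbb{K}[T_1,\dots,T_r,T_\infty]/\langle f_1(T_1,\dots,T_r,\sqrt[m_\infty]{T_\infty})\rangle$$ is factorially $K_1$-graded. Moreover, if $K_0$ is torsion free, then $R$ is even factorial.
   Context: We work over an algebraically closed field $\mathbb{K}$ of characteristic zero. **Graded factoriality.** Let $K$ be a finitely generated abelian group and $R$ a $K$-graded integral $\mathbb{K}$-algebra with $R^*=\mathbb{K}^*$. A nonzero nonunit $f\in R$ is $K$-prime if it is homogeneous and $f\mid gh$ with homogeneous $g,h$ implies $f\mid g$ or $f\mid h$. A proper homogeneous ideal $\mathfrak{a}$ is $K$-prime if $fg\in\mathfrak{a}$ with homogeneous $f,g$ implies $f\in\mathfrak{a}$ or $g\in\mathfrak{a}$; its $K$-height is the maximal $d$ with a strictly increasing chain $\mathfrak{a}_0\subset\dots\subset\mathfrak{a}_d=\mathfrak{a}$ of $K$-prime ideals. $R$ is factorially $K$-graded if every $K$-prime ideal of $K$-height one is principal. **Toric Cox construction.** Let $Z$ be the toric variety of a fan $\Sigma$ in a lattice $N$ whose primitive ray generators $v_1,\dots,v_r$ generate $N_{\mathbb{Q}}$. Let $F=\mathbb{Z}^r$, $P\colon F\to N$, $e_i\mapsto v_i$, $\delta\subseteq F_{\mathbb{Q}}$ the positive orthant. The fan $\widehat{\Sigma}=\{\widehat{\sigma}\preceq\delta;\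 P(\widehat{\sigma})\subseteq\sigma\text{ for some }\sigma\in\Sigma\}$ defines an open toric subvariety $\widehat{Z}\subseteq\overline{Z}:=\mathbb{K}^r$ and $P$ defines $p_Z\colon\widehat{Z}\to Z$. With $E=\mathrm{Hom}(F,\mathbb{Z})$, $M=\mathrm{Hom}(N,\mathbb{Z})$, $K=E/P^*(M)\cong\mathrm{Cl}(Z)$, the group $H=\mathrm{Spec}\,\mathbb{K}[K]$ acts on $\overline{Z},\widehat{Z}$ via the $K$-grading $\deg(T_i)=[e_i]$, and $p_Z$ is a good quotient for $H$. For $\Sigma_0,\Sigma_1$ these data carry indices $0,1$ (so $K_0=E_0/M_0$ and $w_i=[e_i]$); the variables for $\Sigma_1$ are $T_1,\dots,T_r,T_\infty$ with $T_\infty$ corresponding to $v_\infty$, $K_1=E_1/M_1$, and $\mathbb{K}[T_1,\dots,T_r,T_\infty]$ is $K_1$-graded accordingly. **Maximal projectable fan.** Let $\gamma=\delta^\vee\subseteq E_{\mathbb{Q}}$ and $Q^0\colon E_{\mathbb{Q}}\to\mathbb{Q}\otimes K$ the induced map; for $\delta_0\preceq\delta$ put $\delta_0^*=\delta_0^\perp\cap\gamma\preceq\gamma$. A collection of faces of $\delta$ is compatible if $Q^0(\delta_1^* )^\circ\cap Q^0(\delta_2^* )^\circ\neq\emptyset$ for any two members ($^\circ$ is relative interior). A projectable fan is the fan generated by a compatible collection; it is maximal if the compatible collection is maximal. **Stellar subdivision.** The stellar subdivision $\Sigma_1$ of $\Sigma_0$ at a primitive $v_\infty\in\sigma_0^\circ$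 consists of all $\sigma\in\Sigma_0$ with $\sigma_0\not\preceq\sigma$ and all $\tau+\mathrm{cone}(v_\infty)$ where $\tau\preceq\sigma$ for some $\sigma\in\Sigma_0$ with $\sigma_0\preceq\sigma$, and $\sigma_0\not\preceq\tau$. Its index $m_\infty$ is the smallest positive integer such that $m_\infty v_\infty$ is a nonnegative integral combination of $v_1,\dots,v_d$. **Admissible polynomial.** Grade $\mathbb{K}[T_1,\dots,T_r]$ by $\mathbb{Z}_{\ge0}$ via $\deg(T_i)=a_i$ for $i\le d$ and $\deg(T_i)=0$ for $i\ge d+1$, and write $f_0=g_{k_0}+\dots+g_{k_m}$ with $k_0<\dots<k_m$ and each $g_{k_i}$ nontrivial of degree $k_i$. $f_0$ is admissible if (1) the toric orbit $0\times(\mathbb{K}^* )^{r-d}\subseteq\mathbb{K}^r$ intersects $V(f_0)$, and (2) $g_{k_0}$ is a $K_1$-prime polynomial in at least two variables. *)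

theory Defs
  imports
    "HOL-Library.Poly_Mapping"
    "HOL-Library.Extended_Nat"
    "HOL-Analysis.Cartesian_Space"
    "HOL-Algebra.Algebra"
    "HOL-Algebra.Algebraic_Closure_Type"
begin

section \<open>Graded algebras\<close>

definition additive_group :: "'a::ab_group_add monoid" where
  "additive_group = \<lparr>carrier = UNIV, monoid.mult = (+), one = 0\<rparr>"

definition fg_abelian_group :: "('g, 'm) monoid_scheme \<Rightarrow> bool" where
  "fg_abelian_group G \<longleftrightarrow>
     comm_group G \<and> (\<exists>S. finite S \<and> S \<subseteq> carrier G \<and> generate G S = carrier G)"

definition torsion_free_group :: "('g, 'm) monoid_scheme \<Rightarrow> bool" where
  "torsion_free_group G \<longleftrightarrow>
     (\<forall>x\<in>carrier G. \<forall>n::nat. 0 < n \<and> x [^]\<^bsub>G\<^esub> n = \<one>\<^bsub>G\<^esub> \<longrightarrow> x = \<one>\<^bsub>G\<^esub>)"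

text \<open>Grading groups are written multiplicatively. The \<open>'k\<close>-algebra structure of \<open>R\<close> is the ring
  homomorphism \<open>\<iota>\<close>, and \<open>A g\<close> is the homogeneous component of degree \<open>g\<close>.\<close>

definition graded_algebra ::
  "('g, 'm) monoid_scheme \<Rightarrow> 'a ring \<Rightarrow> ('k::field \<Rightarrow> 'a) \<Rightarrow> ('g \<Rightarrow> 'a set) \<Rightarrow> bool" where
  "graded_algebra G R \<iota> A \<longleftrightarrow>
     fg_abelian_group G \<and> cring R \<and> \<iota> \<in> ring_hom ring_of_type_algebra R \<and>
     (\<forall>g\<in>carrier G. additive_subgroup (A g) R) \<and>
     (\<forall>g\<in>carrier G. \<forall>c. \<forall>x\<in>A g. \<iota> c \<otimes>\<^bsub>R\<^esub> x \<in> A g) \<and>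
     (\<forall>g\<in>carrier G. \<forall>h\<in>carrier G. \<forall>x\<in>A g. \<forall>y\<in>A h. x \<otimes>\<^bsub>R\<^esub> y \<in> A (g \<otimes>\<^bsub>G\<^esub> h)) \<and>
     (\<forall>x\<in>carrier R. \<exists>!c. c \<in> (\<Pi>\<^sub>E g\<in>carrier G. A g) \<and>
        finite {g \<in> carrier G. c g \<noteq> \<zero>\<^bsub>R\<^esub>} \<and>
        x = (\<Oplus>\<^bsub>R\<^esub>g\<in>{g \<in> carrier G. c g \<noteq> \<zero>\<^bsub>R\<^esub>}. c g))"

definition homogeneous_elems :: "('g, 'm) monoid_scheme \<Rightarrow> ('g \<Rightarrow> 'a set) \<Rightarrow> 'a set" where
  "homogeneous_elems G A = (\<Union>g\<in>carrier G. A g)"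

definition graded_prime_elem ::
  "('g, 'm) monoid_scheme \<Rightarrow> 'a ring \<Rightarrow> ('g \<Rightarrow> 'a set) \<Rightarrow> 'a \<Rightarrow> bool" where
  "graded_prime_elem G R A f \<longleftrightarrow>
     f \<in> homogeneous_elems G A \<and> f \<noteq> \<zero>\<^bsub>R\<^esub> \<and> f \<notin> Units R \<and>
     (\<forall>g\<in>homogeneous_elems G A. \<forall>h\<in>homogeneous_elems G A.
        f divides\<^bsub>R\<^esub> g \<otimes>\<^bsub>R\<^esub> h \<longrightarrow> f divides\<^bsub>R\<^esub> g \<or> f divides\<^bsub>R\<^esub> h)"

definition homogeneous_ideal ::
  "('g, 'm) monoid_scheme \<Rightarrow> 'a ring \<Rightarrow> ('g \<Rightarrow> 'a set) \<Rightarrow> 'a set \<Rightarrow> bool" where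
  "homogeneous_ideal G R A I \<longleftrightarrow> ideal I R \<and> I = Idl\<^bsub>R\<^esub> (I \<inter> homogeneous_elems G A)"

definition graded_prime_ideal ::
  "('g, 'm) monoid_scheme \<Rightarrow> 'a ring \<Rightarrow> ('g \<Rightarrow> 'a set) \<Rightarrow> 'a set \<Rightarrow> bool" where
  "graded_prime_ideal G R A I \<longleftrightarrow>
     homogeneous_ideal G R A I \<and> I \<noteq> carrier R \<and>
     (\<forall>f\<in>homogeneous_elems G A. \<forall>g\<in>homogeneous_elems G A.
        f \<otimes>\<^bsub>R\<^esub> g \<in> I \<longrightarrow> f \<in> I \<or> g \<in> I)"

definition graded_height ::
  "('g, 'm) monoid_scheme \<Rightarrow> 'a ring \<Rightarrow> ('g \<Rightarrow> 'a set) \<Rightarrow> 'a set \<Rightarrow> enat" where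
  "graded_height G R A I =
     Sup {enat d | d. \<exists>C. (\<forall>i\<le>d. graded_prime_ideal G R A (C i)) \<and>
                          (\<forall>i<d. C i \<subset> C (Suc i)) \<and> C d = I}"

text \<open>The standing assumptions (\<open>R\<close> integral, \<open>R\<close> has only constant units) are part of the notion.\<close>

definition factorially_graded ::
  "('g, 'm) monoid_scheme \<Rightarrow> 'a ring \<Rightarrow> ('k::field \<Rightarrow> 'a) \<Rightarrow> ('g \<Rightarrow> 'a set) \<Rightarrow> bool" where
  "factorially_graded G R \<iota> A \<longleftrightarrow>
     graded_algebra G R \<iota> A \<and> domain R \<and> Units R = \<iota> ` (UNIV - {0}) \<and>
     (\<forall>I. graded_prime_ideal G R A I \<and> graded_height G R A I = 1 \<longrightarrow> principalideal I R)"

text \<open>\<open>R\<close> is integrally closed in its field of fractions: if the fraction \<open>a / b\<close> satisfies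
  \<open>(a/b)^n + c (n-1) * (a/b)^(n-1) + \<dots> + c 0 = 0\<close> over \<open>R\<close>, then it lies in \<open>R\<close>. The equation
  is multiplied by \<open>b^n\<close>, since the library has no field of fractions of a ring record.\<close>

definition normal_domain :: "'a ring \<Rightarrow> bool" where
  "normal_domain R \<longleftrightarrow> domain R \<and>
     (\<forall>a\<in>carrier R. \<forall>b\<in>carrier R - {\<zero>\<^bsub>R\<^esub>}. \<forall>n::nat. \<forall>c\<in>{..<n} \<rightarrow> carrier R.
        a [^]\<^bsub>R\<^esub> n \<oplus>\<^bsub>R\<^esub> (\<Oplus>\<^bsub>R\<^esub>i\<in>{..<n}. c i \<otimes>\<^bsub>R\<^esub> a [^]\<^bsub>R\<^esub> i \<otimes>\<^bsub>R\<^esub> b [^]\<^bsub>R\<^esub> (n - i)) = \<zero>\<^bsub>R\<^esub>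
        \<longrightarrow> b divides\<^bsub>R\<^esub> a)"


section \<open>Polynomials graded by an abelian group\<close>

text \<open>Polynomials over \<open>'k\<close> whose variables are indexed by \<open>'v\<close>: finitely supported functions on
  exponent vectors.\<close>

type_synonym ('v, 'k) mpoly = "('v \<Rightarrow>\<^sub>0 nat) \<Rightarrow>\<^sub>0 'k"

definition Const :: "'k \<Rightarrow> ('v, 'k::comm_ring_1) mpoly" where
  "Const c = Poly_Mapping.single 0 c"

definition Var :: "'v \<Rightarrow> ('v, 'k::comm_ring_1) mpoly" where
  "Var i = Poly_Mapping.single (Poly_Mapping.single i 1) 1"

definition poly_subst :: "('v \<Rightarrow> ('w, 'k) mpoly) \<Rightarrow> ('v, 'k::comm_ring_1) mpoly \<Rightarrow> ('w, 'k) mpoly" where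
  "poly_subst \<phi> p = (\<Sum>\<mu>\<in>Poly_Mapping.keys p.
     Const (Poly_Mapping.lookup p \<mu>) * (\<Prod>i\<in>Poly_Mapping.keys \<mu>. \<phi> i ^ Poly_Mapping.lookup \<mu> i))"

definition poly_eval :: "('v \<Rightarrow> 'k) \<Rightarrow> ('v, 'k::comm_ring_1) mpoly \<Rightarrow> 'k" where
  "poly_eval x p = (\<Sum>\<mu>\<in>Poly_Mapping.keys p.
     Poly_Mapping.lookup p \<mu> * (\<Prod>i\<in>Poly_Mapping.keys \<mu>. x i ^ Poly_Mapping.lookup \<mu> i))"

definition poly_vars :: "('v, 'k::zero) mpoly \<Rightarrow> 'v set" where
  "poly_vars p = (\<Union>\<mu>\<in>Poly_Mapping.keys p. Poly_Mapping.keys \<mu>)"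

definition mpoly_ring :: "('v, 'k::comm_ring_1) mpoly ring" where
  "mpoly_ring = ring_of_type_algebra"

definition monom_degree :: "('g, 'm) monoid_scheme \<Rightarrow> ('v \<Rightarrow> 'g) \<Rightarrow> ('v \<Rightarrow>\<^sub>0 nat) \<Rightarrow> 'g" where
  "monom_degree G w \<mu> = (\<Otimes>\<^bsub>G\<^esub>i\<in>Poly_Mapping.keys \<mu>. w i [^]\<^bsub>G\<^esub> Poly_Mapping.lookup \<mu> i)"

definition poly_component ::
  "('g, 'm) monoid_scheme \<Rightarrow> ('v \<Rightarrow> 'g) \<Rightarrow> 'g \<Rightarrow> ('v, 'k::comm_ring_1) mpoly set" where
  "poly_component G w g = {p. \<forall>\<mu>\<in>Poly_Mapping.keys p. monom_degree G w \<mu> = g}"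

definition quot_ring :: "('v, 'k::comm_ring_1) mpoly \<Rightarrow> ('v, 'k) mpoly set ring" where
  "quot_ring f = mpoly_ring Quot (PIdl\<^bsub>mpoly_ring\<^esub> f)"

definition quot_class :: "('v, 'k::comm_ring_1) mpoly \<Rightarrow> ('v, 'k) mpoly \<Rightarrow> ('v, 'k) mpoly set" where
  "quot_class f p = (PIdl\<^bsub>mpoly_ring\<^esub> f) +>\<^bsub>mpoly_ring\<^esub> p"

definition quot_const :: "('v, 'k::comm_ring_1) mpoly \<Rightarrow> 'k \<Rightarrow> ('v, 'k) mpoly set" where
  "quot_const f c = quot_class f (Const c)"

definition quot_component ::
  "('g, 'm) monoid_scheme \<Rightarrow> ('v \<Rightarrow> 'g) \<Rightarrow> ('v, 'k::comm_ring_1) mpoly \<Rightarrow> 'g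
    \<Rightarrow> ('v, 'k) mpoly set set" where
  "quot_component G w f g = quot_class f ` poly_component G w g"


section \<open>Cones and fans\<close>

text \<open>A lattice of rank \<open>n\<close> is \<open>int^'n\<close> and its rational vector space is \<open>rat^'n\<close>; dual lattices
  and dual spaces are identified with the original ones through the dual of the standard basis.\<close>

definition rat_vec :: "int^'n \<Rightarrow> rat^'n" where
  "rat_vec x = (\<chi> i. of_int (x $ i))"

definition pairing :: "'a::comm_ring_1^'n \<Rightarrow> 'a^'n \<Rightarrow> 'a" where
  "pairing u x = (\<Sum>i\<in>UNIV. u $ i * x $ i)"

definition cone_of :: "(rat^'n) set \<Rightarrow> (rat^'n) set" where
  "cone_of S = {\<Sum>x\<in>S. t x *s x | t. \<forall>x\<in>S. 0 \<le> t x}"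

definition polyhedral_cone :: "(rat^'n) set \<Rightarrow> bool" where
  "polyhedral_cone \<sigma> \<longleftrightarrow> (\<exists>S. finite S \<and> \<sigma> = cone_of S)"

definition simplicial_cone :: "(rat^'n) set \<Rightarrow> bool" where
  "simplicial_cone \<sigma> \<longleftrightarrow> (\<exists>S. finite S \<and> vec.independent S \<and> \<sigma> = cone_of S)"

definition pointed_cone :: "(rat^'n) set \<Rightarrow> bool" where
  "pointed_cone \<sigma> \<longleftrightarrow> \<sigma> \<inter> uminus ` \<sigma> = {0}"

definition dual_cone :: "(rat^'n) set \<Rightarrow> (rat^'n) set" where
  "dual_cone \<sigma> = {u. \<forall>x\<in>\<sigma>. 0 \<le> pairing u x}"

definition perp :: "(rat^'n) set \<Rightarrow> (rat^'n) set" where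
  "perp \<sigma> = {u. \<forall>x\<in>\<sigma>. pairing u x = 0}"

definition cone_face :: "(rat^'n) set \<Rightarrow> (rat^'n) set \<Rightarrow> bool" where
  "cone_face \<tau> \<sigma> \<longleftrightarrow> (\<exists>u\<in>dual_cone \<sigma>. \<tau> = \<sigma> \<inter> perp {u})"

text \<open>Relative interior of a polyhedral cone: the complement of its proper faces.\<close>

definition relint :: "(rat^'n) set \<Rightarrow> (rat^'n) set" where
  "relint \<sigma> = \<sigma> - \<Union>{\<tau>. cone_face \<tau> \<sigma> \<and> \<tau> \<noteq> \<sigma>}"

definition is_fan :: "(rat^'n) set set \<Rightarrow> bool" where
  "is_fan \<Sigma> \<longleftrightarrow> finite \<Sigma> \<and> \<Sigma> \<noteq> {} \<and>
     (\<forall>\<sigma>\<in>\<Sigma>. polyhedral_cone \<sigma> \<and> pointed_cone \<sigma>) \<and>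
     (\<forall>\<sigma>\<in>\<Sigma>. \<forall>\<tau>. cone_face \<tau> \<sigma> \<longrightarrow> \<tau> \<in> \<Sigma>) \<and>
     (\<forall>\<sigma>\<in>\<Sigma>. \<forall>\<tau>\<in>\<Sigma>. cone_face (\<sigma> \<inter> \<tau>) \<sigma> \<and> cone_face (\<sigma> \<inter> \<tau>) \<tau>)"

definition primitive_vec :: "int^'n \<Rightarrow> bool" where
  "primitive_vec x \<longleftrightarrow> x \<noteq> 0 \<and> (\<forall>k y. x = k *s y \<longrightarrow> k = 1 \<or> k = -1)"

definition primitive_ray_generators :: "(rat^'n) set set \<Rightarrow> ('r \<Rightarrow> int^'n) \<Rightarrow> bool" where
  "primitive_ray_generators \<Sigma> v \<longleftrightarrow>
     inj v \<and> (\<forall>i. primitive_vec (v i)) \<and>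
     range (\<lambda>i. cone_of {rat_vec (v i)}) = {\<rho> \<in> \<Sigma>. vec.dim \<rho> = 1}"

definition stellar_subdivision ::
  "(rat^'n) set set \<Rightarrow> (rat^'n) set \<Rightarrow> int^'n \<Rightarrow> (rat^'n) set set" where
  "stellar_subdivision \<Sigma> \<sigma>\<^sub>0 x =
     {\<sigma> \<in> \<Sigma>. \<not> cone_face \<sigma>\<^sub>0 \<sigma>} \<union>
     {{y + z | y z. y \<in> \<tau> \<and> z \<in> cone_of {rat_vec x}} | \<tau>.
        \<exists>\<sigma>\<in>\<Sigma>. cone_face \<tau> \<sigma> \<and> cone_face \<sigma>\<^sub>0 \<sigma> \<and> \<not> cone_face \<sigma>\<^sub>0 \<tau>}"

definition stellar_index :: "('r \<Rightarrow> int^'n) \<Rightarrow> 'r set \<Rightarrow> int^'n \<Rightarrow> nat" where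
  "stellar_index v D x =
     (LEAST m. 0 < m \<and> (\<exists>a :: 'r \<Rightarrow> nat. int m *s x = (\<Sum>i\<in>D. int (a i) *s v i)))"


section \<open>Toric Cox construction\<close>

text \<open>The rays are indexed by the finite type \<open>'r\<close>, so \<open>F = int^'r\<close>, and \<open>P\<close> maps the
  \<open>i\<close>-th basis vector to \<open>v i\<close>.\<close>

definition cox_map :: "('r \<Rightarrow> int^'n) \<Rightarrow> rat^'r \<Rightarrow> rat^'n" where
  "cox_map v x = (\<Sum>i\<in>UNIV. x $ i *s rat_vec (v i))"

definition cox_dual_map :: "('r \<Rightarrow> int^'n) \<Rightarrow> int^'n \<Rightarrow> int^'r" where
  "cox_dual_map v u = (\<chi> i. pairing u (v i))"

text \<open>The last clause says that \<open>G\<close>, with the degrees \<open>w\<close>, is the cokernel \<open>E / P\<^sup>*(M)\<close>, with the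
  classes of the basis vectors. The varieties, the action and the quotient map of the Cox
  construction are determined by these data.\<close>

definition toric_cox_data ::
  "(rat^'n) set set \<Rightarrow> ('r::finite \<Rightarrow> int^'n) \<Rightarrow> ('g, 'm) monoid_scheme \<Rightarrow> ('r \<Rightarrow> 'g) \<Rightarrow> bool" where
  "toric_cox_data \<Sigma> v G w \<longleftrightarrow>
     is_fan \<Sigma> \<and> primitive_ray_generators \<Sigma> v \<and>
     vec.span (range (\<lambda>i. rat_vec (v i))) = UNIV \<and>
     fg_abelian_group G \<and>
     (\<exists>\<phi>\<in>iso (additive_group Mod range (cox_dual_map v)) G.
        \<forall>i. \<phi> (range (cox_dual_map v) #>\<^bsub>additive_group\<^esub> axis i 1) = w i)"

definition orthant :: "(rat^'r) set" where
  "orthant = {x. \<forall>i. 0 \<le> x $ i}"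

definition cox_fan :: "(rat^'n) set set \<Rightarrow> ('r::finite \<Rightarrow> int^'n) \<Rightarrow> (rat^'r) set set" where
  "cox_fan \<Sigma> v = {\<tau>. cone_face \<tau> orthant \<and> (\<exists>\<sigma>\<in>\<Sigma>. cox_map v ` \<tau> \<subseteq> \<sigma>)}"

text \<open>\<open>\<kappa>\<close> is a model of \<open>G \<rightarrow> \<rat> \<otimes> G\<close>: its kernel is the torsion subgroup, so the linear span of its
  image is \<open>\<rat> \<otimes> G\<close>. The span may be smaller than the ambient space, which has no effect on
  relative interiors.\<close>

definition rationalization :: "('g, 'm) monoid_scheme \<Rightarrow> ('g \<Rightarrow> rat^'r) \<Rightarrow> bool" where
  "rationalization G \<kappa> \<longleftrightarrow>
     \<kappa> \<in> hom G additive_group \<and>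
     (\<forall>x\<in>carrier G. \<kappa> x = 0 \<longleftrightarrow> (\<exists>n::nat. 0 < n \<and> x [^]\<^bsub>G\<^esub> n = \<one>\<^bsub>G\<^esub>))"

definition rat_degree_map :: "('g \<Rightarrow> rat^'r) \<Rightarrow> ('r::finite \<Rightarrow> 'g) \<Rightarrow> rat^'r \<Rightarrow> rat^'r" where
  "rat_degree_map \<kappa> w x = (\<Sum>i\<in>UNIV. x $ i *s \<kappa> (w i))"

definition star_face :: "(rat^'r) set \<Rightarrow> (rat^'r) set" where
  "star_face \<delta>\<^sub>0 = perp \<delta>\<^sub>0 \<inter> dual_cone orthant"

definition compatible_collection ::
  "('g \<Rightarrow> rat^'r) \<Rightarrow> ('r::finite \<Rightarrow> 'g) \<Rightarrow> (rat^'r) set set \<Rightarrow> bool" where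
  "compatible_collection \<kappa> w C \<longleftrightarrow>
     (\<forall>\<delta>\<in>C. cone_face \<delta> orthant) \<and>
     (\<forall>\<delta>\<^sub>1\<in>C. \<forall>\<delta>\<^sub>2\<in>C. relint (rat_degree_map \<kappa> w ` star_face \<delta>\<^sub>1) \<inter>
                   relint (rat_degree_map \<kappa> w ` star_face \<delta>\<^sub>2) \<noteq> {})"

text \<open>The rank of \<open>\<rat> \<otimes> G\<close> is at most the number of rays, so \<open>\<kappa>\<close> exists; the notion does not depend
  on the choice.\<close>

definition maximal_projectable_fan ::
  "('g, 'm) monoid_scheme \<Rightarrow> ('r::finite \<Rightarrow> 'g) \<Rightarrow> (rat^'r) set set \<Rightarrow> bool" where
  "maximal_projectable_fan G w S \<longleftrightarrow>
     (\<exists>\<kappa>. rationalization G \<kappa> \<and>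
        (\<exists>C. compatible_collection \<kappa> w C \<and>
           (\<forall>C'. compatible_collection \<kappa> w C' \<and> C \<subseteq> C' \<longrightarrow> C' = C) \<and>
           S = {\<tau>. \<exists>\<delta>\<in>C. cone_face \<tau> \<delta>}))"


section \<open>Admissible polynomials and their ambient modification\<close>

text \<open>The rays of the subdivided cone are indexed by \<open>D\<close> (in place of \<open>1, \<dots>, d\<close>). The variables
  after the subdivision are indexed by \<open>'r option\<close>, with \<open>None\<close> for the new ray.\<close>

definition weight :: "'r set \<Rightarrow> ('r \<Rightarrow> nat) \<Rightarrow> ('r \<Rightarrow>\<^sub>0 nat) \<Rightarrow> nat" where
  "weight D a \<mu> = (\<Sum>i\<in>D. a i * Poly_Mapping.lookup \<mu> i)"

definition weight_part :: "'r set \<Rightarrow> ('r \<Rightarrow> nat) \<Rightarrow> ('r, 'k::comm_ring_1) mpoly \<Rightarrow> nat \<Rightarrow> ('r, 'k) mpoly" where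
  "weight_part D a f k = (\<Sum>\<mu>\<in>{\<mu> \<in> Poly_Mapping.keys f. weight D a \<mu> = k}.
     Poly_Mapping.single \<mu> (Poly_Mapping.lookup f \<mu>))"

definition lowest_weight :: "'r set \<Rightarrow> ('r \<Rightarrow> nat) \<Rightarrow> ('r, 'k::comm_ring_1) mpoly \<Rightarrow> nat" where
  "lowest_weight D a f = Min (weight D a ` Poly_Mapping.keys f)"

definition admissible ::
  "('g, 'm) monoid_scheme \<Rightarrow> ('r option \<Rightarrow> 'g) \<Rightarrow> 'r set \<Rightarrow> ('r \<Rightarrow> nat)
    \<Rightarrow> ('r, 'k::comm_ring_1) mpoly \<Rightarrow> bool" where
  "admissible G\<^sub>1 w\<^sub>1 D a f \<longleftrightarrow>
     f \<noteq> 0 \<and>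
     (\<exists>x. (\<forall>i. x i = 0 \<longleftrightarrow> i \<in> D) \<and> poly_eval x f = 0) \<and>
     (let g = weight_part D a f (lowest_weight D a f)
      in graded_prime_elem G\<^sub>1 mpoly_ring (poly_component G\<^sub>1 w\<^sub>1) (poly_subst (\<lambda>i. Var (Some i)) g) \<and>
         2 \<le> card (poly_vars g))"

definition ambient_lift ::
  "'r set \<Rightarrow> ('r \<Rightarrow> nat) \<Rightarrow> ('r, 'k::comm_ring_1) mpoly \<Rightarrow> ('r option, 'k) mpoly" where
  "ambient_lift D a f =
     (THE q. q * Var None ^ lowest_weight D a f =
        poly_subst (\<lambda>i. if i \<in> D then Var None ^ a i * Var (Some i) else Var (Some i)) f)"

text \<open>Replaces \<open>T\<^sub>\<infinity>^(l * m)\<close> by \<open>T\<^sub>\<infinity>^l\<close>; only meaningful if \<open>m\<close> divides all exponents of \<open>T\<^sub>\<infinity>\<close>.\<close>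

definition take_root :: "nat \<Rightarrow> ('r option, 'k::comm_ring_1) mpoly \<Rightarrow> ('r option, 'k) mpoly" where
  "take_root m p = (\<Sum>\<mu>\<in>Poly_Mapping.keys p.
     Poly_Mapping.single (Poly_Mapping.update None (Poly_Mapping.lookup \<mu> None div m) \<mu>)
       (Poly_Mapping.lookup p \<mu>))"

end

theory Submission
  imports Defs
begin

text \<open>Write \<open>f\<close> for \<open>f\<^sub>0\<close>, \<open>F\<close> for \<open>f\<^sub>1'\<close> and \<open>Tinf\<close> for the new variable, and let \<open>L\<^sub>0\<close>, \<open>L\<^sub>1\<close> be
  the images of the maps \<open>u \<mapsto> (\<langle>u, v\<^sub>i\<rangle>)\<^sub>i\<close> and \<open>u \<mapsto> ((\<langle>u, v\<^sub>i\<rangle>)\<^sub>i, \<langle>u, v\<^sub>\<infinity>\<rangle>)\<close>. These are the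
  lattices of exponents with \<open>K\<^sub>0 = \<int>\<^sup>r / L\<^sub>0\<close> and \<open>K\<^sub>1 = \<int>\<^sup>r\<^sup>+\<^sup>1 / L\<^sub>1\<close>, so a polynomial is
  homogeneous iff its exponents lie in one coset of the lattice.

  Since the rays span, forgetting the last coordinate maps \<open>L\<^sub>1\<close> bijectively onto \<open>L\<^sub>0\<close>. In
  other words \<open>Tinf\<close> has a degree of infinite order, and \<open>K\<^sub>0\<close> is the quotient of \<open>K\<^sub>1\<close> by it.
  Hence the substitution \<open>Tinf = 1\<close> behaves like the dehomogenization of projective geometry:
  \<open>K\<^sub>0\<close>-homogeneous polynomials lift to \<open>K\<^sub>1\<close>-homogeneous ones (\<open>homogenize\<close>), and two lifts
  differ by powers of \<open>Tinf\<close> (\<open>homogenization_unique\<close>). Two monomials of \<open>f\<close> differ by some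
  \<open>(\<langle>u, v\<^sub>i\<rangle>)\<^sub>i\<close>, so their weights differ by \<open>m \<langle>u, v\<^sub>\<infinity>\<rangle>\<close> (\<open>weight_difference\<close>); therefore only
  powers of \<open>Tinf\<^sup>m\<close> occur in \<open>f\<^sub>1\<close>, and \<open>F\<close> is a lift of \<open>f\<close> that is not divisible by \<open>Tinf\<close>.
  Up to inverting \<open>Tinf\<close>, homogeneous ideal theory modulo \<open>F\<close> is thus the one modulo \<open>f\<close>.
  Setting \<open>Tinf = 0\<close> turns \<open>F\<close> into the part \<open>g\<close> of \<open>f\<close> of lowest weight, so admissibility says
  exactly what is missing: \<open>Tinf\<close> is \<open>K\<^sub>1\<close>-prime modulo \<open>F\<close>.

  The graded statement is now Nagata's argument (\<open>minprime_principal\<close>). A minimal nonzero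
  homogeneous prime ideal \<open>J\<close> modulo \<open>F\<close> that contains \<open>Tinf\<close> is generated by it. Otherwise \<open>J\<close>
  dehomogenizes to a minimal nonzero homogeneous prime ideal modulo \<open>f\<close>, which is principal; a
  lift of its generator generates \<open>J\<close> once superfluous factors \<open>Tinf\<close> are removed. Two points
  need separate arguments. The lift requires a homogeneous generator; it exists because the
  characters of the grading group act on the ring and multiply a generator by units, that is by
  constants (\<open>homogeneous_generator\<close>). And as \<open>K\<^sub>1\<close> may have torsion, primeness on homogeneous
  elements does not show that the ring is a domain with constant units. For this the grading by
  \<open>K\<^sub>1\<close> is replaced by a grading by \<open>\<int>\<close>, with weights \<open>- a\<^sub>i\<close> and \<open>m\<close>, for which \<open>F\<close> is
  homogeneous as well (\<open>weighted_homogenization\<close>).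

  If \<open>K\<^sub>0\<close> is torsion-free then so is \<open>K\<^sub>1\<close>, and \<open>L\<^sub>1\<close> is the common kernel of finitely many
  integral functionals (\<open>saturated_lattice_functionals\<close>). Chains of prime ideals have bounded
  length (\<open>cprime_minimal\<close>), so every nonzero homogeneous prime ideal contains a minimal one and
  with it a homogeneous prime element; by Kaplansky's criterion homogeneous elements are
  products of homogeneous primes (\<open>kaplansky\<close>). Dropping one functional makes the grading
  coarser by a factor \<open>\<int>\<close>, and factorization into primes survives, by the division argument that
  shows that polynomial rings over factorial rings are factorial (\<open>coarsening_step\<close>). When no
  functional is left, every element is homogeneous and the ring is factorial.

  All this is done for ideals of the polynomial ring that contain \<open>F\<close>, with type class
  arithmetic; \<open>factorially_graded_iff\<close> and \<open>factorial_domain_quot_ring\<close> translate to the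
  quotient ring.\<close>

abbreviation (input) keys where "keys \<equiv> Poly_Mapping.keys"
abbreviation (input) lookup where "lookup \<equiv> Poly_Mapping.lookup"
abbreviation (input) single where "single \<equiv> Poly_Mapping.single"

section \<open>Maps and restrictions of exponents\<close>

lemma sum_of_monomials: "p = (\<Sum>\<mu>\<in>keys p. single \<mu> (lookup p \<mu>))"
  by (rule poly_mapping_eqI) (auto simp: lookup_sum lookup_single when_def in_keys_iff)

text \<open>Multiplicativity of the maps below is checked on monomials; this rule performs the reduction.\<close>

lemma mpoly_induct [case_names zero add]:
  fixes p :: "'a \<Rightarrow>\<^sub>0 'b::comm_monoid_add"
  assumes "P 0" and step: "\<And>p \<mu> c. P p \<Longrightarrow> P (p + single \<mu> c)"
  shows "P p"
proof -
  have "P (\<Sum>\<mu>\<in>S. single \<mu> (lookup p \<mu>))" if "finite S" for S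
    using that
  proof induction
    case (insert \<mu> S)
    then show ?case using step[OF insert.IH, of \<mu> "lookup p \<mu>"] by (simp add: add.commute)
  qed (simp add: assms(1))
  then show ?thesis
    using sum_of_monomials[of p] by (metis finite_keys)
qed

text \<open>Substitutions that send monomials to monomials, such as \<open>Tinf = 1\<close> or renaming variables, act
  on exponents only. Coefficients of exponents with the same image are added.\<close>

definition push :: "('a \<Rightarrow> 'b) \<Rightarrow> ('a \<Rightarrow>\<^sub>0 'k::comm_monoid_add) \<Rightarrow> ('b \<Rightarrow>\<^sub>0 'k)" where
  "push h p = (\<Sum>\<mu>\<in>keys p. single (h \<mu>) (lookup p \<mu>))"

lemma push_superset:
  "finite S \<Longrightarrow> keys p \<subseteq> S \<Longrightarrow> push h p = (\<Sum>\<mu>\<in>S. single (h \<mu>) (lookup p \<mu>))"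
  unfolding push_def by (rule sum.mono_neutral_left) (auto simp: in_keys_iff)

lemma push_0 [simp]: "push h 0 = 0"
  by (simp add: push_def)

lemma push_single [simp]: "push h (single \<mu> c) = single (h \<mu>) c"
  by (simp add: push_def)

lemma push_add: "push h (p + q) = push h p + push h q"
proof -
  let ?S = "keys p \<union> keys q"
  have "push h r = (\<Sum>\<mu>\<in>?S. single (h \<mu>) (lookup r \<mu>))" if "keys r \<subseteq> ?S" for r
    using that by (intro push_superset) auto
  from this[of "p + q"] this[of p] this[of q] show ?thesis
    by (simp add: keys_add lookup_add single_add sum.distrib)
qed

lemma push_uminus: "push h (- p) = - push h (p :: _ \<Rightarrow>\<^sub>0 'k::ab_group_add)"
  using push_add[of h p "-p"] by (simp add: eq_neg_iff_add_eq_0 add.commute)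

lemma push_diff: "push h (p - q) = push h p - push h (q :: _ \<Rightarrow>\<^sub>0 'k::ab_group_add)"
  using push_add[of h p "-q"] by (simp add: push_uminus)

lemma push_sum: "push h (\<Sum>i\<in>I. p i) = (\<Sum>i\<in>I. push h (p i))"
  by (induction I rule: infinite_finite_induct) (auto simp: push_add)

lemma push_mult:
  fixes p q :: "'a::comm_monoid_add \<Rightarrow>\<^sub>0 'k::comm_ring_1"
  assumes h: "\<And>\<mu> \<nu>. h (\<mu> + \<nu>) = (h \<mu> + h \<nu> :: 'b::comm_monoid_add)"
  shows "push h (p * q) = push h p * push h q"
proof (induction p rule: mpoly_induct)
  case (add p \<mu> c)
  have "push h (single \<mu> c * q) = single (h \<mu>) c * push h q"
    by (induction q rule: mpoly_induct) (auto simp: distrib_left push_add mult_single h)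
  then show ?case by (simp add: distrib_right push_add add)
qed auto

lemma push_1: "h 0 = 0 \<Longrightarrow> push h (1 :: 'a::zero \<Rightarrow>\<^sub>0 'k::{comm_monoid_add,zero_neq_one}) = (1 :: 'b::zero \<Rightarrow>\<^sub>0 'k)"
  by (metis push_single single_one)

lemma lookup_push: "lookup (push h p) \<nu> = (\<Sum>\<mu>\<in>{\<mu>\<in>keys p. h \<mu> = \<nu>}. lookup p \<mu>)"
  by (auto simp: push_def lookup_sum lookup_single when_def sum.inter_filter[symmetric])

lemma keys_push: "keys (push h p) \<subseteq> h ` keys p"
proof
  fix \<nu> assume "\<nu> \<in> keys (push h p)"
  then have "{\<mu>\<in>keys p. h \<mu> = \<nu>} \<noteq> {}"
    by (metis in_keys_iff lookup_push sum.empty)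
  then show "\<nu> \<in> h ` keys p" by auto
qed

lemma keys_pushE:
  assumes "\<nu> \<in> keys (push h p)"
  obtains \<mu> where "\<mu> \<in> keys p" "\<nu> = h \<mu>"
  using subsetD[OF keys_push assms] by (rule imageE) (rule that)

lemma lookup_push_inj:
  assumes "inj_on h (keys p)" "\<mu> \<in> keys p"
  shows "lookup (push h p) (h \<mu>) = lookup p \<mu>"
proof -
  have "{\<mu>'\<in>keys p. h \<mu>' = h \<mu>} = {\<mu>}"
    using assms by (auto simp: inj_on_def)
  then show ?thesis by (simp add: lookup_push)
qed

lemma keys_push_inj: "inj_on h (keys p) \<Longrightarrow> keys (push h p) = h ` keys p"
  using keys_push[of h p] lookup_push_inj[of h p] by (fastforce simp: in_keys_iff)

lemma push_push: "push g (push h p) = push (g \<circ> h) p"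
  by (induction p rule: mpoly_induct) (auto simp: push_add)

lemma push_cong: "(\<And>\<mu>. \<mu> \<in> keys p \<Longrightarrow> h \<mu> = h' \<mu>) \<Longrightarrow> push h p = push h' p"
  by (simp add: push_def)

lemma push_id: "(\<And>\<mu>. \<mu> \<in> keys p \<Longrightarrow> h \<mu> = \<mu>) \<Longrightarrow> push h p = p"
  by (simp add: push_def sum_of_monomials[symmetric])

definition part :: "('a \<Rightarrow> bool) \<Rightarrow> ('a \<Rightarrow>\<^sub>0 'k::zero) \<Rightarrow> ('a \<Rightarrow>\<^sub>0 'k)" where
  "part Q p = Poly_Mapping.mapp (\<lambda>\<mu> c. if Q \<mu> then c else 0) p"

lemma lookup_part: "lookup (part Q p) \<mu> = (if Q \<mu> then lookup p \<mu> else 0)"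
  by (auto simp: part_def lookup_mapp when_def in_keys_iff)

lemma keys_part: "keys (part Q p) = {\<mu>\<in>keys p. Q \<mu>}"
  by (auto simp: in_keys_iff lookup_part split: if_splits)

lemma part_0 [simp]: "part Q 0 = 0"
  by (rule poly_mapping_eqI) (simp add: lookup_part)

lemma part_add: "part Q (p + q) = part Q p + part Q q"
  by (rule poly_mapping_eqI) (simp add: lookup_part lookup_add)

lemma part_diff: "part Q (p - q) = part Q p - part Q (q :: _ \<Rightarrow>\<^sub>0 'k::ab_group_add)"
  by (rule poly_mapping_eqI) (simp add: lookup_part lookup_minus)

lemma part_sum: "part Q (\<Sum>i\<in>I. p i) = (\<Sum>i\<in>I. part Q (p i))"
  by (induction I rule: infinite_finite_induct) (auto simp: part_add)

lemma part_all: "(\<And>\<mu>. \<mu> \<in> keys p \<Longrightarrow> Q \<mu>) \<Longrightarrow> part Q p = p"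
  by (rule poly_mapping_eqI) (auto simp: lookup_part in_keys_iff)

lemma part_none: "(\<And>\<mu>. \<mu> \<in> keys p \<Longrightarrow> \<not> Q \<mu>) \<Longrightarrow> part Q p = 0"
  by (rule poly_mapping_eqI) (auto simp: lookup_part in_keys_iff)

lemma part_split: "p = part Q p + part (\<lambda>\<mu>. \<not> Q \<mu>) (p :: _ \<Rightarrow>\<^sub>0 'k::comm_monoid_add)"
  by (rule poly_mapping_eqI) (auto simp: lookup_part lookup_add)

lemma part_cong: "(\<And>\<mu>. \<mu> \<in> keys p \<Longrightarrow> Q \<mu> = Q' \<mu>) \<Longrightarrow> part Q p = part Q' p"
  by (rule poly_mapping_eqI) (auto simp: lookup_part in_keys_iff)

lemma part_part: "part Q (part Q' p) = part (\<lambda>\<mu>. Q \<mu> \<and> Q' \<mu>) p"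
  by (rule poly_mapping_eqI) (auto simp: lookup_part)

lemma keys_multE:
  assumes "\<mu> \<in> keys (p * q)"
  obtains \<alpha> \<beta> where "\<alpha> \<in> keys p" "\<beta> \<in> keys q" "\<mu> = \<alpha> + \<beta>"
  using keys_mult[of p q] assms by blast

text \<open>Covers both the homogeneous components of a product with a homogeneous factor and the
  restriction of a product to a face: the factor \<open>p\<close> must shift the condition \<open>Q'\<close> to \<open>Q\<close>.\<close>

lemma part_mult:
  fixes p q :: "'a::comm_monoid_add \<Rightarrow>\<^sub>0 'k::comm_ring_1"
  assumes "\<And>\<mu> \<nu>. \<mu> \<in> keys p \<Longrightarrow> Q (\<mu> + \<nu>) \<longleftrightarrow> Q' \<nu>"
  shows "part Q (p * q) = p * part Q' q"
proof -
  have "part Q (p * q) = part Q (p * part Q' q) + part Q (p * part (\<lambda>\<mu>. \<not> Q' \<mu>) q)"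
    by (metis distrib_left part_add part_split)
  also have "part Q (p * part Q' q) = p * part Q' q"
    by (rule part_all) (auto elim!: keys_multE simp: keys_part assms)
  also have "part Q (p * part (\<lambda>\<mu>. \<not> Q' \<mu>) q) = 0"
    by (rule part_none) (auto elim!: keys_multE simp: keys_part assms)
  finally show ?thesis by simp
qed

lemma part_fibres:
  fixes p :: "'a \<Rightarrow>\<^sub>0 'k::comm_monoid_add"
  assumes "finite S" "d ` keys p \<subseteq> S"
  shows "p = (\<Sum>g\<in>S. part (\<lambda>\<mu>. d \<mu> = g) p)"
proof (rule poly_mapping_eqI)
  fix \<mu>
  show "lookup p \<mu> = lookup (\<Sum>g\<in>S. part (\<lambda>\<mu>. d \<mu> = g) p) \<mu>"
    using assms by (cases "\<mu> \<in> keys p") (auto simp: lookup_sum lookup_part in_keys_iff)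
qed

unbundle no fps_syntax

lemma nonzero_key: "p \<noteq> 0 \<Longrightarrow> \<exists>\<mu>. \<mu> \<in> keys p"
  by (metis ex_in_conv keys_eq_empty)

section \<open>Gradings\<close>

definition ivec :: "('v::finite \<Rightarrow>\<^sub>0 nat) \<Rightarrow> int^'v" where
  "ivec \<mu> = (\<chi> i. int (lookup \<mu> i))"

lemma ivec_nth [simp]: "ivec \<mu> $ i = int (lookup \<mu> i)"
  by (simp add: ivec_def)

lemma ivec_add: "ivec (\<mu> + \<nu>) = ivec \<mu> + ivec \<nu>"
  by (simp add: vec_eq_iff lookup_add)

lemma ivec_0 [simp]: "ivec 0 = 0"
  by (simp add: vec_eq_iff)

definition add_subgroup :: "'a::ab_group_add set \<Rightarrow> bool" where
  "add_subgroup L \<longleftrightarrow> 0 \<in> L \<and> (\<forall>x\<in>L. \<forall>y\<in>L. x - y \<in> L)"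

lemma add_subgroup_0: "add_subgroup L \<Longrightarrow> 0 \<in> L"
  and add_subgroup_diff: "add_subgroup L \<Longrightarrow> x \<in> L \<Longrightarrow> y \<in> L \<Longrightarrow> x - y \<in> L"
  by (auto simp: add_subgroup_def)

lemma add_subgroup_uminus: "add_subgroup L \<Longrightarrow> x \<in> L \<Longrightarrow> - x \<in> L"
  using add_subgroup_diff[of L 0 x] add_subgroup_0 by auto

lemma add_subgroup_add: "add_subgroup L \<Longrightarrow> x \<in> L \<Longrightarrow> y \<in> L \<Longrightarrow> x + y \<in> L"
  using add_subgroup_diff[of L x "-y"] add_subgroup_uminus by auto

lemma add_subgroup_diff_iff: "add_subgroup L \<Longrightarrow> x - y \<in> L \<Longrightarrow> x \<in> L \<longleftrightarrow> y \<in> L"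
  using add_subgroup_diff[of L x "x - y"] add_subgroup_add[of L "x - y" y] by auto

text \<open>A grading of the polynomial ring by a quotient of the group of exponents is given by the
  subgroup \<open>L\<close> alone, and a degree by any representative \<open>\<kappa>\<close>. Coarsening the grading means
  enlarging \<open>L\<close>.\<close>

definition homd :: "(int^'v) set \<Rightarrow> int^'v \<Rightarrow> ('v::finite, 'k::comm_ring_1) mpoly \<Rightarrow> bool" where
  "homd L \<kappa> p \<longleftrightarrow> (\<forall>\<mu>\<in>keys p. ivec \<mu> - \<kappa> \<in> L)"

definition homog :: "(int^'v) set \<Rightarrow> ('v::finite, 'k::comm_ring_1) mpoly \<Rightarrow> bool" where
  "homog L p \<longleftrightarrow> (\<exists>\<kappa>. homd L \<kappa> p)"

definition hcomp :: "(int^'v) set \<Rightarrow> int^'v \<Rightarrow> ('v::finite, 'k::comm_ring_1) mpoly \<Rightarrow> ('v, 'k) mpoly" where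
  "hcomp L \<kappa> p = part (\<lambda>\<mu>. ivec \<mu> - \<kappa> \<in> L) p"

lemma homogI: "homd L \<kappa> p \<Longrightarrow> homog L p"
  by (auto simp: homog_def)

lemma homd_0 [simp]: "homd L \<kappa> 0"
  by (simp add: homd_def)

lemma homd_Const: "add_subgroup L \<Longrightarrow> homd L 0 (Const c)"
  by (simp add: homd_def Const_def add_subgroup_0)

lemma homd_1: "add_subgroup L \<Longrightarrow> homd L 0 1"
  by (simp add: homd_def add_subgroup_0)

lemma homog_0 [simp]: "homog L 0"
  by (auto simp: homog_def)

lemma homog_1: "add_subgroup L \<Longrightarrow> homog L 1"
  using homd_1 homogI by blast

lemma homd_add: "homd L \<kappa> p \<Longrightarrow> homd L \<kappa> q \<Longrightarrow> homd L \<kappa> (p + q)"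
  unfolding homd_def using keys_add[of p q] by blast

lemma homd_diff: "homd L \<kappa> p \<Longrightarrow> homd L \<kappa> q \<Longrightarrow> homd L \<kappa> (p - q)"
  unfolding homd_def using keys_diff[of p q] by blast

lemma homd_mult:
  assumes "add_subgroup L" "homd L \<kappa> p" "homd L \<rho> q"
  shows "homd L (\<kappa> + \<rho>) (p * q)"
  unfolding homd_def
proof
  fix \<mu> assume "\<mu> \<in> keys (p * q)"
  then obtain \<alpha> \<beta> where *: "\<alpha> \<in> keys p" "\<beta> \<in> keys q" "\<mu> = \<alpha> + \<beta>"
    by (rule keys_multE)
  then have "(ivec \<alpha> - \<kappa>) + (ivec \<beta> - \<rho>) \<in> L"
    using assms by (intro add_subgroup_add) (auto simp: homd_def)
  then show "ivec \<mu> - (\<kappa> + \<rho>) \<in> L"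
    by (simp add: * ivec_add algebra_simps)
qed

lemma homog_mult: "add_subgroup L \<Longrightarrow> homog L p \<Longrightarrow> homog L q \<Longrightarrow> homog L (p * q)"
  unfolding homog_def using homd_mult by blast

lemma homog_power: "add_subgroup L \<Longrightarrow> homog L p \<Longrightarrow> homog L (p ^ n)"
  by (induction n) (auto intro: homog_1 homog_mult)

lemma homd_cong: "add_subgroup L \<Longrightarrow> homd L \<kappa> p \<Longrightarrow> \<kappa> - \<rho> \<in> L \<Longrightarrow> homd L \<rho> p"
  unfolding homd_def
proof
  fix \<mu> assume a: "add_subgroup L" "\<forall>\<mu>\<in>keys p. ivec \<mu> - \<kappa> \<in> L" "\<kappa> - \<rho> \<in> L" "\<mu> \<in> keys p"
  then have "(ivec \<mu> - \<kappa>) + (\<kappa> - \<rho>) \<in> L" by (metis add_subgroup_add)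
  then show "ivec \<mu> - \<rho> \<in> L" by simp
qed

lemma homd_unique:
  "add_subgroup L \<Longrightarrow> homd L \<kappa> p \<Longrightarrow> homd L \<rho> p \<Longrightarrow> p \<noteq> 0 \<Longrightarrow> \<kappa> - \<rho> \<in> L"
proof -
  assume a: "add_subgroup L" "homd L \<kappa> p" "homd L \<rho> p" "p \<noteq> 0"
  then obtain \<mu> where "\<mu> \<in> keys p" using nonzero_key by blast
  then have "(ivec \<mu> - \<rho>) - (ivec \<mu> - \<kappa>) \<in> L"
    using a unfolding homd_def by (metis add_subgroup_diff)
  then show ?thesis by simp
qed

lemma homd_hcomp [simp]: "homd L \<kappa> (hcomp L \<kappa> p)"
  by (auto simp: homd_def hcomp_def keys_part)

lemma homog_hcomp [simp]: "homog L (hcomp L \<kappa> p)"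
  using homd_hcomp homogI by blast

lemma hcomp_homd: "homd L \<kappa> p \<Longrightarrow> hcomp L \<kappa> p = p"
  by (auto simp: homd_def hcomp_def intro: part_all)

lemma hcomp_homd_other:
  assumes "add_subgroup L" "homd L \<kappa> p" "\<kappa> - \<rho> \<notin> L"
  shows "hcomp L \<rho> p = 0"
  unfolding hcomp_def
proof (rule part_none, rule notI)
  fix \<mu> assume *: "\<mu> \<in> keys p" "ivec \<mu> - \<rho> \<in> L"
  then have "ivec \<mu> - \<kappa> \<in> L" using assms by (auto simp: homd_def)
  from add_subgroup_diff[OF assms(1) *(2) this] have "(ivec \<mu> - \<rho>) - (ivec \<mu> - \<kappa>) \<in> L" .
  then show False using assms by simp
qed

lemma hcomp_0 [simp]: "hcomp L \<kappa> 0 = 0"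
  by (simp add: hcomp_def)

lemma hcomp_add: "hcomp L \<kappa> (p + q) = hcomp L \<kappa> p + hcomp L \<kappa> q"
  by (simp add: hcomp_def part_add)

lemma hcomp_diff: "hcomp L \<kappa> (p - q) = hcomp L \<kappa> p - hcomp L \<kappa> q"
  by (simp add: hcomp_def part_diff)

lemma hcomp_sum: "hcomp L \<kappa> (\<Sum>i\<in>I. p i) = (\<Sum>i\<in>I. hcomp L \<kappa> (p i))"
  by (simp add: hcomp_def part_sum)

lemma hcomp_mult:
  assumes L: "add_subgroup L" and p: "homd L \<kappa> p"
  shows "hcomp L \<rho> (p * q) = p * hcomp L (\<rho> - \<kappa>) q"
  unfolding hcomp_def
proof (rule part_mult)
  fix \<mu> \<nu> assume "\<mu> \<in> keys p"
  then have "ivec \<mu> - \<kappa> \<in> L" using p by (auto simp: homd_def)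
  then show "ivec (\<mu> + \<nu>) - \<rho> \<in> L \<longleftrightarrow> ivec \<nu> - (\<rho> - \<kappa>) \<in> L"
    by (intro add_subgroup_diff_iff[OF L]) (simp add: ivec_add algebra_simps)
qed

lemma hcomp_decomposition:
  assumes L: "add_subgroup L"
  obtains S where "finite S" "p = (\<Sum>\<kappa>\<in>S. hcomp L \<kappa> p)"
    "\<And>\<kappa> \<rho>. \<kappa> \<in> S \<Longrightarrow> \<rho> \<in> S \<Longrightarrow> \<kappa> - \<rho> \<in> L \<Longrightarrow> \<kappa> = \<rho>" "\<And>\<kappa>. \<kappa> \<in> S \<Longrightarrow> hcomp L \<kappa> p \<noteq> 0"
proof -
  define r where "r x = (SOME y. x - y \<in> L)" for x
  have r: "x - r x \<in> L" for x
    unfolding r_def by (rule someI[of _ x]) (simp add: add_subgroup_0[OF L])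
  have r_eq: "r x = r y" if "x - y \<in> L" for x y
  proof -
    have "x - z \<in> L \<longleftrightarrow> y - z \<in> L" for z
      using that by (intro add_subgroup_diff_iff[OF L]) simp
    then show ?thesis by (simp add: r_def)
  qed
  define S where "S = (r \<circ> ivec) ` keys p"
  have rr: "r (r x) = r x" for x
    using r_eq[OF r[of x]] by simp
  have rS: "r g = g" if "g \<in> S" for g
    using that rr by (auto simp: S_def)
  have *: "part (\<lambda>\<mu>. (r \<circ> ivec) \<mu> = g) p = hcomp L g p" if "g \<in> S" for g
    unfolding hcomp_def
  proof (rule part_cong)
    fix \<mu> assume "\<mu> \<in> keys p"
    show "((r \<circ> ivec) \<mu> = g) = (ivec \<mu> - g \<in> L)"
      using r[of "ivec \<mu>"] r_eq[of "ivec \<mu>" g] rS[OF that] by auto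
  qed
  show ?thesis
  proof (rule that[of S])
    show "p = (\<Sum>\<kappa>\<in>S. hcomp L \<kappa> p)"
      using part_fibres[of S "r \<circ> ivec" p] * by (simp add: S_def)
    show "\<kappa> = \<rho>" if "\<kappa> \<in> S" "\<rho> \<in> S" "\<kappa> - \<rho> \<in> L" for \<kappa> \<rho>
      using that r_eq[of \<kappa> \<rho>] rS by metis
    show "hcomp L \<kappa> p \<noteq> 0" if "\<kappa> \<in> S" for \<kappa>
    proof -
      obtain \<mu> where "\<mu> \<in> keys p" "\<kappa> = r (ivec \<mu>)" using \<open>\<kappa> \<in> S\<close> unfolding S_def by (metis imageE comp_apply)
      then have "\<mu> \<in> keys (hcomp L \<kappa> p)" by (simp add: hcomp_def keys_part r)
      then show ?thesis by auto
    qed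
  qed (simp add: S_def)
qed

section \<open>Ideals\<close>

text \<open>Ideals of the quotient by \<open>F\<close> are treated as ideals of the polynomial ring that contain \<open>F\<close>,
  so that the arithmetic of the type class is available.\<close>

definition cideal :: "'a::comm_ring_1 set \<Rightarrow> bool" where
  "cideal I \<longleftrightarrow> 0 \<in> I \<and> (\<forall>a\<in>I. \<forall>b\<in>I. a + b \<in> I) \<and> (\<forall>a\<in>I. \<forall>r. r * a \<in> I)"

lemma cideal_0: "cideal I \<Longrightarrow> 0 \<in> I"
  and cideal_add: "cideal I \<Longrightarrow> a \<in> I \<Longrightarrow> b \<in> I \<Longrightarrow> a + b \<in> I"
  and cideal_mult: "cideal I \<Longrightarrow> a \<in> I \<Longrightarrow> r * a \<in> I"
  and cideal_mult2: "cideal I \<Longrightarrow> a \<in> I \<Longrightarrow> a * r \<in> I"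
  by (auto simp: cideal_def mult.commute)

lemma cideal_uminus: "cideal I \<Longrightarrow> a \<in> I \<Longrightarrow> - a \<in> I"
  using cideal_mult[of I a "-1"] by simp

lemma cideal_diff: "cideal I \<Longrightarrow> a \<in> I \<Longrightarrow> b \<in> I \<Longrightarrow> a - b \<in> I"
  using cideal_add[of I a "-b"] cideal_uminus[of I b] by simp

lemma cideal_sum: "cideal I \<Longrightarrow> (\<And>i. i \<in> S \<Longrightarrow> f i \<in> I) \<Longrightarrow> (\<Sum>i\<in>S. f i) \<in> I"
  by (induction S rule: infinite_finite_induct) (auto intro: cideal_0 cideal_add)

lemma cideal_dvd: "cideal I \<Longrightarrow> a \<in> I \<Longrightarrow> a dvd b \<Longrightarrow> b \<in> I"
  by (auto simp: dvd_def intro: cideal_mult2)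

lemma cideal_diff_iff: "cideal I \<Longrightarrow> a - b \<in> I \<Longrightarrow> a \<in> I \<longleftrightarrow> b \<in> I"
  using cideal_diff[of I a "a - b"] cideal_add[of I "a - b" b] by auto

definition adjoin :: "'a::comm_ring_1 set \<Rightarrow> 'a \<Rightarrow> 'a set" where
  "adjoin M i = {p. \<exists>b. p - i * b \<in> M}"

lemma adjoinI: "p - i * b \<in> M \<Longrightarrow> p \<in> adjoin M i"
  by (auto simp: adjoin_def)

lemma adjoin_sup: "M \<subseteq> adjoin M i"
  by (auto intro: adjoinI[of _ _ 0])

lemma adjoin_gen: "cideal M \<Longrightarrow> i \<in> adjoin M i"
  by (rule adjoinI[of _ _ 1]) (simp add: cideal_0)

lemma cideal_adjoin:
  assumes M: "cideal M"
  shows "cideal (adjoin M i)"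
  unfolding cideal_def
proof (intro conjI ballI allI)
  show "0 \<in> adjoin M i" using adjoin_sup cideal_0[OF M] by blast
next
  fix p q assume "p \<in> adjoin M i" "q \<in> adjoin M i"
  then obtain b c where *: "p - i * b \<in> M" "q - i * c \<in> M" by (auto simp: adjoin_def)
  have "p + q - i * (b + c) = (p - i * b) + (q - i * c)" by (simp add: algebra_simps)
  then have "p + q - i * (b + c) \<in> M" using cideal_add[OF M *] by metis
  then show "p + q \<in> adjoin M i" by (rule adjoinI)
next
  fix p r assume "p \<in> adjoin M i"
  then obtain b where *: "p - i * b \<in> M" by (auto simp: adjoin_def)
  have "r * p - i * (r * b) = r * (p - i * b)" by (simp add: algebra_simps)
  then have "r * p - i * (r * b) \<in> M" using cideal_mult[OF M *] by simp
  then show "r * p \<in> adjoin M i" by (rule adjoinI)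
qed

text \<open>The preimage of the principal ideal generated by the class of \<open>i\<close> modulo \<open>F\<close>.\<close>

definition pid :: "'a::comm_ring_1 \<Rightarrow> 'a \<Rightarrow> 'a set" where
  "pid F i = {p. \<exists>b. F dvd p - i * b}"

lemma pid_memI: "F dvd p - i * b \<Longrightarrow> p \<in> pid F i"
  by (auto simp: pid_def)

lemma pid_gen [simp]: "i \<in> pid F i" "F \<in> pid F i"
  by (rule pid_memI[of _ _ _ 1], simp) (rule pid_memI[of _ _ _ 0], simp)

lemma pid_eq_adjoin: "pid F i = adjoin {p. F dvd p} i"
  by (simp add: pid_def adjoin_def)

lemma cideal_multiples: "cideal {p. F dvd p}"
  by (auto simp: cideal_def)

lemma cideal_pid [simp]: "cideal (pid F i)"
  unfolding pid_eq_adjoin by (rule cideal_adjoin[OF cideal_multiples])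

lemma pid_least: "cideal I \<Longrightarrow> F \<in> I \<Longrightarrow> i \<in> I \<Longrightarrow> pid F i \<subseteq> I"
  unfolding pid_def by (auto intro: cideal_diff_iff[THEN iffD2] cideal_mult2 cideal_dvd)

text \<open>For an ideal, this says that it is homogeneous.\<close>

definition hcomp_closed :: "(int^'v) set \<Rightarrow> ('v::finite, 'k::comm_ring_1) mpoly set \<Rightarrow> bool" where
  "hcomp_closed L J \<longleftrightarrow> (\<forall>p\<in>J. \<forall>\<kappa>. hcomp L \<kappa> p \<in> J)"

lemma hcomp_closed_multiples:
  assumes "add_subgroup L" "homog L F"
  shows "hcomp_closed L {p. F dvd p}"
  using assms by (auto simp: hcomp_closed_def homog_def dvd_def hcomp_mult)

lemma hcomp_closed_adjoin:
  assumes L: "add_subgroup L" and M: "hcomp_closed L M" and i: "homog L i"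
  shows "hcomp_closed L (adjoin M i)"
  unfolding hcomp_closed_def
proof (intro ballI allI)
  fix p \<kappa> assume "p \<in> adjoin M i"
  then obtain b where *: "p - i * b \<in> M" by (auto simp: adjoin_def)
  obtain \<rho> where \<rho>: "homd L \<rho> i" using i by (auto simp: homog_def)
  have "hcomp L \<kappa> (p - i * b) \<in> M" using M * by (auto simp: hcomp_closed_def)
  then show "hcomp L \<kappa> p \<in> adjoin M i"
    by (intro adjoinI[of _ _ "hcomp L (\<kappa> - \<rho>) b"]) (simp add: hcomp_diff hcomp_mult[OF L \<rho>])
qed

lemma hcomp_closed_pid:
  assumes "add_subgroup L" "homog L F" "homog L i"
  shows "hcomp_closed L (pid F i)"
  unfolding pid_eq_adjoin
  by (rule hcomp_closed_adjoin[OF assms(1) hcomp_closed_multiples[OF assms(1,2)] assms(3)])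

text \<open>The largest homogeneous ideal inside a given ideal; primes of a graded ring are compared with
  homogeneous primes through it.\<close>

lemma cideal_homogeneous_core:
  assumes L: "add_subgroup L" and J: "cideal J"
  shows "cideal {p. \<forall>\<kappa>. hcomp L \<kappa> p \<in> J}"
  unfolding cideal_def
proof (intro conjI ballI allI)
  show "0 \<in> {p. \<forall>\<kappa>. hcomp L \<kappa> p \<in> J}" by (simp add: cideal_0[OF J])
  show "p + q \<in> {p. \<forall>\<kappa>. hcomp L \<kappa> p \<in> J}"
    if "p \<in> {p. \<forall>\<kappa>. hcomp L \<kappa> p \<in> J}" "q \<in> {p. \<forall>\<kappa>. hcomp L \<kappa> p \<in> J}" for p q
    using that cideal_add[OF J] by (simp add: hcomp_add)
  show "r * p \<in> {p. \<forall>\<kappa>. hcomp L \<kappa> p \<in> J}" if p: "p \<in> {p. \<forall>\<kappa>. hcomp L \<kappa> p \<in> J}" for p r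
    unfolding mem_Collect_eq
  proof
    fix \<kappa>
    obtain S where S: "r = (\<Sum>\<rho>\<in>S. hcomp L \<rho> r)" using hcomp_decomposition[OF L] by metis
    have "hcomp L \<kappa> (r * p) = (\<Sum>\<rho>\<in>S. hcomp L \<rho> r * hcomp L (\<kappa> - \<rho>) p)"
      by (subst S) (simp add: sum_distrib_right hcomp_sum hcomp_mult[OF L homd_hcomp])
    also have "\<dots> \<in> J"
      using p by (intro cideal_sum[OF J] cideal_mult[OF J]) simp
    finally show "hcomp L \<kappa> (r * p) \<in> J" .
  qed
qed

lemma nonzero_homogeneous:
  assumes L: "add_subgroup L" "hcomp_closed L J" and p: "p \<in> J" "\<not> G dvd p"
  obtains q where "q \<in> J" "homog L q" "\<not> G dvd q"
proof -
  obtain S where S: "p = (\<Sum>\<kappa>\<in>S. hcomp L \<kappa> p)"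
    using hcomp_decomposition[OF L(1)] by metis
  obtain \<kappa> where "\<not> G dvd hcomp L \<kappa> p" using p(2) S dvd_sum by metis
  moreover have "hcomp L \<kappa> p \<in> J" using L(2) p(1) by (auto simp: hcomp_closed_def)
  ultimately show ?thesis using that homog_hcomp by blast
qed

lemma pid_eq_multiples: "F dvd i \<Longrightarrow> pid F i = {p. F dvd p}"
proof
  assume "F dvd i"
  then show "pid F i \<subseteq> {p. F dvd p}" by (intro pid_least cideal_multiples) auto
  show "{p. F dvd p} \<subseteq> pid F i" using cideal_dvd[OF cideal_pid pid_gen(2)] by blast
qed

definition hprime :: "(int^'v) set \<Rightarrow> ('v::finite, 'k::comm_ring_1) mpoly set \<Rightarrow> bool" where
  "hprime L J \<longleftrightarrow> 1 \<notin> J \<and> (\<forall>p q. homog L p \<longrightarrow> homog L q \<longrightarrow> p * q \<in> J \<longrightarrow> p \<in> J \<or> q \<in> J)"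

definition gprime :: "(int^'v) set \<Rightarrow> ('v::finite, 'k::comm_ring_1) mpoly \<Rightarrow> ('v, 'k) mpoly set \<Rightarrow> bool" where
  "gprime L F J \<longleftrightarrow> cideal J \<and> F \<in> J \<and> hcomp_closed L J \<and> hprime L J"

text \<open>The zero ideal of the quotient is prime when \<open>F\<close> is, so these are the preimages of the
  homogeneous prime ideals of height one.\<close>

definition minprime :: "(int^'v) set \<Rightarrow> ('v::finite, 'k::comm_ring_1) mpoly \<Rightarrow> ('v, 'k) mpoly set \<Rightarrow> bool" where
  "minprime L F J \<longleftrightarrow> gprime L F J \<and> (\<exists>p\<in>J. \<not> F dvd p) \<and>
     (\<forall>J'. gprime L F J' \<longrightarrow> J' \<subseteq> J \<longrightarrow> (\<exists>p\<in>J'. \<not> F dvd p) \<longrightarrow> J' = J)"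

definition prime_mod :: "'a::comm_ring_1 \<Rightarrow> bool" where
  "prime_mod F \<longleftrightarrow> \<not> F dvd 1 \<and> (\<forall>p q. F dvd p * q \<longrightarrow> F dvd p \<or> F dvd q)"

definition const_units :: "('v, 'k::comm_ring_1) mpoly \<Rightarrow> bool" where
  "const_units F \<longleftrightarrow> (\<forall>p q. F dvd p * q - 1 \<longrightarrow> (\<exists>c. c \<noteq> 0 \<and> F dvd p - Const c))"

text \<open>Graded factoriality of the quotient by \<open>F\<close>, for the grading by \<open>L\<close>.\<close>

definition gfactorial :: "(int^'v) set \<Rightarrow> ('v::finite, 'k::comm_ring_1) mpoly \<Rightarrow> bool" where
  "gfactorial L F \<longleftrightarrow> prime_mod F \<and> const_units F \<and>
     (\<forall>J. minprime L F J \<longrightarrow> (\<exists>i. J = pid F i))"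

section \<open>Integrality and Noetherianity\<close>

lemma inj_push: "inj h \<Longrightarrow> inj (push h :: _ \<Rightarrow> _ \<Rightarrow>\<^sub>0 'k::comm_monoid_add)"
proof (rule injI, rule poly_mapping_eqI)
  fix p q :: "_ \<Rightarrow>\<^sub>0 'k" and \<mu> assume *: "inj h" "push h p = push h q"
  have "lookup (push h r) (h \<mu>) = lookup r \<mu>" for r :: "_ \<Rightarrow>\<^sub>0 'k"
  proof (cases "\<mu> \<in> keys r")
    case False
    then have "h \<mu> \<notin> keys (push h r)" using keys_push[of h r] *(1) by (auto dest: injD)
    with False show ?thesis by (simp add: in_keys_iff)
  qed (use *(1) in \<open>auto intro: lookup_push_inj inj_on_subset\<close>)
  then show "lookup p \<mu> = lookup q \<mu>" by (metis *(2))
qed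

text \<open>Polynomials in variables indexed by natural numbers form a domain, because their exponents are
  linearly ordered; finitely many variables are renamed injectively into that ring.\<close>

lemma mpoly_no_zero_divisors:
  fixes p q :: "('v::finite, 'k::idom) mpoly"
  assumes "p * q = 0"
  shows "p = 0 \<or> q = 0"
proof -
  let ?e = "push (push (to_nat :: 'v \<Rightarrow> nat) :: ('v \<Rightarrow>\<^sub>0 nat) \<Rightarrow> _) :: ('v, 'k) mpoly \<Rightarrow> _"
  have inj: "inj ?e" by (intro inj_push inj_to_nat)
  have "?e p * ?e q = 0" using assms by (metis push_mult push_add push_0)
  then have "?e p = 0 \<or> ?e q = 0" by simp
  then show ?thesis using injD[OF inj, of _ 0] by auto
qed

lemma mpoly_mult_cancel:
  fixes p q r :: "('v::finite, 'k::idom) mpoly"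
  assumes "r * p = r * q" "r \<noteq> 0"
  shows "p = q"
  using mpoly_no_zero_divisors[of r "p - q"] assms by (auto simp: algebra_simps)

lemma nat_seq_mono_subseq:
  fixes f :: "nat \<Rightarrow> nat"
  obtains r where "strict_mono r" "incseq (f \<circ> r)"
proof -
  obtain g where g: "strict_mono g" "monoseq (\<lambda>n. f (g n))"
    using seq_monosub[of f] by blast
  show ?thesis
  proof (cases "incseq (\<lambda>n. f (g n))")
    case True
    then show ?thesis using that g by (auto simp: o_def)
  next
    case False
    then have dec: "decseq (\<lambda>n. f (g n))" using g by (auto simp: monoseq_iff)
    define m where "m = (LEAST m. m \<in> range (\<lambda>n. f (g n)))"
    obtain N where N: "m = f (g N)"
      using LeastI[of "\<lambda>m. m \<in> range (\<lambda>n. f (g n))"] unfolding m_def by blast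
    have "f (g (n + N)) = m" for n
      using decseqD[OF dec, of N "n + N"] Least_le[of "\<lambda>m. m \<in> range (\<lambda>n. f (g n))" "f (g (n+N))"] N
      by (auto simp: m_def)
    then show ?thesis
      using g by (intro that[of "\<lambda>n. g (n + N)"]) (auto simp: strict_mono_def incseq_def o_def)
  qed
qed

lemma dickson:
  fixes s :: "nat \<Rightarrow> ('v::finite \<Rightarrow>\<^sub>0 nat)"
  obtains i j \<delta> where "i < j" "s j = s i + \<delta>"
proof -
  have "\<exists>r. strict_mono r \<and> (\<forall>v\<in>W. incseq (\<lambda>n. lookup (s (r n)) v))" if "finite W" for W :: "'v set"
    using that
  proof induction
    case empty
    show ?case by (auto intro: exI[of _ id] simp: strict_mono_def)
  next
    case (insert w W)
    then obtain r where r: "strict_mono r" "\<forall>v\<in>W. incseq (\<lambda>n. lookup (s (r n)) v)" by blast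
    obtain t where t: "strict_mono t" "incseq ((\<lambda>n. lookup (s (r n)) w) \<circ> t)"
      by (rule nat_seq_mono_subseq)
    have "incseq (\<lambda>n. lookup (s (r (t n))) v)" if "v \<in> W" for v
      using r(2) that t(1) by (auto simp: incseq_def strict_mono_less_eq)
    then show ?case
      using t r by (intro exI[of _ "r \<circ> t"]) (auto simp: strict_mono_def o_def)
  qed
  from this[of UNIV] obtain r where r: "strict_mono r" "\<And>v. incseq (\<lambda>n. lookup (s (r n)) v)" by auto
  have "r 0 < r 1" using r(1) by (simp add: strict_mono_def)
  moreover have "s (r 1) = s (r 0) + (s (r 1) - s (r 0))"
    using r(2) by (intro poly_mapping_eqI) (auto simp: lookup_add lookup_minus incseq_def)
  ultimately show ?thesis using that by blast
qed

text \<open>Transports the lexicographic order on exponents with indices in \<open>nat\<close> to an arbitrary finite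
  set of variables.\<close>

definition mord :: "('v::finite \<Rightarrow>\<^sub>0 nat) \<Rightarrow> (nat \<Rightarrow>\<^sub>0 nat)" where
  "mord \<mu> = push to_nat \<mu>"

lemma mord_add: "mord (\<mu> + \<nu>) = mord \<mu> + mord \<nu>"
  by (simp add: mord_def push_add)

lemma inj_mord: "inj mord"
  unfolding mord_def[abs_def] by (intro inj_push) simp

lemma zero_le_pm: "(0 :: nat \<Rightarrow>\<^sub>0 nat) \<le> x"
proof (rule ccontr)
  assume "\<not> 0 \<le> x"
  then have "x < 0" by simp
  then show False by transfer (auto simp: less_fun_def)
qed

text \<open>A strictly decreasing sequence of exponents contradicts Dickson's lemma, since a later
  exponent is a multiple of an earlier one, and a multiple is not smaller.\<close>

lemma wf_mord: "wf {(\<mu>, \<nu> :: 'v::finite \<Rightarrow>\<^sub>0 nat). mord \<mu> < mord \<nu>}"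
  unfolding wf_iff_no_infinite_down_chain
proof
  assume "\<exists>s. \<forall>i. (s (Suc i), s i) \<in> {(\<mu>, \<nu> :: 'v \<Rightarrow>\<^sub>0 nat). mord \<mu> < mord \<nu>}"
  then obtain s :: "nat \<Rightarrow> 'v \<Rightarrow>\<^sub>0 nat" where s: "\<And>i. mord (s (Suc i)) < mord (s i)" by auto
  obtain i j \<delta> where ij: "i < j" "s j = s i + \<delta>" by (rule dickson)
  have "i < j \<Longrightarrow> mord (s j) < mord (s i)" for j
    by (induction j) (auto simp: less_Suc_eq intro: order.strict_trans s)
  then have "mord (s j) < mord (s i)" using ij(1) .
  moreover have "mord (s i) + 0 \<le> mord (s j)"
    unfolding ij(2) mord_add by (intro add_left_mono zero_le_pm)
  ultimately show False by simp
qed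

definition lmon :: "('v::finite, 'k::zero) mpoly \<Rightarrow> ('v \<Rightarrow>\<^sub>0 nat)" where
  "lmon p = arg_max_on mord (keys p)"

lemma lmon:
  assumes "p \<noteq> 0"
  shows "lmon p \<in> keys p" "\<mu> \<in> keys p \<Longrightarrow> mord \<mu> \<le> mord (lmon p)"
proof -
  have "finite (keys p)" "keys p \<noteq> {}" using assms by auto
  then have "Max (mord ` keys p) \<in> mord ` keys p" by (intro Max_in) auto
  then obtain m where m: "m \<in> keys p" "Max (mord ` keys p) = mord m" by auto
  have m': "mord \<mu> \<le> mord m" if "\<mu> \<in> keys p" for \<mu>
    unfolding m(2)[symmetric] using that by simp
  have "is_arg_max mord (\<lambda>x. x \<in> keys p) m"
    using m m' by (auto simp: is_arg_max_def not_less)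
  then have "is_arg_max mord (\<lambda>x. x \<in> keys p) (lmon p)"
    unfolding lmon_def arg_max_on_def arg_max_def by (rule someI)
  then show "lmon p \<in> keys p" "\<mu> \<in> keys p \<Longrightarrow> mord \<mu> \<le> mord (lmon p)"
    by (auto simp: is_arg_max_def not_less)
qed

lemma lmon_reduce:
  fixes p q :: "('v::finite, 'k::field) mpoly"
  assumes "p \<noteq> 0" "q \<noteq> 0" "lmon q = lmon p + \<delta>"
  obtains c where "q - single \<delta> c * p = 0 \<or> mord (lmon (q - single \<delta> c * p)) < mord (lmon q)"
proof -
  define c where "c = lookup q (lmon q) / lookup p (lmon p)"
  let ?r = "q - single \<delta> c * p"
  have keys_sp: "\<exists>\<alpha>\<in>keys p. \<mu> = \<delta> + \<alpha>" if "\<mu> \<in> keys (single \<delta> c * p)" for \<mu>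
    using that by (auto elim!: keys_multE split: if_splits)
  have lookup_sp: "lookup (single \<delta> c * p) (\<delta> + \<alpha>) = c * lookup p \<alpha>" for \<alpha>
  proof (induction p rule: mpoly_induct)
    case (add p \<mu> d)
    then show ?case by (auto simp: distrib_left lookup_add mult_single lookup_single when_def)
  qed auto
  have le: "mord \<mu> \<le> mord (lmon q)" if mu: "\<mu> \<in> keys ?r" for \<mu>
  proof -
    consider "\<mu> \<in> keys q" | "\<mu> \<in> keys (single \<delta> c * p)"
      using mu keys_diff[of q "single \<delta> c * p"] by blast
    then show ?thesis
    proof cases
      case 2
      then obtain \<alpha> where "\<alpha> \<in> keys p" "\<mu> = \<delta> + \<alpha>" using keys_sp by blast
      then show ?thesis using lmon(2)[OF assms(1)] assms(3)
        by (metis add.commute mord_add add_left_mono)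
    qed (use lmon(2)[OF assms(2)] in blast)
  qed
  have "lookup ?r (lmon q) = 0"
    using lookup_sp[of "lmon p"] lmon(1)[OF assms(1)] assms(3)
    by (simp add: lookup_minus c_def add.commute in_keys_iff)
  then have "lmon q \<notin> keys ?r" by (simp add: in_keys_iff)
  then have "?r \<noteq> 0 \<Longrightarrow> mord (lmon ?r) \<noteq> mord (lmon q)"
    using lmon(1)[of ?r] inj_mord by (metis injD)
  then show ?thesis using le[OF lmon(1)] that[of c] by fastforce
qed

text \<open>In an infinite ascending chain take, at every step, a new polynomial of smallest leading
  exponent. By Dickson's lemma one leading exponent is a multiple of an earlier one, and
  subtracting a multiple of the earlier polynomial gives a new polynomial with a smaller leading
  exponent.\<close>

lemma wf_ideals:
  "wf {(I', I :: ('v::finite, 'k::field) mpoly set). cideal I \<and> cideal I' \<and> I \<subset> I'}"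
  unfolding wf_iff_no_infinite_down_chain
proof
  assume "\<exists>I. \<forall>n. (I (Suc n), I n) \<in> {(I', I :: ('v, 'k) mpoly set). cideal I \<and> cideal I' \<and> I \<subset> I'}"
  then obtain I :: "nat \<Rightarrow> ('v, 'k) mpoly set" where
    "\<And>n. (I (Suc n), I n) \<in> {(I', I :: ('v, 'k) mpoly set). cideal I \<and> cideal I' \<and> I \<subset> I'}" by blast
  then have I: "\<And>n. cideal (I n)" "\<And>n. I n \<subset> I (Suc n)" by blast+
  have mono: "I m \<subseteq> I n" if "m \<le> n" for m n
    using lift_Suc_mono_le[of I, OF _ that] I(2) by blast
  have "\<exists>p. p \<in> I (Suc n) - I n \<and> (\<forall>q\<in>I (Suc n) - I n. \<not> mord (lmon q) < mord (lmon p))" for n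
  proof -
    obtain p where "p \<in> I (Suc n) - I n" using I(2)[of n] by blast
    then obtain q where "q \<in> I (Suc n) - I n"
        "\<And>y. (y, q) \<in> inv_image {(\<mu>, \<nu>). mord \<mu> < mord \<nu>} lmon \<Longrightarrow> y \<notin> I (Suc n) - I n"
      using wfE_min[OF wf_inv_image[OF wf_mord]] by metis
    then show ?thesis unfolding inv_image_def by blast
  qed
  then obtain p where p: "\<And>n. p n \<in> I (Suc n) - I n"
      "\<And>n q. q \<in> I (Suc n) - I n \<Longrightarrow> \<not> mord (lmon q) < mord (lmon (p n))"
    by metis
  obtain i j \<delta> where ij: "i < j" "lmon (p j) = lmon (p i) + \<delta>"
    using dickson[of "\<lambda>n. lmon (p n)"] by blast
  have "p n \<noteq> 0" for n using p(1)[of n] cideal_0[OF I(1)] by auto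
  then obtain c where c: "p j - single \<delta> c * p i = 0 \<or>
      mord (lmon (p j - single \<delta> c * p i)) < mord (lmon (p j))"
    using lmon_reduce ij(2) by metis
  have "p i \<in> I j" using p(1)[of i] mono[of "Suc i" j] ij(1) by auto
  then have *: "single \<delta> c * p i \<in> I j" using cideal_mult[OF I(1)] by blast
  then have mem: "p j - single \<delta> c * p i \<in> I (Suc j)"
    using cideal_diff[OF I(1)] p(1)[of j] mono[of j "Suc j"] by (metis DiffD1 le_SucI order_refl subsetD)
  have nin: "p j - single \<delta> c * p i \<notin> I j"
    using cideal_add[OF I(1) _ *] p(1)[of j] by (metis DiffD2 diff_add_cancel)
  have "p j - single \<delta> c * p i \<noteq> 0" using nin cideal_0[OF I(1)] by metis
  then show False using p(2)[of _ j] c mem nin by blast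
qed

lemma noetherian_maximal:
  fixes Y :: "('v::finite, 'k::field) mpoly set set"
  assumes "\<And>I. I \<in> Y \<Longrightarrow> cideal I" "I0 \<in> Y"
  obtains M where "M \<in> Y" "\<And>I. I \<in> Y \<Longrightarrow> \<not> M \<subset> I"
proof -
  obtain M where M: "M \<in> Y" "\<And>I. (I, M) \<in> {(I', I). cideal I \<and> cideal I' \<and> I \<subset> I'} \<Longrightarrow> I \<notin> Y"
    using wfE_min[OF wf_ideals assms(2)] by blast
  then have "\<not> M \<subset> I" if "I \<in> Y" for I
    using assms(1) that by (metis (mono_tags, lifting) case_prodI mem_Collect_eq)
  then show ?thesis using that M(1) by blast
qed

section \<open>Characters and homogeneous generators\<close>

definition character_on :: "(int^'v) set \<Rightarrow> (int^'v::finite \<Rightarrow> 'k::field) \<Rightarrow> bool" where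
  "character_on H \<zeta> \<longleftrightarrow> (\<forall>x\<in>H. \<forall>y\<in>H. \<zeta> (x + y) = \<zeta> x * \<zeta> y) \<and> (\<forall>x\<in>H. \<zeta> x \<noteq> 0)"

lemma character_on_0: "add_subgroup H \<Longrightarrow> character_on H \<zeta> \<Longrightarrow> \<zeta> 0 = 1"
  unfolding character_on_def using add_subgroup_0[of H] by (metis add.right_neutral mult_cancel_left2)

lemma character_on_diff:
  assumes "add_subgroup H" "character_on H \<zeta>" "x \<in> H" "y \<in> H"
  shows "\<zeta> (x - y) = \<zeta> x / \<zeta> y"
proof -
  have "\<zeta> ((x - y) + y) = \<zeta> (x - y) * \<zeta> y"
    using assms add_subgroup_diff unfolding character_on_def by blast
  then show ?thesis using assms by (simp add: character_on_def)
qed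

lemma add_subgroup_scale:
  assumes "add_subgroup H" "x \<in> H"
  shows "(k::int) *s x \<in> H"
proof (induction k rule: int_induct[where k = 0])
  case base
  then show ?case using assms add_subgroup_0 by simp
next
  case (step1 i)
  then show ?case using assms add_subgroup_add[of H "i *s x" x] by (simp add: vector_sadd_rdistrib)
next
  case (step2 i)
  have "(i - 1) *s x = i *s x - x" by (simp add: vec_eq_iff algebra_simps)
  then show ?case using step2 assms add_subgroup_diff[of H "i *s x" x] by simp
qed

lemma character_on_scale:
  assumes "add_subgroup H" "character_on H \<zeta>" "x \<in> H"
  shows "\<zeta> (k *s x) = \<zeta> x powi k"
proof (induction k rule: int_induct[where k = 0])
  case base
  then show ?case using assms by (simp add: character_on_0)
next
  case (step1 i)
  have "\<zeta> (i *s x + x) = \<zeta> (i *s x) * \<zeta> x"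
    using assms add_subgroup_scale unfolding character_on_def by blast
  moreover have "\<zeta> x \<noteq> 0" using assms by (auto simp: character_on_def)
  ultimately show ?case using step1 by (simp add: vector_sadd_rdistrib power_int_add)
next
  case (step2 i)
  have "(i - 1) *s x = i *s x - x" by (simp add: vec_eq_iff algebra_simps)
  moreover have "\<zeta> (i *s x - x) = \<zeta> (i *s x) / \<zeta> x"
    using assms add_subgroup_scale character_on_diff by blast
  moreover have "\<zeta> x \<noteq> 0" using assms by (auto simp: character_on_def)
  ultimately show ?case using step2 by (simp add: power_int_diff)
qed

text \<open>Characteristic zero matters for \<open>c = 1\<close>: there is a \<open>d\<close>-th root of unity other than 1, because
  1 is not a zero of \<open>1 + y + \<dots> + y\<^sup>d\<^sup>-\<^sup>1\<close>.\<close>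

lemma nontrivial_root:
  fixes c :: "'k::{alg_closed_field, field_char_0}"
  assumes "2 \<le> d" "c \<noteq> 0"
  obtains y where "y ^ d = c" "y \<noteq> 1"
proof (cases "c = 1")
  case False
  obtain y where "y ^ d = c" using nth_root_exists[of d c] assms by auto
  then show ?thesis using that False by (metis power_one)
next
  case True
  obtain y :: 'k where "(\<Sum>i\<le>d - 1. 1 * y ^ i) = 0"
    using alg_closed[of "d - 1" "\<lambda>_. 1"] assms by auto
  moreover have "{..d - 1} = {..<d}" using assms by auto
  ultimately have y: "(\<Sum>i<d. y ^ i) = 0" by simp
  then have "y \<noteq> 1" using assms by auto
  moreover have "y ^ d = 1" using power_diff_1_eq[of y d] y by simp
  ultimately show ?thesis using that True by simp
qed

text \<open>The multiples of \<open>x\<close> that lie in \<open>H\<close> are those of \<open>d *s x\<close> for some \<open>d\<close>, so the value at \<open>x\<close>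
  may be any \<open>d\<close>-th root of the value at \<open>d *s x\<close>, or any nonzero number if \<open>d = 0\<close>. If \<open>x\<close> is
  not in \<open>H\<close> then \<open>d \<noteq> 1\<close>, and the root can be chosen different from 1.\<close>

lemma character_extend:
  fixes \<zeta> :: "int^'v::finite \<Rightarrow> 'k::{alg_closed_field, field_char_0}"
  assumes H: "add_subgroup H" and \<zeta>: "character_on H \<zeta>"
  obtains H' \<zeta>' where "add_subgroup H'" "character_on H' \<zeta>'" "H \<subseteq> H'" "x \<in> H'"
    "\<And>h. h \<in> H \<Longrightarrow> \<zeta>' h = \<zeta> h" "x \<notin> H \<Longrightarrow> \<zeta>' x \<noteq> 1"
proof (cases "x \<in> H")
  case True
  then show ?thesis using that[OF assms] by blast
next
  case False
  obtain d :: nat and y :: 'k where d: "\<And>n. n *s x \<in> H \<Longrightarrow> int d dvd n" "int d *s x \<in> H"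
    and y: "y \<noteq> 0" "y ^ d = \<zeta> (int d *s x)" "y \<noteq> 1"
  proof (cases "\<exists>n>0. int n *s x \<in> H")
    case True
    define d where "d = (LEAST n. n > 0 \<and> int n *s x \<in> H)"
    have d: "d > 0" "int d *s x \<in> H"
      using LeastI_ex[OF True] by (simp_all add: d_def)
    have dvd: "int d dvd n" if "n *s x \<in> H" for n
    proof (rule ccontr)
      assume "\<not> int d dvd n"
      then have m: "n mod int d > 0" 
        using d(1) pos_mod_sign[of "int d" n] by (metis dvd_eq_mod_eq_0 le_less of_nat_0_less_iff)
      have "(n mod int d) *s x = n *s x - (n div int d) *s (int d *s x)"
        by (simp add: vec_eq_iff minus_div_mult_eq_mod[symmetric] algebra_simps)
      then have "(n mod int d) *s x \<in> H"
        using add_subgroup_diff[OF H that] add_subgroup_scale[OF H d(2)] by simp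
      then have "d \<le> nat (n mod int d)"
        unfolding d_def using m by (intro Least_le) (simp add: d_def[symmetric])
      moreover have "n mod int d < int d" using d(1) by simp
      ultimately show False using m by linarith
    qed
    have "d \<noteq> 1" using d(2) False by (auto simp: vec_eq_iff[symmetric])
    then have d2: "2 \<le> d" using d(1) by simp
    have nz: "\<zeta> (int d *s x) \<noteq> 0" using \<zeta> d(2) by (auto simp: character_on_def)
    obtain y where "y ^ d = \<zeta> (int d *s x)" "y \<noteq> 1"
      using nontrivial_root[OF d2 nz] .
    then show ?thesis using that[OF dvd d(2), of y] nz d(1) by (metis zero_power)
  next
    case none: False
    have "n = 0" if n: "n *s x \<in> H" for n
    proof (rule ccontr)
      assume "n \<noteq> 0"
      then have "n > 0 \<or> - n > 0" by linarith
      moreover have "- (n *s x) \<in> H" using add_subgroup_uminus[OF H that] .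
      moreover have "- (n *s x) = (-n) *s x" by (simp add: vec_eq_iff)
      ultimately obtain k where "k > 0" "k *s x \<in> H" using n by (elim disjE) metis+
      then show False using none by (metis zero_less_imp_eq_int of_nat_0_less_iff)
    qed
    then show ?thesis using that[of 0 2] add_subgroup_0[OF H] character_on_0[OF H \<zeta>] by auto
  qed
  define H' where "H' = {h + n *s x | h n. h \<in> H}"
  define \<zeta>' where "\<zeta>' z = (THE c. \<exists>h n. h \<in> H \<and> z = h + n *s x \<and> c = \<zeta> h * y powi n)" for z
  have wd: "\<zeta> h * y powi n = \<zeta> h' * y powi n'"
    if "h \<in> H" "h' \<in> H" "h + n *s x = h' + n' *s x" for h h' n n'
  proof -
    have eq: "(n - n') *s x = h' - h"
      using that(3) by (simp add: vec_eq_iff algebra_simps)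
    then have "(n - n') *s x \<in> H" using add_subgroup_diff[OF H that(2,1)] by simp
    then obtain k where k: "n - n' = int d * k" using d(1) by (auto simp: dvd_def)
    have "\<zeta> h' / \<zeta> h = \<zeta> (h' - h)" using character_on_diff[OF H \<zeta> that(2,1)] by simp
    also have "h' - h = k *s (int d *s x)" unfolding eq[symmetric] k by (simp add: vec_eq_iff algebra_simps)
    also have "\<zeta> \<dots> = (y ^ d) powi k" using character_on_scale[OF H \<zeta> d(2)] y(2) by simp
    also have "\<dots> = y powi (n - n')" by (simp add: k power_int_mult)
    also have "\<dots> = y powi n / y powi n'" using y(1) by (simp add: power_int_diff)
    finally show ?thesis using \<zeta> that y(1) by (auto simp: character_on_def field_simps)
  qed
  have \<zeta>': "\<zeta>' (h + n *s x) = \<zeta> h * y powi n" if "h \<in> H" for h n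
    unfolding \<zeta>'_def
  proof (rule the_equality)
    show "\<exists>h' n'. h' \<in> H \<and> h + n *s x = h' + n' *s x \<and> \<zeta> h * y powi n = \<zeta> h' * y powi n'"
      using that by blast
  next
    fix c assume "\<exists>h' n'. h' \<in> H \<and> h + n *s x = h' + n' *s x \<and> c = \<zeta> h' * y powi n'"
    then show "c = \<zeta> h * y powi n" using wd that by metis
  qed
  show ?thesis
  proof (rule that[of H' \<zeta>'])
    show "add_subgroup H'"
      unfolding add_subgroup_def
    proof (intro conjI ballI)
      show "0 \<in> H'" unfolding H'_def
        using add_subgroup_0[OF H] by (intro CollectI exI[of _ 0]) auto
      fix a b assume "a \<in> H'" "b \<in> H'"
      then obtain h n h' n' where *: "h \<in> H" "h' \<in> H" "a = h + n *s x" "b = h' + n' *s x"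
        by (auto simp: H'_def)
      have "a - b = (h - h') + (n - n') *s x" using * by (simp add: vec_eq_iff algebra_simps)
      then show "a - b \<in> H'" unfolding H'_def using add_subgroup_diff[OF H *(1,2)] by blast
    qed
    show "character_on H' \<zeta>'"
      unfolding character_on_def
    proof (intro conjI ballI)
      fix a b assume "a \<in> H'" "b \<in> H'"
      then obtain h n h' n' where *: "h \<in> H" "h' \<in> H" "a = h + n *s x" "b = h' + n' *s x"
        by (auto simp: H'_def)
      have "a + b = (h + h') + (n + n') *s x" using * by (simp add: vec_eq_iff algebra_simps)
      then have "\<zeta>' (a + b) = \<zeta> (h + h') * y powi (n + n')"
        using \<zeta>' add_subgroup_add[OF H *(1,2)] by metis
      also have "\<dots> = (\<zeta> h * y powi n) * (\<zeta> h' * y powi n')"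
        using \<zeta> * y(1) by (simp add: character_on_def power_int_add)
      also have "\<dots> = \<zeta>' a * \<zeta>' b" using \<zeta>' * by simp
      finally show "\<zeta>' (a + b) = \<zeta>' a * \<zeta>' b" .
    next
      fix a assume "a \<in> H'"
      then obtain h n where *: "h \<in> H" "a = h + n *s x"
        by (auto simp: H'_def)
      then show "\<zeta>' a \<noteq> 0" using \<zeta>' y(1) \<zeta> by (auto simp: character_on_def)
    qed
    have *: "h \<in> H \<Longrightarrow> h = h + 0 *s x" for h by (simp add: vec_eq_iff)
    then show "H \<subseteq> H'" unfolding H'_def by blast
    have x: "x = 0 + 1 *s x" by (simp add: vec_eq_iff)
    then show "x \<in> H'" using add_subgroup_0[OF H] unfolding H'_def by blast
    show "\<zeta>' h = \<zeta> h" if "h \<in> H" for h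
      using \<zeta>'[OF that, of 0] by simp
    show "\<zeta>' x \<noteq> 1"
      using \<zeta>'[OF add_subgroup_0[OF H], of 1] character_on_0[OF H \<zeta>] y(3) by simp
  qed
qed

text \<open>Extend the trivial character of \<open>L\<close> first to \<open>z\<close>, with a value other than 1, and then to the
  standard basis.\<close>

lemma character_separates:
  fixes L :: "(int^'v::finite) set"
  assumes L: "add_subgroup L" and z: "z \<notin> L"
  obtains \<zeta> :: "int^'v \<Rightarrow> 'k::{alg_closed_field, field_char_0}"
  where "character_on UNIV \<zeta>" "\<And>x. x \<in> L \<Longrightarrow> \<zeta> x = 1" "\<zeta> z \<noteq> 1"
proof -
  have 1: "character_on L (\<lambda>_. 1 :: 'k)" by (simp add: character_on_def)
  obtain H\<^sub>1 \<zeta>\<^sub>1 where H1: "add_subgroup H\<^sub>1" "character_on H\<^sub>1 \<zeta>\<^sub>1" "L \<subseteq> H\<^sub>1" "z \<in> H\<^sub>1"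
    "\<And>h. h \<in> L \<Longrightarrow> \<zeta>\<^sub>1 h = (1::'k)" "\<zeta>\<^sub>1 z \<noteq> 1"
    using character_extend[OF L 1, of z] z by metis
  have "\<exists>H \<zeta>. add_subgroup H \<and> character_on H \<zeta> \<and> H\<^sub>1 \<subseteq> H \<and> (\<forall>h\<in>H\<^sub>1. \<zeta> h = \<zeta>\<^sub>1 h) \<and> (\<forall>i\<in>S. axis i 1 \<in> H)"
    if "finite S" for S :: "'v set"
    using that
  proof induction
    case empty
    then show ?case using H1 by blast
  next
    case (insert i S)
    then obtain H \<zeta> where *: "add_subgroup H" "character_on H \<zeta>" "H\<^sub>1 \<subseteq> H" "\<forall>h\<in>H\<^sub>1. \<zeta> h = \<zeta>\<^sub>1 h"
      "\<forall>i\<in>S. axis i 1 \<in> H" by blast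
    obtain H' \<zeta>' where "add_subgroup H'" "character_on H' \<zeta>'" "H \<subseteq> H'" "axis i 1 \<in> H'"
      "\<And>h. h \<in> H \<Longrightarrow> \<zeta>' h = \<zeta> h"
      using character_extend[OF *(1,2), of "axis i 1"] by metis
    then show ?case using *(3-) by (intro exI[of _ H'] exI[of _ \<zeta>']) auto
  qed
  from this[of UNIV] obtain H \<zeta> where *: "add_subgroup H" "character_on H \<zeta>" "H\<^sub>1 \<subseteq> H"
      "\<forall>h\<in>H\<^sub>1. \<zeta> h = \<zeta>\<^sub>1 h" "\<And>i. axis i 1 \<in> H" by auto
  have "x \<in> H" for x
  proof -
    have "(\<Sum>i\<in>S. (x$i) *s axis i 1) \<in> H" if "finite S" for S
      using that by induction (auto intro!: add_subgroup_add add_subgroup_scale * add_subgroup_0)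
    moreover have "(\<Sum>i\<in>UNIV. (x$i) *s axis i 1) = x"
      by (simp add: vec_eq_iff axis_def if_distrib cong: if_cong)
    ultimately show ?thesis by (metis finite)
  qed
  then have "character_on UNIV \<zeta>" using *(2) by (metis UNIV_eq_I)
  moreover have "\<zeta> x = 1" if "x \<in> L" for x using that *(4) H1(3,5) by (metis subsetD)
  ultimately show ?thesis using that *(4) H1(4,6) by metis
qed

text \<open>The action of a character on the polynomial ring: it multiplies homogeneous elements by the
  value of the character at their degree.\<close>

definition twist :: "(int^'v \<Rightarrow> 'k) \<Rightarrow> ('v::finite, 'k::field) mpoly \<Rightarrow> ('v, 'k) mpoly" where
  "twist \<zeta> p = Poly_Mapping.mapp (\<lambda>\<mu> c. \<zeta> (ivec \<mu>) * c) p"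

lemma lookup_twist: "lookup (twist \<zeta> p) \<mu> = \<zeta> (ivec \<mu>) * lookup p \<mu>"
  by (auto simp: twist_def lookup_mapp when_def in_keys_iff)

lemma twist_add: "twist \<zeta> (p + q) = twist \<zeta> p + twist \<zeta> q"
  by (rule poly_mapping_eqI) (simp add: lookup_twist lookup_add algebra_simps)

lemma twist_diff: "twist \<zeta> (p - q) = twist \<zeta> p - twist \<zeta> q"
  by (rule poly_mapping_eqI) (simp add: lookup_twist lookup_minus algebra_simps)

lemma twist_0 [simp]: "twist \<zeta> 0 = 0"
  by (rule poly_mapping_eqI) (simp add: lookup_twist)

lemma twist_sum: "twist \<zeta> (\<Sum>i\<in>I. p i) = (\<Sum>i\<in>I. twist \<zeta> (p i))"
  by (induction I rule: infinite_finite_induct) (auto simp: twist_add)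

lemma twist_single: "twist \<zeta> (single \<mu> c) = single \<mu> (\<zeta> (ivec \<mu>) * c)"
  by (rule poly_mapping_eqI) (simp add: lookup_twist lookup_single when_def)

lemma twist_mult:
  assumes "character_on UNIV \<zeta>"
  shows "twist \<zeta> (p * q) = twist \<zeta> p * twist \<zeta> q"
proof (induction p rule: mpoly_induct)
  case (add p \<mu> c)
  have \<zeta>: "\<zeta> (x + y) = \<zeta> x * \<zeta> y" for x y using assms by (simp add: character_on_def)
  have "twist \<zeta> (single \<mu> c * q) = twist \<zeta> (single \<mu> c) * twist \<zeta> q"
    by (induction q rule: mpoly_induct)
      (auto simp: distrib_left twist_add mult_single twist_single ivec_add \<zeta> algebra_simps)
  then show ?case by (simp add: distrib_right twist_add add)
qed auto

lemma lookup_Const_mult: "lookup (Const c * p) \<mu> = c * lookup p \<mu>"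
  unfolding Const_def mult_map_scale_conv_mult[symmetric]
  by (auto simp: Poly_Mapping.map.rep_eq when_def)

lemma Const_0 [simp]: "Const 0 = 0" and Const_1 [simp]: "Const 1 = 1"
  by (simp_all add: Const_def)

lemma Const_mult: "Const (a * b) = Const a * Const b"
  and Const_add: "Const (a + b) = Const a + Const b"
  and Const_diff: "Const (a - b) = Const a - Const b"
  by (simp_all add: Const_def mult_single single_add single_diff)

lemma Const_inverse: "c \<noteq> 0 \<Longrightarrow> Const (c::'k::field) * Const (inverse c) = 1"
  by (simp add: Const_mult[symmetric])

lemma dvd_Const_mult_iff: "c \<noteq> 0 \<Longrightarrow> F dvd Const (c::'k::field) * p \<longleftrightarrow> F dvd p"
proof
  assume c: "c \<noteq> 0" and "F dvd Const c * p"
  then have "F dvd Const (inverse c) * (Const c * p)" by (rule_tac dvd_mult)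
  also have "Const (inverse c) * (Const c * p) = p"
    using Const_inverse[OF c] by (metis mult.assoc mult.commute mult_1)
  finally show "F dvd p" .
qed simp

lemma twist_homd:
  assumes "character_on UNIV \<zeta>" "\<And>x. x \<in> L \<Longrightarrow> \<zeta> x = 1" "homd L \<kappa> p"
  shows "twist \<zeta> p = Const (\<zeta> \<kappa>) * p"
proof (rule poly_mapping_eqI)
  fix \<mu>
  have "\<zeta> (ivec \<mu>) = \<zeta> \<kappa>" if "\<mu> \<in> keys p"
  proof -
    have "\<zeta> ((ivec \<mu> - \<kappa>) + \<kappa>) = \<zeta> (ivec \<mu> - \<kappa>) * \<zeta> \<kappa>" using assms(1) unfolding character_on_def by blast
    moreover have "\<zeta> (ivec \<mu> - \<kappa>) = 1" using assms that by (auto simp: homd_def)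
    ultimately show ?thesis by simp
  qed
  then show "lookup (twist \<zeta> p) \<mu> = lookup (Const (\<zeta> \<kappa>) * p) \<mu>"
    by (cases "\<mu> \<in> keys p") (auto simp: lookup_twist lookup_Const_mult in_keys_iff)
qed

lemma twist_in_ideal:
  assumes "add_subgroup L" "character_on UNIV \<zeta>" "\<And>x. x \<in> L \<Longrightarrow> \<zeta> x = 1"
    and J: "cideal J" "hcomp_closed L J" "p \<in> J"
  shows "twist \<zeta> p \<in> J"
proof -
  obtain S where S: "finite S" "p = (\<Sum>\<kappa>\<in>S. hcomp L \<kappa> p)"
    using hcomp_decomposition[OF assms(1)] by metis
  have "twist \<zeta> p = (\<Sum>\<kappa>\<in>S. Const (\<zeta> \<kappa>) * hcomp L \<kappa> p)"
    by (subst S(2)) (simp add: twist_sum twist_homd[OF assms(2,3) homd_hcomp])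
  also have "\<dots> \<in> J"
    using J by (intro cideal_sum cideal_mult) (auto simp: hcomp_closed_def)
  finally show ?thesis .
qed

lemma pid_cong:
  assumes "F dvd i - i'"
  shows "pid F i = pid F i'"
proof -
  have *: "pid F i \<subseteq> pid F i'" if "F dvd i - i'" for i i'
  proof (rule pid_least)
    show "i \<in> pid F i'" using that by (intro pid_memI[of _ _ _ 1]) simp
  qed auto
  have "F dvd i' - i" using assms by (metis dvd_minus_iff minus_diff_eq)
  then show ?thesis using *[of i i'] *[of i' i] assms by blast
qed

text \<open>A homogeneous ideal is stable under all characters of the grading group. Hence a character
  multiplies a generator by a unit, which is a constant. So the generator is a common
  eigenvector; as characters separate degrees, it has only one component that is nonzero modulo
  \<open>F\<close>.\<close>

lemma homogeneous_generator:
  fixes F :: "('v::finite, 'k::{alg_closed_field, field_char_0}) mpoly"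
  assumes L: "add_subgroup L" and F: "homog L F" "prime_mod F"
    and units: "const_units F"
    and J: "hcomp_closed L (pid F i)"
  obtains i' where "homog L i'" "pid F i = pid F i'"
proof -
  note cm = cideal_multiples hcomp_closed_multiples[OF L F(1)]
  \<comment> \<open>The factor \<open>a\<close> by which \<open>\<zeta>\<close> changes the generator is a unit, because the inverse character
    changes it by the inverse factor.\<close>
  have eig: "\<exists>c. \<forall>\<kappa>. \<not> F dvd hcomp L \<kappa> i \<longrightarrow> \<zeta> \<kappa> = c"
    if \<zeta>: "character_on UNIV \<zeta>" "\<And>x. x \<in> L \<Longrightarrow> \<zeta> x = 1" and i: "\<not> F dvd i" for \<zeta> :: "int^'v \<Rightarrow> 'k"
  proof -
    define \<psi> where "\<psi> x = inverse (\<zeta> x)" for x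
    have \<psi>: "character_on UNIV \<psi>" "\<And>x. x \<in> L \<Longrightarrow> \<psi> x = 1"
      using \<zeta> by (auto simp: \<psi>_def character_on_def)
    obtain a where a: "F dvd twist \<zeta> i - i * a"
      using twist_in_ideal[OF L \<zeta> cideal_pid J pid_gen(1)] by (auto simp: pid_def)
    obtain b where b: "F dvd twist \<psi> i - i * b"
      using twist_in_ideal[OF L \<psi> cideal_pid J pid_gen(1)] by (auto simp: pid_def)
    have "twist \<zeta> (twist \<psi> i) = i"
      using \<zeta>(1) by (intro poly_mapping_eqI) (simp add: lookup_twist \<psi>_def character_on_def)
    moreover have "F dvd twist \<zeta> (twist \<psi> i - i * b)"
      using twist_in_ideal[OF L \<zeta> cm, of "twist \<psi> i - i * b"] b by simp
    ultimately have "F dvd i - twist \<zeta> i * twist \<zeta> b"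
      by (simp add: twist_diff twist_mult[OF \<zeta>(1)])
    then have "F dvd (i - twist \<zeta> i * twist \<zeta> b) + (twist \<zeta> i - i * a) * twist \<zeta> b"
      using a by (intro dvd_add dvd_mult2)
    also have "(i - twist \<zeta> i * twist \<zeta> b) + (twist \<zeta> i - i * a) * twist \<zeta> b = - (i * (a * twist \<zeta> b - 1))"
      by (simp add: algebra_simps)
    finally have "F dvd i * (a * twist \<zeta> b - 1)" by simp
    then have "F dvd a * twist \<zeta> b - 1" using F(2) i by (auto simp: prime_mod_def)
    then obtain c where c: "F dvd a - Const c" using units by (auto simp: const_units_def)
    have "F dvd (twist \<zeta> i - i * a) + i * (a - Const c)" using a c by (intro dvd_add dvd_mult)
    then have "F dvd twist \<zeta> i - Const c * i" by (simp add: algebra_simps)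
    then have "F dvd hcomp L \<kappa> (twist \<zeta> i - Const c * i)" for \<kappa>
      using cm(2) by (auto simp: hcomp_closed_def)
    moreover have "hcomp L \<kappa> (twist \<zeta> i - Const c * i) = Const (\<zeta> \<kappa> - c) * hcomp L \<kappa> i" for \<kappa>
    proof -
      have "hcomp L \<kappa> (twist \<zeta> i) = twist \<zeta> (hcomp L \<kappa> i)"
        by (rule poly_mapping_eqI) (simp add: hcomp_def lookup_part lookup_twist)
      moreover have "hcomp L \<kappa> (Const c * i) = Const c * hcomp L \<kappa> i"
        using hcomp_mult[OF L homd_Const[OF L]] by simp
      ultimately show ?thesis
        by (simp add: hcomp_diff twist_homd[OF \<zeta> homd_hcomp] Const_diff algebra_simps)
    qed
    ultimately have *: "F dvd Const (\<zeta> \<kappa> - c) * hcomp L \<kappa> i" for \<kappa> by metis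
    have "\<zeta> \<kappa> = c" if "\<not> F dvd hcomp L \<kappa> i" for \<kappa>
      using *[of \<kappa>] dvd_Const_mult_iff[of "\<zeta> \<kappa> - c" F "hcomp L \<kappa> i"] that by auto
    then show ?thesis by blast
  qed
  show ?thesis
  proof (cases "F dvd i")
    case True
    then show ?thesis using that[of 0] pid_cong[of F i 0] by simp
  next
    case i: False
    obtain S where S: "finite S" "i = (\<Sum>\<kappa>\<in>S. hcomp L \<kappa> i)"
      "\<And>\<kappa> \<rho>. \<kappa> \<in> S \<Longrightarrow> \<rho> \<in> S \<Longrightarrow> \<kappa> - \<rho> \<in> L \<Longrightarrow> \<kappa> = \<rho>"
      using hcomp_decomposition[OF L] by metis
    obtain \<kappa> where \<kappa>: "\<kappa> \<in> S" "\<not> F dvd hcomp L \<kappa> i"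
      using i S(2) dvd_sum by metis
    have "F dvd hcomp L \<rho> i" if \<rho>: "\<rho> \<in> S - {\<kappa>}" for \<rho>
    proof (rule ccontr)
      assume *: "\<not> F dvd hcomp L \<rho> i"
      have "\<rho> - \<kappa> \<notin> L" using S(3) \<rho> \<kappa>(1) by blast
      then obtain \<zeta> :: "int^'v \<Rightarrow> 'k"
        where \<zeta>: "character_on UNIV \<zeta>" "\<And>x. x \<in> L \<Longrightarrow> \<zeta> x = 1" "\<zeta> (\<rho> - \<kappa>) \<noteq> 1"
        using character_separates[OF L] by metis
      have "\<zeta> \<rho> = \<zeta> \<kappa>" using eig[OF \<zeta>(1,2) i] * \<kappa>(2) by metis
      moreover have "\<zeta> (\<rho> - \<kappa>) = \<zeta> \<rho> / \<zeta> \<kappa>"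
        by (rule character_on_diff[OF _ \<zeta>(1)]) (auto simp: add_subgroup_def)
      moreover have "\<zeta> \<kappa> \<noteq> 0" using \<zeta>(1) by (simp add: character_on_def)
      ultimately show False using \<zeta>(3) by simp
    qed
    then have "F dvd (\<Sum>\<rho>\<in>S - {\<kappa>}. hcomp L \<rho> i)" by (intro dvd_sum)
    also have "(\<Sum>\<rho>\<in>S - {\<kappa>}. hcomp L \<rho> i) = i - hcomp L \<kappa> i"
      using S(1) \<kappa>(1) by (subst (2) S(2)) (simp add: sum.remove)
    finally show ?thesis using pid_cong that[of "hcomp L \<kappa> i"] by auto
  qed
qed

section \<open>Coarsening a grading by one integral functional\<close>

definition ker :: "int^'v \<Rightarrow> (int^'v::finite) set" where
  "ker c = {x. pairing c x = 0}"

lemma pairing_add: "pairing c (x + y) = pairing c x + pairing c y"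
  and pairing_diff: "pairing c (x - y) = pairing c x - pairing c (y :: 'a::comm_ring_1^'n)"
  and pairing_0 [simp]: "pairing c 0 = 0"
  by (simp_all add: pairing_def algebra_simps sum.distrib sum_subtractf)

lemma add_subgroup_ker: "add_subgroup (ker c)"
  by (auto simp: add_subgroup_def ker_def pairing_diff)

lemma add_subgroup_Int: "add_subgroup L \<Longrightarrow> add_subgroup M \<Longrightarrow> add_subgroup (L \<inter> M)"
  by (auto simp: add_subgroup_def)

lemma add_subgroup_UNIV [simp]: "add_subgroup UNIV"
  by (simp add: add_subgroup_def)

lemma homog_UNIV [simp]: "homog UNIV p"
  by (simp add: homog_def homd_def)

text \<open>The grading by \<open>L\<close> is finer than the one by \<open>M\<close> when \<open>L \<subseteq> M\<close>. Passing from \<open>L \<inter> ker c\<close> to \<open>L\<close>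
  forgets a grading by the integers; \<open>cpart c n\<close> is its component of degree \<open>n\<close>.\<close>

definition cpart :: "int^'v \<Rightarrow> int \<Rightarrow> ('v::finite, 'k::comm_ring_1) mpoly \<Rightarrow> ('v, 'k) mpoly" where
  "cpart c n p = part (\<lambda>\<mu>. pairing c (ivec \<mu>) = n) p"

lemma cpart_0 [simp]: "cpart c n 0 = 0"
  and cpart_diff: "cpart c n (p - q) = cpart c n p - cpart c n q"
  and cpart_sum: "cpart c n (\<Sum>i\<in>I. f i) = (\<Sum>i\<in>I. cpart c n (f i))"
  by (simp_all add: cpart_def part_add part_diff part_sum)

lemma cpart_mult:
  assumes "homd (ker c) \<kappa> p"
  shows "cpart c n (p * q) = p * cpart c (n - pairing c \<kappa>) q"
  unfolding cpart_def
proof (rule part_mult)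
  fix \<mu> \<nu> assume "\<mu> \<in> keys p"
  then have "pairing c (ivec \<mu>) = pairing c \<kappa>"
    using assms by (auto simp: homd_def ker_def pairing_diff)
  then show "(pairing c (ivec (\<mu> + \<nu>)) = n) = (pairing c (ivec \<nu>) = n - pairing c \<kappa>)"
    by (auto simp: ivec_add pairing_add)
qed

lemma cpart_cpart_mult: "cpart c s (cpart c n p * q) = cpart c n p * cpart c (s - n) q"
  unfolding cpart_def
  by (rule part_mult) (auto simp: keys_part ivec_add pairing_add)

lemma cpart_decomposition:
  obtains S where "finite S" "p = (\<Sum>n\<in>S. cpart c n p)" "\<And>n. n \<notin> S \<Longrightarrow> cpart c n p = 0"
proof (rule that)
  let ?S = "(\<lambda>\<mu>. pairing c (ivec \<mu>)) ` keys p"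
  show "finite ?S" by simp
  show "p = (\<Sum>n\<in>?S. cpart c n p)"
    unfolding cpart_def by (rule part_fibres) auto
  show "cpart c n p = 0" if "n \<notin> ?S" for n
    unfolding cpart_def by (rule part_none) (use that in auto)
qed

lemma homd_part: "homd L \<kappa> p \<Longrightarrow> homd L \<kappa> (part Q p)"
  by (auto simp: homd_def keys_part)

lemma homog_cpart:
  assumes L: "add_subgroup L" and p: "homog L p"
  shows "homog (L \<inter> ker c) (cpart c n p)"
proof (cases "cpart c n p = 0")
  case False
  then obtain \<mu> where \<mu>: "\<mu> \<in> keys (cpart c n p)" using nonzero_key by blast
  obtain \<kappa> where \<kappa>: "homd L \<kappa> p" using p by (auto simp: homog_def)
  have "homd (L \<inter> ker c) (ivec \<mu>) (cpart c n p)"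
    unfolding homd_def
  proof
    fix \<nu> assume \<nu>: "\<nu> \<in> keys (cpart c n p)"
    have "ivec \<nu> - \<kappa> \<in> L" "ivec \<mu> - \<kappa> \<in> L"
      using \<kappa> \<mu> \<nu> by (auto simp: homd_def cpart_def keys_part)
    from add_subgroup_diff[OF L this] have "ivec \<nu> - ivec \<mu> \<in> L" by simp
    then show "ivec \<nu> - ivec \<mu> \<in> L \<inter> ker c"
      using \<mu> \<nu> by (auto simp: cpart_def keys_part ker_def pairing_diff)
  qed
  then show ?thesis by (rule homogI)
qed simp

lemma homog_coarsen: "homog L p \<Longrightarrow> L \<subseteq> M \<Longrightarrow> homog M p"
  unfolding homog_def homd_def by blast

definition cpart_closed :: "int^'v \<Rightarrow> ('v::finite, 'k::comm_ring_1) mpoly set \<Rightarrow> bool" where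
  "cpart_closed c J \<longleftrightarrow> (\<forall>p\<in>J. \<forall>n. cpart c n p \<in> J)"

lemma cpart_closed_of_hcomp_closed:
  assumes L: "add_subgroup L" "L \<subseteq> ker c" and J: "cideal J" "hcomp_closed L J"
  shows "cpart_closed c J"
  unfolding cpart_closed_def
proof (intro ballI allI)
  fix p n assume p: "p \<in> J"
  obtain S where S: "finite S" "p = (\<Sum>\<kappa>\<in>S. hcomp L \<kappa> p)"
    using hcomp_decomposition[OF L(1)] by metis
  have "cpart c n (hcomp L \<kappa> p) \<in> J" for \<kappa>
  proof -
    have *: "\<mu> \<in> keys (hcomp L \<kappa> p) \<Longrightarrow> pairing c (ivec \<mu>) = pairing c \<kappa>" for \<mu>
      using L(2) by (auto simp: hcomp_def keys_part ker_def pairing_diff)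
    have "cpart c n (hcomp L \<kappa> p) = (if n = pairing c \<kappa> then hcomp L \<kappa> p else 0)"
      unfolding cpart_def using * by (auto intro: part_all part_none)
    then show ?thesis using J p by (auto simp: hcomp_closed_def cideal_0)
  qed
  then have "(\<Sum>\<kappa>\<in>S. cpart c n (hcomp L \<kappa> p)) \<in> J" by (intro cideal_sum[OF J(1)])
  then show "cpart c n p \<in> J" by (metis S(2) cpart_sum)
qed

text \<open>If only one pair of components contributes to degree \<open>m + k\<close> modulo \<open>J\<close>, then the component of
  the product in this degree is a product of two homogeneous elements outside \<open>J\<close>.\<close>

lemma extreme_product:
  assumes L: "add_subgroup L" and J: "cideal J" "hprime (L \<inter> ker c) J"
    and pq: "homog L p" "homog L q"
    and nin: "cpart c m p \<notin> J" "cpart c k q \<notin> J"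
    and extreme: "\<And>n. n \<noteq> m \<Longrightarrow> cpart c n p \<in> J \<or> cpart c (m + k - n) q \<in> J"
  shows "cpart c (m + k) (p * q) \<notin> J"
proof
  assume *: "cpart c (m + k) (p * q) \<in> J"
  obtain S where S: "finite S" "p = (\<Sum>n\<in>S. cpart c n p)" "\<And>n. n \<notin> S \<Longrightarrow> cpart c n p = 0"
    using cpart_decomposition by metis
  have mS: "m \<in> S" using S(3) nin(1) cideal_0[OF J(1)] by metis
  have "cpart c (m + k) (p * q) = (\<Sum>n\<in>S. cpart c n p * cpart c (m + k - n) q)"
    by (subst S(2)) (simp add: sum_distrib_right cpart_sum cpart_cpart_mult)
  also have "\<dots> = cpart c m p * cpart c k q + (\<Sum>n\<in>S - {m}. cpart c n p * cpart c (m + k - n) q)"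
    using S(1) mS by (simp add: sum.remove)
  finally have "cpart c m p * cpart c k q =
      cpart c (m + k) (p * q) - (\<Sum>n\<in>S - {m}. cpart c n p * cpart c (m + k - n) q)"
    by simp
  also have "\<dots> \<in> J"
  proof (intro cideal_diff[OF J(1) *] cideal_sum[OF J(1)])
    fix n assume "n \<in> S - {m}"
    then show "cpart c n p * cpart c (m + k - n) q \<in> J"
      using extreme[of n] cideal_mult[OF J(1)] cideal_mult2[OF J(1)] by blast
  qed
  finally show False
    using J(2) nin homog_cpart[OF L pq(1)] homog_cpart[OF L pq(2)] unfolding hprime_def by blast
qed

definition cdegs :: "int^'v \<Rightarrow> ('v::finite, 'k::comm_ring_1) mpoly set \<Rightarrow> ('v, 'k) mpoly \<Rightarrow> int set" where
  "cdegs c J p = {n. cpart c n p \<notin> J}"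

lemma finite_cdegs: "cideal J \<Longrightarrow> finite (cdegs c J p)"
proof -
  assume J: "cideal J"
  obtain S where S: "finite S" "\<And>n. n \<notin> S \<Longrightarrow> cpart c n p = 0"
    using cpart_decomposition by metis
  have "cdegs c J p \<subseteq> S" using S(2) cideal_0[OF J] unfolding cdegs_def by force
  then show ?thesis using S(1) finite_subset by blast
qed

lemma cdegs_nonempty: "cideal J \<Longrightarrow> p \<notin> J \<Longrightarrow> cdegs c J p \<noteq> {}"
proof
  assume *: "cideal J" "p \<notin> J" "cdegs c J p = {}"
  obtain S where S: "finite S" "p = (\<Sum>n\<in>S. cpart c n p)"
    using cpart_decomposition by metis
  have "(\<Sum>n\<in>S. cpart c n p) \<in> J"
    using * by (intro cideal_sum) (auto simp: cdegs_def)
  then show False using S(2) *(2) by metis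
qed

lemma cdegs_Max:
  assumes "cideal J" "p \<notin> J"
  shows "cpart c (Max (cdegs c J p)) p \<notin> J" "n > Max (cdegs c J p) \<Longrightarrow> cpart c n p \<in> J"
    "n \<in> cdegs c J p \<Longrightarrow> n \<le> Max (cdegs c J p)"
proof -
  note * = finite_cdegs[OF assms(1), of c p] cdegs_nonempty[OF assms, of c]
  show "cpart c (Max (cdegs c J p)) p \<notin> J" using Max_in[OF *] by (simp add: cdegs_def)
  show "n \<in> cdegs c J p \<Longrightarrow> n \<le> Max (cdegs c J p)" for n using * by simp
  then show "n > Max (cdegs c J p) \<Longrightarrow> cpart c n p \<in> J" by (force simp: cdegs_def)
qed

lemma cdegs_Min:
  assumes "cideal J" "p \<notin> J"
  shows "cpart c (Min (cdegs c J p)) p \<notin> J" "n < Min (cdegs c J p) \<Longrightarrow> cpart c n p \<in> J"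
    "n \<in> cdegs c J p \<Longrightarrow> Min (cdegs c J p) \<le> n"
proof -
  note * = finite_cdegs[OF assms(1), of c p] cdegs_nonempty[OF assms, of c]
  show "cpart c (Min (cdegs c J p)) p \<notin> J" using Min_in[OF *] by (simp add: cdegs_def)
  show "n \<in> cdegs c J p \<Longrightarrow> Min (cdegs c J p) \<le> n" for n using * by simp
  then show "n < Min (cdegs c J p) \<Longrightarrow> cpart c n p \<in> J" by (force simp: cdegs_def)
qed

text \<open>The highest components do not cancel, and neither do the lowest ones.\<close>

lemma cdegs_mult:
  assumes L: "add_subgroup L" and J: "cideal J" "hprime (L \<inter> ker c) J"
    and pq: "homog L p" "homog L q" "p \<notin> J" "q \<notin> J"
  shows "Max (cdegs c J p) + Max (cdegs c J q) \<in> cdegs c J (p * q)"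
    "Min (cdegs c J p) + Min (cdegs c J q) \<in> cdegs c J (p * q)"
proof -
  have "cpart c n p \<in> J \<or> cpart c (Max (cdegs c J p) + Max (cdegs c J q) - n) q \<in> J"
    if "n \<noteq> Max (cdegs c J p)" for n
    using that cdegs_Max(2)[OF J(1) pq(3), of c n] cdegs_Max(2)[OF J(1) pq(4)] by (cases "n > Max (cdegs c J p)") auto
  from extreme_product[OF L J pq(1,2) _ _ this] cdegs_Max(1)[OF J(1) pq(3)] cdegs_Max(1)[OF J(1) pq(4)]
  show "Max (cdegs c J p) + Max (cdegs c J q) \<in> cdegs c J (p * q)" by (auto simp: cdegs_def)
  have "cpart c n p \<in> J \<or> cpart c (Min (cdegs c J p) + Min (cdegs c J q) - n) q \<in> J"
    if "n \<noteq> Min (cdegs c J p)" for n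
    using that cdegs_Min(2)[OF J(1) pq(3), of n c] cdegs_Min(2)[OF J(1) pq(4)] by (cases "n < Min (cdegs c J p)") auto
  from extreme_product[OF L J pq(1,2) _ _ this] cdegs_Min(1)[OF J(1) pq(3)] cdegs_Min(1)[OF J(1) pq(4)]
  show "Min (cdegs c J p) + Min (cdegs c J q) \<in> cdegs c J (p * q)" by (auto simp: cdegs_def)
qed

text \<open>The integers are ordered, so primeness of a homogeneous ideal is not lost when a factor \<open>\<int>\<close> of
  the grading group is forgotten: compare the highest components.\<close>

lemma hprime_coarsen:
  assumes L: "add_subgroup L" and J: "cideal J" "hprime (L \<inter> ker c) J" "cpart_closed c J"
  shows "hprime L J"
  unfolding hprime_def
proof (intro conjI allI impI)
  show "1 \<notin> J" using J by (simp add: hprime_def)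
  fix p q assume *: "homog L p" "homog L q" "p * q \<in> J"
  show "p \<in> J \<or> q \<in> J"
  proof (rule ccontr)
    assume "\<not> (p \<in> J \<or> q \<in> J)"
    then have "cdegs c J (p * q) \<noteq> {}" using cdegs_mult(1)[OF L J(1,2) *(1,2)] by blast
    then show False using J(3) *(3) by (auto simp: cdegs_def cpart_closed_def)
  qed
qed

text \<open>The highest and the lowest degrees of two mutually inverse elements both add up to 0, so each
  element has just one degree.\<close>

lemma unit_cpart:
  fixes p q :: "('v::finite, 'k::comm_ring_1) mpoly"
  assumes J: "cideal J" "hprime (ker c) J" "cpart_closed c J" and pq: "p * q - 1 \<in> J"
  obtains m where "p - cpart c m p \<in> J" "q - cpart c (- m) q \<in> J"
proof -
  have J1: "1 \<notin> J" and J2: "hprime (UNIV \<inter> ker c) J" using J(2) by (simp_all add: hprime_def)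
  have p: "p \<notin> J" using cideal_diff_iff[OF J(1) pq] cideal_mult2[OF J(1)] J1 by blast
  have q: "q \<notin> J" using cideal_diff_iff[OF J(1) pq] cideal_mult[OF J(1)] J1 by blast
  have "n = 0" if "n \<in> cdegs c J (p * q)" for n
  proof (rule ccontr)
    assume "n \<noteq> 0"
    then have "cpart c n 1 = (0 :: ('v, 'k) mpoly)" unfolding cpart_def by (intro part_none) auto
    moreover have "cpart c n (p * q - 1) \<in> J" using J(3) pq by (auto simp: cpart_closed_def)
    ultimately show False using that by (simp add: cpart_diff cdegs_def)
  qed
  note zero = this
  have 0: "Max (cdegs c J p) + Max (cdegs c J q) = 0" "Min (cdegs c J p) + Min (cdegs c J q) = 0"
    using zero cdegs_mult[OF add_subgroup_UNIV J(1) J2 homog_UNIV homog_UNIV p q] by blast+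
  have le: "Min (cdegs c J r) \<le> Max (cdegs c J r)" if "r \<notin> J" for r
    using cdegs_Min(3)[OF J(1) that] cdegs_Max(1)[OF J(1) that] by (simp add: cdegs_def)
  have eq: "Min (cdegs c J p) = Max (cdegs c J p)" "Min (cdegs c J q) = Max (cdegs c J q)"
    using 0 le[OF p] le[OF q] by linarith+
  have conc: "r - cpart c (Max (cdegs c J r)) r \<in> J"
    if r: "r \<notin> J" "Min (cdegs c J r) = Max (cdegs c J r)" for r
  proof -
    let ?m = "Max (cdegs c J r)"
    obtain S where S: "finite S" "r = (\<Sum>n\<in>S. cpart c n r)" "\<And>n. n \<notin> S \<Longrightarrow> cpart c n r = 0"
      using cpart_decomposition by metis
    have "?m \<in> S" using S(3) cdegs_Max(1)[OF J(1) r(1)] cideal_0[OF J(1)] by metis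
    then have "r - cpart c ?m r = (\<Sum>n\<in>S - {?m}. cpart c n r)"
      using S(1) by (subst S(2)) (simp add: sum.remove)
    also have "\<dots> \<in> J"
    proof (rule cideal_sum[OF J(1)])
      fix n assume "n \<in> S - {?m}"
      then have "n < Min (cdegs c J r) \<or> n > ?m" using r(2) by auto
      then show "cpart c n r \<in> J" using cdegs_Max(2)[OF J(1) r(1)] cdegs_Min(2)[OF J(1) r(1)] by blast
    qed
    finally show ?thesis .
  qed
  have "- Max (cdegs c J p) = Max (cdegs c J q)" using 0 by simp
  then show ?thesis using that conc[OF p eq(1)] conc[OF q eq(2)] by metis
qed

section \<open>Chains of prime ideals in a polynomial ring\<close>

definition mev :: "('v \<Rightarrow> ('w, 'k) mpoly) \<Rightarrow> ('v \<Rightarrow>\<^sub>0 nat) \<Rightarrow> ('w, 'k::comm_ring_1) mpoly" where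
  "mev f \<mu> = (\<Prod>i\<in>keys \<mu>. f i ^ lookup \<mu> i)"

lemma mev_superset: "finite S \<Longrightarrow> keys \<mu> \<subseteq> S \<Longrightarrow> mev f \<mu> = (\<Prod>i\<in>S. f i ^ lookup \<mu> i)"
  unfolding mev_def by (rule prod.mono_neutral_left) (auto simp: in_keys_iff)

lemma mev_add: "mev f (\<mu> + \<nu>) = mev f \<mu> * mev f \<nu>"
proof -
  let ?S = "keys \<mu> \<union> keys \<nu>"
  have "mev f \<rho> = (\<Prod>i\<in>?S. f i ^ lookup \<rho> i)" if "keys \<rho> \<subseteq> ?S" for \<rho>
    using that by (intro mev_superset) auto
  from this[of "\<mu> + \<nu>"] this[of \<mu>] this[of \<nu>] show ?thesis
    by (simp add: keys_add lookup_add power_add prod.distrib)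
qed

lemma poly_subst_superset:
  "finite S \<Longrightarrow> keys p \<subseteq> S \<Longrightarrow> poly_subst f p = (\<Sum>\<mu>\<in>S. Const (lookup p \<mu>) * mev f \<mu>)"
  unfolding poly_subst_def mev_def[symmetric]
  by (rule sum.mono_neutral_left) (auto simp: in_keys_iff)

lemma poly_subst_0 [simp]: "poly_subst f 0 = 0"
  by (simp add: poly_subst_def)

lemma poly_subst_single: "poly_subst f (single \<mu> c) = Const c * mev f \<mu>"
  using poly_subst_superset[of "{\<mu>}" "single \<mu> c" f] by simp

lemma poly_subst_add: "poly_subst f (p + q) = poly_subst f p + poly_subst f q"
proof -
  let ?S = "keys p \<union> keys q"
  have "poly_subst f r = (\<Sum>\<mu>\<in>?S. Const (lookup r \<mu>) * mev f \<mu>)" if "keys r \<subseteq> ?S" for r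
    using that by (intro poly_subst_superset) auto
  from this[of "p + q"] this[of p] this[of q] show ?thesis
    by (simp add: keys_add lookup_add Const_def single_add distrib_right sum.distrib)
qed

lemma poly_subst_sum: "poly_subst f (\<Sum>i\<in>I. p i) = (\<Sum>i\<in>I. poly_subst f (p i))"
  by (induction I rule: infinite_finite_induct) (auto simp: poly_subst_add)

lemma poly_subst_mult: "poly_subst f (p * q) = poly_subst f p * poly_subst f q"
proof (induction p rule: mpoly_induct)
  case (add p \<mu> c)
  have "poly_subst f (single \<mu> c * q) = poly_subst f (single \<mu> c) * poly_subst f q"
  proof (induction q rule: mpoly_induct)
    case (add q \<nu> d)
    then show ?case
      by (simp add: distrib_left poly_subst_add mult_single poly_subst_single mev_add)
        (simp add: Const_mult mult.assoc mult.left_commute)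
  qed simp
  then show ?case by (simp add: distrib_right poly_subst_add add)
qed simp

lemma poly_subst_cong:
  "(\<And>\<mu> i. \<mu> \<in> keys p \<Longrightarrow> i \<in> keys \<mu> \<Longrightarrow> f i = g i) \<Longrightarrow> poly_subst f p = poly_subst g p"
  by (simp add: poly_subst_def)

lemma monomial_mult_eq_push: "single \<nu> 1 * p = push ((+) \<nu>) (p :: ('v, 'k::comm_ring_1) mpoly)"
  by (induction p rule: mpoly_induct) (auto simp: distrib_left push_add mult_single)

text \<open>Algebraic independence of the first \<open>t\<close> members of \<open>ps\<close> modulo \<open>J\<close>. Transcendence degree
  bounds the length of chains of prime ideals.\<close>

definition algindep :: "('v, 'k) mpoly set \<Rightarrow> (nat \<Rightarrow> ('v, 'k::comm_ring_1) mpoly) \<Rightarrow> nat \<Rightarrow> bool" where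
  "algindep J ps t \<longleftrightarrow>
     (\<forall>H :: (nat, 'k) mpoly. H \<noteq> 0 \<longrightarrow> poly_vars H \<subseteq> {..<t} \<longrightarrow> poly_subst ps H \<notin> J)"

text \<open>Every element is homogeneous for the grading by the trivial group, so this is ordinary
  primeness.\<close>

definition cprime :: "('v::finite, 'k::comm_ring_1) mpoly set \<Rightarrow> bool" where
  "cprime J \<longleftrightarrow> cideal J \<and> hprime UNIV J"

lemma cprime_cideal: "cprime J \<Longrightarrow> cideal J"
  and cprime_1: "cprime J \<Longrightarrow> 1 \<notin> J"
  and cprime_mult: "cprime J \<Longrightarrow> p * q \<in> J \<Longrightarrow> p \<in> J \<or> q \<in> J"
  by (auto simp: cprime_def hprime_def)

lemma cprime_power: "cprime J \<Longrightarrow> p ^ n \<in> J \<Longrightarrow> p \<in> J"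
  by (induction n) (auto dest: cprime_1 cprime_mult)

text \<open>Prime ideals that decrease gain algebraically independent elements. In a relation modulo \<open>Q\<close>
  for the extended family, powers of the new element \<open>p\<close> can be cancelled; what remains has a
  part free of the new variable, and that part is a relation modulo \<open>P\<close> for the old family,
  since \<open>p\<close> lies in \<open>P\<close>.\<close>

lemma algindep_extend:
  fixes P Q :: "('v::finite, 'k::field) mpoly set"
  assumes Q: "cprime Q" and P: "cprime P" and sub: "Q \<subseteq> P" and p: "p \<in> P" "p \<notin> Q"
    and ind: "algindep P ps t"
  shows "algindep Q (ps(t := p)) (Suc t)"
  unfolding algindep_def
proof (intro allI impI notI)
  fix H :: "(nat, 'k) mpoly"
  assume H: "H \<noteq> 0" "poly_vars H \<subseteq> {..<Suc t}" "poly_subst (ps(t := p)) H \<in> Q"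
  let ?e = "poly_subst (ps(t := p))"
  \<comment> \<open>Dividing \<open>H\<close> by the largest power of the last variable leaves a part without it.\<close>
  define m where "m = Min ((\<lambda>\<mu>. lookup \<mu> t) ` keys H)"
  have fin: "finite ((\<lambda>\<mu>. lookup \<mu> t) ` keys H)" "(\<lambda>\<mu>. lookup \<mu> t) ` keys H \<noteq> {}"
    using H(1) nonzero_key[of H] by auto
  have m_le: "m \<le> lookup \<mu> t" if "\<mu> \<in> keys H" for \<mu>
    unfolding m_def using that by (intro Min_le) auto
  obtain \<mu>\<^sub>0 where \<mu>0: "\<mu>\<^sub>0 \<in> keys H" "lookup \<mu>\<^sub>0 t = m"
    using Min_in[OF fin] unfolding m_def by auto
  define h where "h \<mu> = \<mu> - single t m" for \<mu> :: "nat \<Rightarrow>\<^sub>0 nat"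
  have h: "single t m + h \<mu> = \<mu>" if "\<mu> \<in> keys H" for \<mu>
    using m_le[OF that]
    by (intro poly_mapping_eqI) (auto simp: h_def lookup_add lookup_minus lookup_single when_def)
  define H' where "H' = push h H"
  have H_eq: "H = single (single t m) 1 * H'"
    unfolding H'_def monomial_mult_eq_push push_push
    by (rule push_id[symmetric]) (use h in auto)
  have keysH': "keys H' = h ` keys H"
    unfolding H'_def by (rule keys_push_inj) (metis h inj_onI)
  have "?e H = p ^ m * ?e H'"
  proof -
    have "mev (ps(t := p)) (single t m) = p ^ m"
      using mev_superset[of "{t}" "single t m" "ps(t := p)"] by simp
    then show ?thesis by (subst H_eq) (simp add: poly_subst_mult poly_subst_single)
  qed
  then have H'Q: "?e H' \<in> Q" using H(3) cprime_mult[OF Q] cprime_power[OF Q] p(2) by metis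
  define H0 where "H0 = part (\<lambda>\<mu>. lookup \<mu> t = 0) H'"
  have "h \<mu>\<^sub>0 \<in> keys H0" using \<mu>0 keysH' by (auto simp: H0_def keys_part h_def lookup_minus)
  then have H0: "H0 \<noteq> 0" by auto
  have vars: "poly_vars H0 \<subseteq> {..<t}"
  proof
    fix i assume "i \<in> poly_vars H0"
    then obtain \<mu> where \<mu>: "\<mu> \<in> keys H'" "lookup \<mu> t = 0" "i \<in> keys \<mu>"
      by (auto simp: poly_vars_def H0_def keys_part)
    then obtain \<nu> where \<nu>: "\<nu> \<in> keys H" "\<mu> = h \<nu>" using keysH' by auto
    then have "i \<in> keys \<nu>" using \<mu>(3) by (auto simp: h_def in_keys_iff lookup_minus)
    then have "i < Suc t" using H(2) \<nu>(1) by (auto simp: poly_vars_def)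
    moreover have "i \<noteq> t" using \<mu> by (auto simp: in_keys_iff)
    ultimately show "i \<in> {..<t}" by simp
  qed
  have "?e (part (\<lambda>\<mu>. lookup \<mu> t \<noteq> 0) H') \<in> P"
    unfolding poly_subst_def mev_def[symmetric]
  proof (rule cideal_sum[OF cprime_cideal[OF P]])
    fix \<mu> assume "\<mu> \<in> keys (part (\<lambda>\<mu>. lookup \<mu> t \<noteq> 0) H')"
    then have "t \<in> keys \<mu>" by (simp add: keys_part in_keys_iff)
    then have "p dvd mev (ps(t := p)) \<mu>"
      unfolding mev_def by (auto simp: prod.remove[of _ t] in_keys_iff dvd_power intro!: dvd_mult2)
    then show "Const (lookup (part (\<lambda>\<mu>. lookup \<mu> t \<noteq> 0) H') \<mu>) * mev (ps(t := p)) \<mu> \<in> P"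
      using cideal_dvd[OF cprime_cideal[OF P] p(1)] by (metis dvd_mult)
  qed
  moreover have "?e H' = ?e H0 + ?e (part (\<lambda>\<mu>. lookup \<mu> t \<noteq> 0) H')"
    unfolding H0_def by (metis part_split poly_subst_add)
  ultimately have "?e H0 \<in> P"
    using cideal_diff[OF cprime_cideal[OF P]] H'Q sub by (metis add_diff_cancel_right' subsetD)
  moreover have "?e H0 = poly_subst ps H0"
    using vars by (intro poly_subst_cong) (auto simp: poly_vars_def)
  ultimately show False using ind H0 vars by (auto simp: algindep_def)
qed

lemma vector_space_mpoly: "vector_space (\<lambda>c (p :: ('v, 'k::field) mpoly). Const c * p)"
  by unfold_locales (simp_all add: algebra_simps Const_add Const_mult)

text \<open>Polynomials with exponents in \<open>B\<close> form a space of dimension at most \<open>card B\<close>. The family \<open>f\<close>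
  need not be injective, so equal members are treated separately.\<close>

lemma linear_dependence:
  fixes f :: "'x \<Rightarrow> ('v, 'k::field) mpoly"
  assumes "finite X'" "finite B" "card B < card X'" "\<And>x. x \<in> X' \<Longrightarrow> keys (f x) \<subseteq> B"
  obtains c x where "x \<in> X'" "c x \<noteq> 0" "(\<Sum>x\<in>X'. Const (c x) * f x) = 0"
proof -
  interpret V: vector_space "\<lambda>c (p :: ('v, 'k) mpoly). Const c * p" by (rule vector_space_mpoly)
  show ?thesis
  proof (cases "inj_on f X'")
    case False
    then obtain x y where xy: "x \<in> X'" "y \<in> X'" "x \<noteq> y" "f x = f y" by (auto simp: inj_on_def)
    define c where "c z = (if z = x then 1 else if z = y then - 1 else 0 :: 'k)" for z
    have "(\<Sum>z\<in>X'. Const (c z) * f z) = (\<Sum>z\<in>{x, y}. Const (c z) * f z)"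
      using xy assms(1) by (intro sum.mono_neutral_right) (auto simp: c_def)
    also have "\<dots> = 0" using xy by (simp add: c_def Const_def single_uminus)
    finally show ?thesis using that[of x c] xy by (simp add: c_def)
  next
    case inj: True
    let ?T = "(\<lambda>\<mu>. single \<mu> (1::'k)) ` B"
    have "f ` X' \<subseteq> V.span ?T"
    proof
      fix p assume "p \<in> f ` X'"
      then have keys: "keys p \<subseteq> B" using assms(4) by auto
      have "(\<Sum>\<mu>\<in>keys p. Const (lookup p \<mu>) * single \<mu> 1) \<in> V.span ?T"
        using keys by (intro V.span_sum V.span_scale V.span_base) auto
      moreover have "(\<Sum>\<mu>\<in>keys p. Const (lookup p \<mu>) * single \<mu> 1) = p"
        by (simp add: Const_def mult_single sum_of_monomials[symmetric])
      ultimately show "p \<in> V.span ?T" by simp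
    qed
    moreover have "card ?T \<le> card B" using assms(2) by (rule card_image_le)
    moreover have "card (f ` X') = card X'" using inj by (rule card_image)
    ultimately have "V.dependent (f ` X')"
      using V.independent_span_bound[of ?T "f ` X'"] assms(2,3) by auto
    then obtain u v where u: "v \<in> f ` X'" "u v \<noteq> 0" "(\<Sum>v\<in>f ` X'. Const (u v) * v) = 0"
      using V.dependent_finite[of "f ` X'"] assms(1) by auto
    then obtain x where "x \<in> X'" "v = f x" by auto
    then show ?thesis using that[of x "u \<circ> f"] u inj by (simp add: sum.reindex)
  qed
qed

definition degbound :: "nat \<Rightarrow> ('v, 'k::comm_ring_1) mpoly \<Rightarrow> bool" where
  "degbound n p \<longleftrightarrow> (\<forall>\<mu>\<in>keys p. \<forall>v. lookup \<mu> v \<le> n)"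

lemma degbound_mult: "degbound m p \<Longrightarrow> degbound n q \<Longrightarrow> degbound (m + n) (p * q)"
  unfolding degbound_def by (auto elim!: keys_multE simp: lookup_add) (meson add_mono)

lemma degbound_power: "degbound m p \<Longrightarrow> degbound (n * m) (p ^ n)"
  by (induction n) (auto intro: degbound_mult simp: degbound_def[of 0])

lemma degbound_mono: "degbound m p \<Longrightarrow> m \<le> n \<Longrightarrow> degbound n p"
  unfolding degbound_def by (meson order_trans)

lemma degbound_prod:
  "finite S \<Longrightarrow> (\<And>i. i \<in> S \<Longrightarrow> degbound m (f i)) \<Longrightarrow> degbound (card S * m) (\<Prod>i\<in>S. f i)"
  by (induction S rule: finite_induct) (auto intro: degbound_mult simp: degbound_def[of 0])

lemma degbound_exists: "\<exists>n. degbound n (p :: ('v::finite, 'k::comm_ring_1) mpoly)"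
proof -
  let ?S = "(\<lambda>(\<mu>, v). lookup \<mu> v) ` (keys p \<times> UNIV)"
  have "finite ?S" by simp
  then have "degbound (Max ?S) p" unfolding degbound_def by (auto intro!: Max_ge)
  then show ?thesis ..
qed

lemma finite_box: "finite {\<mu> :: 'v::finite \<Rightarrow>\<^sub>0 nat. \<forall>v. lookup \<mu> v \<le> n}"
  and card_box: "card {\<mu> :: 'v::finite \<Rightarrow>\<^sub>0 nat. \<forall>v. lookup \<mu> v \<le> n} \<le> (n + 1) ^ CARD('v)"
proof -
  let ?B = "{\<mu> :: 'v::finite \<Rightarrow>\<^sub>0 nat. \<forall>v. lookup \<mu> v \<le> n}"
  let ?P = "PiE (UNIV :: 'v set) (\<lambda>_. {..n})"
  have inj: "inj_on lookup ?B" by (metis inj_onI lookup_inject)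
  have sub: "lookup ` ?B \<subseteq> ?P" by auto
  have fin: "finite ?P" by (intro finite_PiE) auto
  show "finite ?B" using inj_on_finite[OF inj sub fin] .
  have "card ?B \<le> card ?P" using card_inj_on_le[OF inj sub fin] .
  also have "card ?P = (n + 1) ^ CARD('v)" by (simp add: card_PiE)
  finally show "card ?B \<le> (n + 1) ^ CARD('v)" .
qed

text \<open>Count monomials. Those in \<open>t\<close> elements with exponents below \<open>N\<close> number \<open>N\<^sup>t\<close>, while their
  values have degrees at most \<open>t N d\<close> in each of \<open>r < t\<close> variables and so lie in a space of
  dimension at most \<open>(t N d + 1)\<^sup>r\<close>, which is smaller for large \<open>N\<close>.\<close>

lemma algebraic_dependence:
  fixes ps :: "nat \<Rightarrow> ('v::finite, 'k::field) mpoly"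
  assumes t: "CARD('v) < t"
  obtains H :: "(nat, 'k) mpoly" where "H \<noteq> 0" "poly_vars H \<subseteq> {..<t}" "poly_subst ps H = 0"
proof -
  have "\<forall>i. \<exists>n. degbound n (ps i)" using degbound_exists by blast
  then obtain b where b: "\<And>i. degbound (b i) (ps i)" by metis
  define d where "d = Max (b ` {..<t})"
  have d: "degbound d (ps i)" if "i < t" for i
    using b[of i] by (rule degbound_mono) (use that in \<open>auto simp: d_def\<close>)
  define r where "r = CARD('v)"
  \<comment> \<open>Large enough for \<open>((t d + 1) N)\<^sup>r < N\<^sup>r\<^sup>+\<^sup>1\<close>.\<close>
  define N where "N = (t * d + 1) ^ r + 1"
  have N: "N \<ge> 1" by (simp add: N_def)
  let ?X = "PiE {..<t} (\<lambda>_. {..<N})"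
  let ?B = "{\<mu> :: 'v \<Rightarrow>\<^sub>0 nat. \<forall>v. lookup \<mu> v \<le> t * (N * d)}"
  define M where "M f = (\<Prod>i<t. ps i ^ f i)" for f
  have finX: "finite ?X" by (intro finite_PiE) auto
  have "card ?B \<le> (t * (N * d) + 1) ^ r" unfolding r_def by (rule card_box)
  also have "\<dots> \<le> ((t * d + 1) * N) ^ r"
    using N by (intro power_mono) (auto simp: algebra_simps)
  also have "\<dots> = (t * d + 1) ^ r * N ^ r" by (rule power_mult_distrib)
  also have "\<dots> < N * N ^ r" using N by (intro mult_strict_right_mono) (auto simp: N_def)
  also have "\<dots> = N ^ Suc r" by simp
  also have "\<dots> \<le> N ^ t" using t N by (intro power_increasing) (auto simp: r_def)
  also have "\<dots> = card ?X" by (simp add: card_PiE)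
  finally have card: "card ?B < card ?X" .
  have bound: "keys (M f) \<subseteq> ?B" if f: "f \<in> ?X" for f
  proof -
    have "degbound (N * d) (ps i ^ f i)" if "i < t" for i
    proof -
      have "f i \<le> N" using f that by (auto simp: PiE_iff intro: less_imp_le)
      then show ?thesis using degbound_power[OF d[OF that], of "f i"] by (rule_tac degbound_mono) auto
    qed
    then have "degbound (t * (N * d)) (M f)"
      unfolding M_def using degbound_prod[of "{..<t}" "N * d" "\<lambda>i. ps i ^ f i"] by simp
    then show ?thesis by (auto simp: degbound_def)
  qed
  obtain c f\<^sub>0 where c: "f\<^sub>0 \<in> ?X" "c f\<^sub>0 \<noteq> 0" "(\<Sum>f\<in>?X. Const (c f) * M f) = 0"
    by (rule linear_dependence[OF finX finite_box card bound])
  define e where "e f = (\<Sum>i<t. single i (f i))" for f :: "nat \<Rightarrow> nat"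
  have lookup_e: "lookup (e f) i = (if i < t then f i else 0)" for f i
    by (auto simp: e_def lookup_sum lookup_single when_def)
  have inj: "f = g" if "f \<in> ?X" "g \<in> ?X" "e f = e g" for f g
    using that by (intro PiE_ext[OF that(1,2)]) (metis lessThan_iff lookup_e)
  define H where "H = (\<Sum>f\<in>?X. single (e f) (c f))"
  have "lookup H (e f\<^sub>0) = (\<Sum>f\<in>?X. if f = f\<^sub>0 then c f else 0)"
    unfolding H_def lookup_sum using inj[OF _ c(1)] by (intro sum.cong) (auto simp: lookup_single when_def)
  also have "\<dots> = c f\<^sub>0" using c(1) finX by simp
  finally have "H \<noteq> 0" using c(2) by auto
  moreover have "poly_vars H \<subseteq> {..<t}"
  proof
    fix i assume "i \<in> poly_vars H"
    then obtain \<mu> where "\<mu> \<in> keys H" "i \<in> keys \<mu>" by (auto simp: poly_vars_def)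
    moreover have "keys H \<subseteq> (\<Union>f\<in>?X. keys (single (e f) (c f)))" unfolding H_def by (rule keys_sum)
    ultimately obtain f where "i \<in> keys (e f)" by (auto split: if_splits)
    then show "i \<in> {..<t}" using lookup_e by (auto simp: in_keys_iff split: if_splits)
  qed
  moreover have "poly_subst ps H = 0"
  proof -
    have "mev ps (e f) = M f" for f
    proof -
      have "keys (e f) \<subseteq> {..<t}" by (rule subsetI) (metis in_keys_iff lessThan_iff lookup_e)
      then show ?thesis using mev_superset[of "{..<t}" "e f" ps] lookup_e by (simp add: M_def)
    qed
    then show ?thesis unfolding H_def poly_subst_sum poly_subst_single using c(3) by simp
  qed
  ultimately show ?thesis using that by blast
qed

text \<open>A member of \<open>Y\<close> that admits the largest number of algebraically independent elements is
  minimal.\<close>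

lemma cprime_minimal:
  fixes Y :: "('v::finite, 'k::field) mpoly set set"
  assumes Y: "\<And>J. J \<in> Y \<Longrightarrow> cprime J" "J0 \<in> Y"
  obtains M where "M \<in> Y" "\<And>J. J \<in> Y \<Longrightarrow> \<not> J \<subset> M"
proof -
  let ?T = "{t. \<exists>J\<in>Y. \<exists>ps. algindep J ps t}"
  have "t \<le> CARD('v)" if "t \<in> ?T" for t
  proof (rule ccontr)
    assume t: "\<not> t \<le> CARD('v)"
    obtain J ps where J: "J \<in> Y" "algindep J ps t" using \<open>t \<in> ?T\<close> by auto
    obtain H :: "(nat, 'k) mpoly" where "H \<noteq> 0" "poly_vars H \<subseteq> {..<t}" "poly_subst ps H = 0"
      using algebraic_dependence[of t ps] t by (metis not_le)
    then show False using J(2) cideal_0[OF cprime_cideal[OF Y(1)[OF J(1)]]] unfolding algindep_def by metis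
  qed
  then have fin: "finite ?T" by (meson finite_nat_set_iff_bounded_le)
  have "algindep J0 (\<lambda>_. 0) 0"
    unfolding algindep_def
  proof (intro allI impI notI)
    fix H :: "(nat, 'k) mpoly" assume H: "H \<noteq> 0" "poly_vars H \<subseteq> {..<0}" "poly_subst (\<lambda>_. 0) H \<in> J0"
    have *: "\<mu> = 0" if "\<mu> \<in> keys H" for \<mu>
      using that H(2) by (auto simp: poly_vars_def)
    have eq: "H = single 0 (lookup H 0)"
      by (rule poly_mapping_eqI) (metis * in_keys_iff lookup_single_eq lookup_single_not_eq)
    have "poly_subst (\<lambda>_. 0) (single 0 (lookup H 0)) = (Const (lookup H 0) :: ('v, 'k) mpoly)"
      by (simp add: poly_subst_single mev_def)
    then have H': "poly_subst (\<lambda>_. 0) H = (Const (lookup H 0) :: ('v, 'k) mpoly)"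
      by (subst eq)
    have "lookup H 0 \<noteq> 0" using H(1) eq by (metis single_zero)
    note H' = H' this
    have "Const (inverse (lookup H 0)) * Const (lookup H 0) \<in> J0"
      using H(3) cideal_mult[OF cprime_cideal[OF Y(1)[OF Y(2)]]] unfolding H'(1) by blast
    then show False using cprime_1[OF Y(1)[OF Y(2)]] H'(2) Const_inverse by (metis mult.commute)
  qed
  then have "?T \<noteq> {}" using Y(2) by blast
  then have "Max ?T \<in> ?T" using fin Max_in by blast
  then obtain M ps where M: "M \<in> Y" "algindep M ps (Max ?T)" by blast
  have "\<not> J \<subset> M" if J: "J \<in> Y" for J
  proof
    assume "J \<subset> M"
    then obtain p where "p \<in> M" "p \<notin> J" "J \<subseteq> M" by blast
    then have "algindep J (ps(Max ?T := p)) (Suc (Max ?T))"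
      using algindep_extend[OF Y(1)[OF J] Y(1)[OF M(1)]] M(2) by blast
    then have "Suc (Max ?T) \<in> ?T" using J by blast
    then have "Suc (Max ?T) \<le> Max ?T" using Max_ge[OF fin] by blast
    then show False by simp
  qed
  then show ?thesis using that M(1) by blast
qed

section \<open>Factorization in rings graded by a torsion-free group\<close>

text \<open>Take the component of the expected degree in the equation \<open>y = p * b\<close> modulo \<open>M\<close>.\<close>

lemma homogeneous_cofactor_degree:
  assumes L: "add_subgroup L" and M: "hcomp_closed L M"
    and y: "homd L \<kappa> y" and p: "homd L \<rho> p" and yp: "y - p * b \<in> M"
  obtains b' where "homd L (\<kappa> - \<rho>) b'" "y - p * b' \<in> M"
proof -
  have "hcomp L \<kappa> (y - p * b) = y - p * hcomp L (\<kappa> - \<rho>) b"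
    by (simp add: hcomp_diff hcomp_mult[OF L p] hcomp_homd[OF y])
  moreover have "hcomp L \<kappa> (y - p * b) \<in> M" using M yp by (auto simp: hcomp_closed_def)
  ultimately show ?thesis using that[of "hcomp L (\<kappa> - \<rho>) b"] by simp
qed

lemma homogeneous_cofactor:
  assumes L: "add_subgroup L" and M: "hcomp_closed L M"
    and y: "homog L y" and p: "homog L p" and yp: "y - p * b \<in> M"
  obtains b' where "homog L b'" "y - p * b' \<in> M"
proof -
  obtain \<kappa> \<rho> where "homd L \<kappa> y" "homd L \<rho> p" using y p by (auto simp: homog_def)
  from homogeneous_cofactor_degree[OF L M this yp] show ?thesis using that homogI by metis
qed

definition hprime_elem :: "(int^'v) set \<Rightarrow> ('v::finite, 'k::comm_ring_1) mpoly \<Rightarrow> ('v, 'k) mpoly \<Rightarrow> bool" where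
  "hprime_elem L F p \<longleftrightarrow> homog L p \<and> \<not> F dvd p \<and> hprime L (pid F p)"

text \<open>Homogeneous elements that are, modulo \<open>F\<close>, a unit times a product of homogeneous primes. The
  congruence in the second rule absorbs changes of the representative.\<close>

inductive hfac :: "(int^'v) set \<Rightarrow> ('v::finite, 'k::comm_ring_1) mpoly \<Rightarrow> ('v, 'k) mpoly \<Rightarrow> bool"
  for L F where
  unit: "homog L u \<Longrightarrow> F dvd u * v - 1 \<Longrightarrow> hfac L F u"
| mult: "hfac L F x \<Longrightarrow> hprime_elem L F p \<Longrightarrow> homog L y \<Longrightarrow> F dvd y - x * p \<Longrightarrow> hfac L F y"

lemma hfac_homog: "hfac L F x \<Longrightarrow> homog L x"
  by (induction rule: hfac.induct)

lemma hfac_1: "add_subgroup L \<Longrightarrow> hfac L F 1"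
  by (rule hfac.unit[of _ _ _ 1]) (auto intro: homog_1)

lemma hfac_hprime_elem: "add_subgroup L \<Longrightarrow> hprime_elem L F p \<Longrightarrow> hfac L F p"
  by (rule hfac.mult[of _ _ 1 p]) (auto intro: hfac_1 simp: hprime_elem_def)

lemma hfac_mult:
  assumes L: "add_subgroup L"
  shows "hfac L F x \<Longrightarrow> hfac L F y \<Longrightarrow> hfac L F (x * y)"
proof (induction arbitrary: y rule: hfac.induct)
  case (unit u v)
  from unit(3) show ?case
  proof (induction rule: hfac.induct)
    case (unit u' v')
    have "F dvd u * v * (u' * v' - 1) + (u * v - 1)"
      using unit.hyps \<open>F dvd u * v - 1\<close> by (intro dvd_add dvd_mult)
    also have "u * v * (u' * v' - 1) + (u * v - 1) = (u * u') * (v * v') - 1" by (simp add: algebra_simps)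
    finally show ?case using unit.hyps \<open>homog L u\<close> homog_mult[OF L] hfac.unit by blast
  next
    case (mult x p y)
    have "F dvd u * (y - x * p)" using mult.hyps by (intro dvd_mult)
    then have "F dvd u * y - u * x * p" by (simp add: algebra_simps)
    then show ?case using mult hfac.mult homog_mult[OF L] \<open>homog L u\<close> by blast
  qed
next
  case (mult x p z)
  have "F dvd (z - x * p) * y" using mult.hyps by (intro dvd_mult2)
  then have "F dvd z * y - (x * y) * p" by (simp add: algebra_simps)
  then show ?case
    using mult hfac.mult[OF mult.IH[OF mult.prems]] homog_mult[OF L _ hfac_homog[OF mult.prems]] by blast
qed

lemma prime_modD: "prime_mod F \<Longrightarrow> F dvd p * q \<Longrightarrow> F dvd p \<or> F dvd q"
  by (simp add: prime_mod_def)

lemma hprime_elem_divides: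
  assumes L: "add_subgroup L" and F: "homog L F" and p: "hprime_elem L F p"
    and xy: "homog L x" "homog L y" "x * y \<in> pid F p"
  obtains x' where "homog L x'" "F dvd x - p * x'" | y' where "homog L y'" "F dvd y - p * y'"
proof -
  have *: "\<exists>z'. homog L z' \<and> F dvd z - p * z'" if "homog L z" "z \<in> pid F p" for z
  proof -
    obtain b where "F dvd z - p * b" using \<open>z \<in> pid F p\<close> by (auto simp: pid_def)
    then show ?thesis
      using homogeneous_cofactor[OF L hcomp_closed_multiples[OF L F] \<open>homog L z\<close>, of p b] p
      by (auto simp: hprime_elem_def)
  qed
  have "x \<in> pid F p \<or> y \<in> pid F p"
    using p xy by (auto simp: hprime_elem_def hprime_def)
  then show ?thesis using * xy that by metis
qed

text \<open>Each prime factor of \<open>w\<close> divides one of the two cofactors; cancel it there. So the products of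
  primes form a saturated multiplicative set.\<close>

lemma hfac_divisor:
  assumes L: "add_subgroup L" and F: "homog L F" "prime_mod F"
  shows "hfac L F w \<Longrightarrow> homog L x \<Longrightarrow> homog L y \<Longrightarrow> F dvd w - x * y \<Longrightarrow> hfac L F x"
proof (induction arbitrary: x y rule: hfac.induct)
  case (unit u v)
  have "F dvd (u * v - 1) - (u - x * y) * v"
    using dvd_diff[OF unit.hyps(2) dvd_mult2[OF unit.prems(3)]] .
  also have "(u * v - 1) - (u - x * y) * v = x * (y * v) - 1" by (simp add: algebra_simps)
  finally show ?case using hfac.unit unit.prems by blast
next
  case (mult w p z)
  have p: "homog L p" "\<not> F dvd p" using mult.hyps by (auto simp: hprime_elem_def)
  have eq: "F dvd w * p - x * y"
  proof -
    have "F dvd (z - x * y) - (z - w * p)"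
      using dvd_diff[OF mult.prems(3) mult.hyps(4)] .
    then show ?thesis by simp
  qed
  then have "F dvd x * y - p * w" by (metis dvd_minus_iff minus_diff_eq mult.commute)
  then have "x * y \<in> pid F p" by (rule pid_memI)
  with L F(1) mult.hyps(2) mult.prems(1,2) show ?case
  proof (rule hprime_elem_divides)
    fix x' assume x': "homog L x'" "F dvd x - p * x'"
    have "F dvd (w * p - x * y) + (x - p * x') * y" using eq x' by simp
    also have "(w * p - x * y) + (x - p * x') * y = p * (w - x' * y)" by (simp add: algebra_simps)
    finally have "F dvd w - x' * y" using prime_modD[OF F(2)] p(2) by blast
    then have "hfac L F x'" using mult.IH x'(1) mult.prems by blast
    then show ?thesis using hfac.mult[OF _ mult.hyps(2) mult.prems(1)] x'(2) by (metis mult.commute)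
  next
    fix y' assume y': "homog L y'" "F dvd y - p * y'"
    have "F dvd (w * p - x * y) + x * (y - p * y')" using eq y' by simp
    also have "(w * p - x * y) + x * (y - p * y') = p * (w - x * y')" by (simp add: algebra_simps)
    finally have "F dvd w - x * y'" using prime_modD[OF F(2)] p(2) by blast
    then show ?thesis using mult.IH y'(1) mult.prems by blast
  qed
qed

text \<open>If \<open>x\<close> is not a product of primes, the ideal of its multiples contains no such product, since
  divisors of products of primes are again such products. A homogeneous ideal maximal with this
  property is prime, but by hypothesis contains a prime element.\<close>

lemma kaplansky:
  fixes F :: "('v::finite, 'k::field) mpoly"
  assumes L: "add_subgroup L" and F: "homog L F" "prime_mod F"
    and kap: "\<And>P. gprime L F P \<Longrightarrow> \<exists>p\<in>P. \<not> F dvd p \<Longrightarrow> \<exists>p\<in>P. hprime_elem L F p"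
    and x: "homog L x" "\<not> F dvd x"
  shows "hfac L F x"
proof (rule ccontr)
  assume nx: "\<not> hfac L F x"
  define Y where "Y = {I. cideal I \<and> F \<in> I \<and> hcomp_closed L I \<and> x \<in> I \<and> (\<forall>y\<in>I. \<not> hfac L F y)}"
  have "\<not> hfac L F y" if "y \<in> pid F x" for y
  proof
    assume y: "hfac L F y"
    obtain b where "F dvd y - x * b" using \<open>y \<in> pid F x\<close> by (auto simp: pid_def)
    then obtain b' where "homog L b'" "F dvd y - x * b'"
      using homogeneous_cofactor[OF L hcomp_closed_multiples[OF L F(1)] hfac_homog[OF y] x(1), of b] by auto
    then show False using nx hfac_divisor[OF L F y x(1)] by blast
  qed
  then have "pid F x \<in> Y" using hcomp_closed_pid[OF L F(1) x(1)] by (auto simp: Y_def)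
  then obtain M where M: "M \<in> Y" and max: "\<And>I. I \<in> Y \<Longrightarrow> \<not> M \<subset> I"
    using noetherian_maximal[of Y "pid F x"] unfolding Y_def by blast
  have M': "cideal M" "F \<in> M" "hcomp_closed L M" "x \<in> M" "\<And>y. y \<in> M \<Longrightarrow> \<not> hfac L F y"
    using M by (auto simp: Y_def)
  have ext: "\<exists>y b. hfac L F y \<and> homog L b \<and> y - p * b \<in> M" if p: "homog L p" "p \<notin> M" for p
  proof -
    have "M \<subset> adjoin M p" using adjoin_sup adjoin_gen[OF M'(1)] p(2) by blast
    then have "adjoin M p \<notin> Y" using max by blast
    moreover have "F \<in> adjoin M p" "x \<in> adjoin M p" using adjoin_sup M'(2,4) by blast+
    ultimately obtain y where y: "y \<in> adjoin M p" "hfac L F y"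
      unfolding Y_def using cideal_adjoin[OF M'(1)] hcomp_closed_adjoin[OF L M'(3) p(1)] by blast
    then obtain b where "y - p * b \<in> M" by (auto simp: adjoin_def)
    then show ?thesis
      using homogeneous_cofactor[OF L M'(3) hfac_homog[OF y(2)] p(1)] y(2) by blast
  qed
  have "gprime L F M"
    unfolding gprime_def hprime_def
  proof (intro conjI allI impI M')
    show "1 \<notin> M" using M'(5) hfac_1[OF L] by blast
    fix p q assume pq: "homog L p" "homog L q" "p * q \<in> M"
    show "p \<in> M \<or> q \<in> M"
    proof (rule ccontr)
      assume "\<not> (p \<in> M \<or> q \<in> M)"
      then obtain y b y' b' where *: "hfac L F y" "y - p * b \<in> M" "hfac L F y'" "y' - q * b' \<in> M"
        using ext pq by metis
      have "y' * (y - p * b) + p * b * (y' - q * b') + p * q * (b * b') \<in> M"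
        using * pq(3) by (intro cideal_add[OF M'(1)] cideal_mult[OF M'(1)] cideal_mult2[OF M'(1) pq(3)])
      also have "y' * (y - p * b) + p * b * (y' - q * b') + p * q * (b * b') = y * y'"
        by (simp add: algebra_simps)
      finally show False using M'(5) hfac_mult[OF L *(1,3)] by blast
    qed
  qed
  then obtain p where "p \<in> M" "hprime_elem L F p" using kap M'(4) x(2) by blast
  then show False using M'(5) hfac_hprime_elem[OF L] by blast
qed

text \<open>In a ring graded by the integers, the degree of a Laurent polynomial: the difference of the
  highest and the lowest degree that occur modulo \<open>F\<close>.\<close>

definition width :: "int^'v \<Rightarrow> ('v::finite, 'k::comm_ring_1) mpoly \<Rightarrow> ('v, 'k) mpoly \<Rightarrow> nat" where
  "width c F p = nat (Max (cdegs c {q. F dvd q} p) - Min (cdegs c {q. F dvd q} p))"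

lemma hprime_elem_coarsen:
  assumes L: "add_subgroup L" and F: "homog (L \<inter> ker c) F" and p: "hprime_elem (L \<inter> ker c) F p"
  shows "hprime_elem L F p"
proof -
  have L': "add_subgroup (L \<inter> ker c)" using add_subgroup_Int[OF L add_subgroup_ker] .
  have *: "homog (L \<inter> ker c) p" "hprime (L \<inter> ker c) (pid F p)" "\<not> F dvd p"
    using p by (auto simp: hprime_elem_def)
  have "cpart_closed c (pid F p)"
    by (rule cpart_closed_of_hcomp_closed[OF L' _ cideal_pid hcomp_closed_pid[OF L' F *(1)]]) simp
  then have "hprime L (pid F p)" using hprime_coarsen[OF L cideal_pid *(2)] by blast
  then show ?thesis using * homog_coarsen[of "L \<inter> ker c" p L] by (auto simp: hprime_elem_def)
qed

lemma dvd_mult_cancel_mod: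
  assumes "prime_mod F" "\<not> F dvd p" "F dvd p * x - p * y"
  shows "F dvd x - y"
  using assms prime_modD[of F p "x - y"] by (simp add: algebra_simps)

text \<open>If \<open>P\<close> contains a nonzero element that is homogeneous for the finer grading, then it contains
  a prime factor of this element. Otherwise the situation resembles a prime ideal of a Laurent
  polynomial ring over a factorial ring that contains no nonzero coefficient. As there, \<open>P\<close> is
  generated by an element \<open>g\<close> of smallest width that is primitive, i.e. not divisible by primes
  of the finer grading: pseudo-division by \<open>g\<close> puts a multiple \<open>h * f\<close> of every \<open>f\<close> in \<open>P\<close> into
  the ideal of \<open>g\<close>, where \<open>h\<close> is homogeneous for the finer grading, and the prime factors of \<open>h\<close>
  can be cancelled one by one because none of them divides \<open>g\<close>.\<close>

lemma coarsening_step: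
  fixes F :: "('v::finite, 'k::field) mpoly"
  assumes L: "add_subgroup L" and F: "homog (L \<inter> ker c) F" "prime_mod F"
    and fine: "\<And>x. homog (L \<inter> ker c) x \<Longrightarrow> \<not> F dvd x \<Longrightarrow> hfac (L \<inter> ker c) F x"
    and P: "gprime L F P" "\<exists>p\<in>P. \<not> F dvd p"
  shows "\<exists>p\<in>P. hprime_elem L F p"
proof -
  let ?L = "L \<inter> ker c" and ?Z = "{q. F dvd q}"
  have L': "add_subgroup ?L" using add_subgroup_Int[OF L add_subgroup_ker] .
  have FL: "homog L F" using homog_coarsen[OF F(1)] by blast
  have P': "cideal P" "F \<in> P" "hcomp_closed L P" "1 \<notin> P"
    "\<And>p q. homog L p \<Longrightarrow> homog L q \<Longrightarrow> p * q \<in> P \<Longrightarrow> p \<in> P \<or> q \<in> P"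
    using P(1) by (auto simp: gprime_def hprime_def)
  have Z: "cideal ?Z" by (rule cideal_multiples)
  have ZP: "p \<in> P" if "F dvd p" for p using cideal_dvd[OF P'(1,2) that] .
  have PZ: "p \<in> P \<longleftrightarrow> q \<in> P" if "F dvd p - q" for p q
    using cideal_diff_iff[OF P'(1) ZP[OF that]] .
  show ?thesis
  proof (cases "\<exists>y\<in>P. homog ?L y \<and> \<not> F dvd y")
    case True
    then obtain y where y: "y \<in> P" "hfac ?L F y" using fine by blast
    from y(2,1) have "\<exists>p\<in>P. hprime_elem ?L F p"
    proof (induction rule: hfac.induct)
      case (unit u v)
      then have "u * v \<in> P" using cideal_mult2[OF P'(1)] by blast
      then show ?case using PZ[OF unit(2)] P'(4) by blast
    next
      case (mult x p y)
      then have "x * p \<in> P" using PZ by blast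
      moreover have "homog L x" "homog L p"
        using hfac_homog[OF mult.hyps(1)] mult.hyps(2) homog_coarsen[of ?L _ L] by (auto simp: hprime_elem_def)
      ultimately show ?case using P'(5) mult by blast
    qed
    then show ?thesis using hprime_elem_coarsen[OF L F(1)] by blast
  next
    case False
    then have none: "F dvd y" if "y \<in> P" "homog ?L y" for y using that by blast
    define G where "G = {g \<in> P. homog L g \<and> \<not> F dvd g}"
    obtain p\<^sub>0 where p0: "p\<^sub>0 \<in> P" "\<not> F dvd p\<^sub>0" using P(2) by blast
    have "G \<noteq> {}"
    proof
      assume "G = {}"
      then have "F dvd hcomp L \<kappa> p\<^sub>0" for \<kappa>
        using p0 P'(3) by (auto simp: G_def hcomp_closed_def)
      moreover obtain S where "p\<^sub>0 = (\<Sum>\<kappa>\<in>S. hcomp L \<kappa> p\<^sub>0)" using hcomp_decomposition[OF L] by metis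
      ultimately show False using p0(2) dvd_sum by metis
    qed
    define w where "w = (LEAST n. \<exists>g\<in>G. width c F g = n)"
    have "\<exists>g\<in>G. width c F g = w"
      unfolding w_def by (rule LeastI_ex) (use \<open>G \<noteq> {}\<close> in blast)
    have w_le: "w \<le> width c F g" if "g \<in> G" for g
      unfolding w_def by (rule Least_le) (use that in blast)
    \<comment> \<open>Among the elements of smallest width, one with a maximal ideal is primitive: dividing by
      a prime of the finer grading keeps the width and enlarges the ideal.\<close>
    obtain g where g: "g \<in> G" "width c F g = w"
      and gmax: "\<And>q. q \<in> G \<Longrightarrow> width c F q = w \<Longrightarrow> \<not> pid F g \<subset> pid F q"
    proof -
      let ?Y = "pid F ` {g \<in> G. width c F g = w}"
      obtain g0 where g0: "pid F g0 \<in> ?Y" using \<open>\<exists>g\<in>G. width c F g = w\<close> by blast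
      have cid: "cideal I" if "I \<in> ?Y" for I using that by auto
      have "\<exists>M\<in>?Y. \<forall>I\<in>?Y. \<not> M \<subset> I"
      proof (rule noetherian_maximal[OF cid g0])
        fix M assume M: "M \<in> ?Y" "\<And>I. I \<in> ?Y \<Longrightarrow> \<not> M \<subset> I"
        show ?thesis by (rule bexI[OF _ M(1)], rule ballI, erule M(2))
      qed
      then obtain M where M: "M \<in> ?Y" "\<forall>I\<in>?Y. \<not> M \<subset> I" by (elim bexE)
      from M(1) obtain g where g: "g \<in> G" "width c F g = w" "M = pid F g" by blast
      show ?thesis
      proof (rule that[OF g(1,2)])
        fix q assume "q \<in> G" "width c F q = w"
        then have "pid F q \<in> ?Y" by simp
        then have "\<not> M \<subset> pid F q" by (rule bspec[OF M(2)])
        then show "\<not> pid F g \<subset> pid F q" unfolding g(3) .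
      qed
    qed
    have g': "g \<in> P" "homog L g" "g \<notin> ?Z" using g(1) by (auto simp: G_def)
    have coprime: "\<not> F dvd g - p * q" if p: "hprime_elem ?L F p" and q: "homog L q" for p q
    proof
      assume gpq: "F dvd g - p * q"
      have p': "homog ?L p" "\<not> F dvd p" "1 \<notin> pid F p"
        using p by (auto simp: hprime_elem_def hprime_def)
      have pP: "p \<notin> P" using none p' by blast
      have "p * q \<in> P" using PZ[OF gpq] g'(1) by blast
      then have qP: "q \<in> P" using P'(5)[OF _ q] homog_coarsen[OF p'(1)] pP by blast
      have nq: "\<not> F dvd q"
      proof
        assume "F dvd q"
        then have "F dvd (g - p * q) + p * q" using gpq by (intro dvd_add dvd_mult)
        then show False using g'(3) by simp
      qed
      obtain \<kappa> where \<kappa>: "homd (ker c) \<kappa> p" using homog_coarsen[OF p'(1), of "ker c"] by (auto simp: homog_def)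
      let ?e = "pairing c \<kappa>"
      have cpart_g: "F dvd cpart c n g \<longleftrightarrow> F dvd cpart c (n - ?e) q" for n
      proof -
        have "cpart_closed c ?Z"
          by (rule cpart_closed_of_hcomp_closed[OF L' _ Z hcomp_closed_multiples[OF L' F(1)]]) simp
        then have "F dvd cpart c n (g - p * q)" using gpq by (auto simp: cpart_closed_def)
        then have "F dvd cpart c n g - p * cpart c (n - ?e) q" by (simp add: cpart_diff cpart_mult[OF \<kappa>])
        then have "F dvd cpart c n g \<longleftrightarrow> F dvd p * cpart c (n - ?e) q"
          using cideal_diff_iff[OF Z, of "cpart c n g" "p * cpart c (n - ?e) q"] by simp
        then show ?thesis using prime_modD[OF F(2), of p "cpart c (n - ?e) q"] p'(2) by (metis dvd_mult)
      qed
      \<comment> \<open>Multiplication by \<open>p\<close> shifts all degrees by that of \<open>p\<close>.\<close>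
      have "cdegs c ?Z g = (\<lambda>n. n + ?e) ` cdegs c ?Z q"
      proof (intro equalityI subsetI)
        fix n assume "n \<in> cdegs c ?Z g"
        then have "n - ?e \<in> cdegs c ?Z q" using cpart_g[of n] by (simp add: cdegs_def)
        then show "n \<in> (\<lambda>n. n + ?e) ` cdegs c ?Z q" by (intro image_eqI[of _ _ "n - ?e"]) simp_all
      next
        fix n assume "n \<in> (\<lambda>n. n + ?e) ` cdegs c ?Z q"
        then obtain k where "n = k + ?e" "k \<in> cdegs c ?Z q" by blast
        then show "n \<in> cdegs c ?Z g" using cpart_g[of n] by (simp add: cdegs_def)
      qed
      moreover have "Max ((\<lambda>n. n + ?e) ` cdegs c ?Z q) = Max (cdegs c ?Z q) + ?e"
          "Min ((\<lambda>n. n + ?e) ` cdegs c ?Z q) = Min (cdegs c ?Z q) + ?e"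
        using Max_add_commute[of "cdegs c ?Z q" "\<lambda>n. n" ?e] Min_add_commute[of "cdegs c ?Z q" "\<lambda>n. n" ?e]
          finite_cdegs[OF Z, of c q] cdegs_nonempty[OF Z, of q c] nq by simp_all
      ultimately have wq: "width c F q = w" using g(2) by (simp add: width_def)
      have "q \<in> G" using qP q nq unfolding G_def by blast
      then have "\<not> pid F g \<subset> pid F q" by (rule gmax[OF _ wq])
      moreover have "g \<in> pid F q" using gpq by (intro pid_memI[of _ _ _ p]) (simp add: mult.commute)
      then have "pid F g \<subseteq> pid F q" by (intro pid_least) auto
      ultimately have "pid F q = pid F g" by (metis psubsetI)
      then have "q \<in> pid F g" using pid_gen(1)[of q F] by simp
      then obtain b where "F dvd q - g * b" by (auto simp: pid_def)
      then have "F dvd (q - g * b) + (g - p * q) * b" using gpq by (intro dvd_add dvd_mult2)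
      also have "(q - g * b) + (g - p * q) * b = q * (1 - p * b)" by (simp add: algebra_simps)
      finally have "F dvd 1 - p * b" using prime_modD[OF F(2)] nq by blast
      then show False using p'(3) pid_memI by blast
    qed
    have pseudo: "\<exists>h. homog ?L h \<and> \<not> F dvd h \<and> h * f \<in> pid F g" if "f \<in> P" "homog L f" for f
      using that
    proof (induction "width c F f" arbitrary: f rule: less_induct)
      case less
      show ?case
      proof (cases "F dvd f")
        case True
        have "homog ?L 1" using homog_1[OF L'] .
        moreover have "\<not> F dvd 1" using F(2) by (simp add: prime_mod_def)
        moreover have "1 * f \<in> pid F g" using True cideal_dvd[OF cideal_pid pid_gen(2)] by simp
        ultimately show ?thesis by blast
      next
        case nf: False
        then have fG: "f \<in> G" using less.prems by (simp add: G_def)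
        have fZ: "f \<notin> ?Z" using nf by simp
        let ?m = "Max (cdegs c ?Z f)" and ?k = "Max (cdegs c ?Z g)"
        let ?m' = "Min (cdegs c ?Z f)" and ?k' = "Min (cdegs c ?Z g)"
        define a b where "a = cpart c ?m f" and "b = cpart c ?k g"
        have ab: "\<not> F dvd a" "\<not> F dvd b"
          using cdegs_Max(1)[OF Z fZ, of c] cdegs_Max(1)[OF Z g'(3), of c] by (auto simp: a_def b_def)
        have abh: "homog ?L a" "homog ?L b"
          using homog_cpart[OF L] less.prems(2) g'(2) by (auto simp: a_def b_def)
        \<comment> \<open>Cross-multiplication with the leading components cancels the highest degree. As \<open>g\<close>
          is not wider than \<open>f\<close>, no degree below the lowest one of \<open>b * f\<close> appears.\<close>
        define f' where "f' = b * f - a * g"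
        have f'P: "f' \<in> P" unfolding f'_def using less.prems(1) g'(1)
          by (intro cideal_diff[OF P'(1)] cideal_mult[OF P'(1)])
        obtain \<kappa> \<rho> where \<kappa>: "homd L \<kappa> f" "homd L \<rho> g" using less.prems(2) g'(2) by (auto simp: homog_def)
        then have "homd L \<kappa> a" "homd L \<rho> b" by (auto simp: a_def b_def cpart_def homd_part)
        then have "homd L (\<kappa> + \<rho>) (b * f)" "homd L (\<kappa> + \<rho>) (a * g)"
          using homd_mult[OF L] \<kappa> by (metis add.commute)+
        then have f'h: "homog L f'" unfolding f'_def using homd_diff homogI by blast
        have cf': "cpart c n f' = b * cpart c (n - ?k) f - a * cpart c (n - ?m) g" for n
          unfolding f'_def cpart_diff unfolding a_def b_def cpart_cpart_mult ..
        have wle: "?k - ?k' \<le> ?m - ?m'"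
        proof -
          have "?k' \<le> ?k" using cdegs_Max(1)[OF Z g'(3), of c] cdegs_Min(3)[OF Z g'(3)] by (simp add: cdegs_def)
          moreover have "?m' \<le> ?m"
            using cdegs_Max(1)[OF Z fZ, of c] cdegs_Min(3)[OF Z fZ] by (simp add: cdegs_def)
          moreover have "nat (?k - ?k') \<le> nat (?m - ?m')"
            using w_le[OF fG] g(2) unfolding width_def by simp
          ultimately show ?thesis by linarith
        qed
        have deg_f': "?m' + ?k \<le> n \<and> n < ?m + ?k" if "n \<in> cdegs c ?Z f'" for n
        proof (rule ccontr)
          assume *: "\<not> (?m' + ?k \<le> n \<and> n < ?m + ?k)"
          have "F dvd cpart c n f'"
          proof (cases "n = ?m + ?k")
            case True
            then show ?thesis unfolding cf' by (simp add: a_def b_def mult.commute)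
          next
            case False
            with * have "(n - ?k < ?m' \<and> n - ?m < ?k') \<or> (n - ?k > ?m \<and> n - ?m > ?k)"
              using wle by linarith
            then have "F dvd cpart c (n - ?k) f \<and> F dvd cpart c (n - ?m) g"
              using cdegs_Max(2)[OF Z fZ] cdegs_Min(2)[OF Z fZ] cdegs_Max(2)[OF Z g'(3)] cdegs_Min(2)[OF Z g'(3)]
              by blast
            then show ?thesis unfolding cf' by (intro dvd_diff dvd_mult) auto
          qed
          then show False using that by (simp add: cdegs_def)
        qed
        have "\<exists>h. homog ?L h \<and> \<not> F dvd h \<and> h * f' \<in> pid F g"
        proof (cases "F dvd f'")
          case True
          have "homog ?L 1" using homog_1[OF L'] .
          moreover have "\<not> F dvd 1" using F(2) by (simp add: prime_mod_def)
          moreover have "1 * f' \<in> pid F g" using True cideal_dvd[OF cideal_pid pid_gen(2)] by simp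
          ultimately show ?thesis by blast
        next
          case False
          then have f'Z: "f' \<notin> ?Z" by simp
          have "Max (cdegs c ?Z f') \<in> cdegs c ?Z f'" "Min (cdegs c ?Z f') \<in> cdegs c ?Z f'"
            using Max_in[OF finite_cdegs[OF Z] cdegs_nonempty[OF Z f'Z]]
              Min_in[OF finite_cdegs[OF Z] cdegs_nonempty[OF Z f'Z]] .
          then have "?m' + ?k \<le> Min (cdegs c ?Z f')" "Max (cdegs c ?Z f') < ?m + ?k"
            "Min (cdegs c ?Z f') \<le> Max (cdegs c ?Z f')"
            using deg_f' cdegs_Max(3)[OF Z f'Z] by blast+
          then have "width c F f' < width c F f" unfolding width_def by linarith
          then show ?thesis using less.hyps f'P f'h by blast
        qed
        then obtain h where h: "homog ?L h" "\<not> F dvd h" "h * f' \<in> pid F g" by blast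
        have "h * f' + g * (h * a) \<in> pid F g"
          using h(3) cideal_add[OF cideal_pid] cideal_mult2[OF cideal_pid pid_gen(1)] by blast
        also have "h * f' + g * (h * a) = (h * b) * f" by (simp add: f'_def algebra_simps)
        finally have "(h * b) * f \<in> pid F g" .
        moreover have "homog ?L (h * b)" using homog_mult[OF L' h(1) abh(2)] .
        moreover have "\<not> F dvd h * b" using prime_modD[OF F(2)] h(2) ab(2) by blast
        ultimately show ?thesis by blast
      qed
    qed
    have strip: "f \<in> pid F g" if "hfac ?L F h" "homog L f" "h * f \<in> pid F g" for h f
      using that
    proof (induction arbitrary: f rule: hfac.induct)
      case (unit u v)
      have "u * v - 1 \<in> pid F g" using cideal_dvd[OF cideal_pid pid_gen(2) unit.hyps(2)] .
      from cideal_diff[OF cideal_pid cideal_mult[OF cideal_pid unit.prems(2)] cideal_mult[OF cideal_pid this]]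
      have "v * (u * f) - f * (u * v - 1) \<in> pid F g" .
      then show ?case by (simp add: algebra_simps)
    next
      case (mult x p y)
      have p: "homog L p" "\<not> F dvd p" "hprime_elem L F p"
        using mult.hyps(2) hprime_elem_coarsen[OF L F(1)] by (auto simp: hprime_elem_def)
      have "y - x * p \<in> pid F g" using cideal_dvd[OF cideal_pid pid_gen(2) mult.hyps(4)] .
      from cideal_diff[OF cideal_pid mult.prems(2) cideal_mult2[OF cideal_pid this]]
      have "y * f - (y - x * p) * f \<in> pid F g" .
      then have "x * (p * f) \<in> pid F g" by (simp add: algebra_simps)
      then have "p * f \<in> pid F g" using mult.IH homog_mult[OF L p(1) mult.prems(1)] by blast
      then obtain q where "F dvd p * f - g * q" by (auto simp: pid_def)
      then obtain q' where q': "homog L q'" "F dvd p * f - g * q'"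
        using homogeneous_cofactor[OF L hcomp_closed_multiples[OF L FL] homog_mult[OF L p(1) mult.prems(1)] g'(2)]
        by blast
      then have "F dvd g * q' - p * f" by (metis dvd_minus_iff minus_diff_eq)
      then have "g * q' \<in> pid F p" by (rule pid_memI)
      with L FL p(3) g'(2) q'(1) show ?case
      proof (rule hprime_elem_divides)
        fix x' assume "homog L x'" "F dvd g - p * x'"
        then show ?thesis using coprime[OF mult.hyps(2)] by blast
      next
        fix y' assume y': "homog L y'" "F dvd q' - p * y'"
        have "F dvd (p * f - g * q') + g * (q' - p * y')" using q' y' by simp
        also have "(p * f - g * q') + g * (q' - p * y') = p * f - p * (g * y')" by (simp add: algebra_simps)
        finally have "F dvd f - g * y'" using dvd_mult_cancel_mod[OF F(2) p(2)] by blast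
        then show ?thesis by (rule pid_memI)
      qed
    qed
    have hP: "f \<in> pid F g" if "f \<in> P" "homog L f" for f
      using pseudo[OF that] strip fine that(2) by blast
    have "P \<subseteq> pid F g"
    proof
      fix p assume p: "p \<in> P"
      obtain S where S: "p = (\<Sum>\<kappa>\<in>S. hcomp L \<kappa> p)" using hcomp_decomposition[OF L] by metis
      have "(\<Sum>\<kappa>\<in>S. hcomp L \<kappa> p) \<in> pid F g"
        using P'(3) p hP by (intro cideal_sum[OF cideal_pid]) (auto simp: hcomp_closed_def)
      then show "p \<in> pid F g" using S by simp
    qed
    moreover have "pid F g \<subseteq> P" using pid_least P' g'(1) by blast
    ultimately have "P = pid F g" by blast
    then show ?thesis using P(1) g' by (auto simp: hprime_elem_def gprime_def)
  qed
qed

text \<open>The degree group is \<open>\<int>\<^sup>v\<close> modulo the common kernel of \<open>C\<close>, which embeds into \<open>\<int>\<^sup>C\<close> and hence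
  is torsion-free. Without functionals, every element is homogeneous.\<close>

definition kers :: "(int^'v) set \<Rightarrow> (int^'v::finite) set" where
  "kers C = {x. \<forall>c\<in>C. pairing c x = 0}"

lemma kers_empty: "kers {} = UNIV"
  by (simp add: kers_def)

lemma kers_insert: "kers (insert c C) = kers C \<inter> ker c"
  by (auto simp: kers_def ker_def)

lemma add_subgroup_kers: "add_subgroup (kers C)"
  by (auto simp: add_subgroup_def kers_def pairing_diff)

lemma factorization_coarsens:
  fixes F :: "('v::finite, 'k::field) mpoly"
  assumes F: "prime_mod F"
  shows "finite C \<Longrightarrow> homog (kers C) F \<Longrightarrow>
    (\<And>x. homog (kers C) x \<Longrightarrow> \<not> F dvd x \<Longrightarrow> hfac (kers C) F x) \<Longrightarrow> \<not> F dvd x \<Longrightarrow> hfac UNIV F x"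
proof (induction arbitrary: x rule: finite_induct)
  case empty
  then show ?case by (simp add: kers_empty)
next
  case (insert c C)
  note L = add_subgroup_kers[of C]
  have FC: "homog (kers C) F" using insert.prems(1) homog_coarsen unfolding kers_insert by blast
  have "hfac (kers C) F y" if "homog (kers C) y" "\<not> F dvd y" for y
    using coarsening_step[OF L insert.prems(1)[unfolded kers_insert] F insert.prems(2)[unfolded kers_insert]]
    by (intro kaplansky[OF L FC F _ that]) blast
  then show ?case using insert.IH[OF FC] insert.prems(3) by blast
qed

lemma hprime_kers:
  assumes J: "cideal J"
  shows "finite C \<Longrightarrow> hprime (kers C) J \<Longrightarrow> (\<And>c. c \<in> C \<Longrightarrow> cpart_closed c J) \<Longrightarrow> hprime UNIV J"
proof (induction rule: finite_induct)
  case empty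
  then show ?case by (simp add: kers_empty)
next
  case (insert c C)
  then show ?case using hprime_coarsen[OF add_subgroup_kers J, of C c] by (simp add: kers_insert)
qed

text \<open>Kaplansky's criterion applies to the given grading, since below a nonzero homogeneous prime
  ideal there is a minimal one. It exists because homogeneous primes are prime in a grading by a
  torsion-free group, and chains of primes are bounded. The factorization then survives the
  removal of each functional.\<close>

theorem torsionfree_factorization:
  fixes F :: "('v::finite, 'k::{alg_closed_field, field_char_0}) mpoly"
  assumes C: "finite C" and F: "homog (kers C) F" "gfactorial (kers C) F" and x: "\<not> F dvd x"
  shows "hfac UNIV F x"
proof -
  let ?L = "kers C"
  note L = add_subgroup_kers[of C]
  have F': "prime_mod F" "const_units F"
    "\<And>J. minprime ?L F J \<Longrightarrow> \<exists>i. J = pid F i"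
    using F(2) by (auto simp: gfactorial_def)
  \<comment> \<open>The bound on chains concerns ordinary prime ideals, so homogeneous ones have to be prime.\<close>
  have cp: "cprime J" if J: "gprime ?L F J" for J
  proof -
    have "cpart_closed c J" if "c \<in> C" for c
      using J that by (intro cpart_closed_of_hcomp_closed[OF L]) (auto simp: gprime_def kers_def ker_def)
    then show ?thesis using J hprime_kers[OF _ C] by (auto simp: cprime_def gprime_def)
  qed
  have "\<exists>p\<in>P. hprime_elem ?L F p" if P: "gprime ?L F P" "\<exists>p\<in>P. \<not> F dvd p" for P
  proof -
    let ?Y = "{J. gprime ?L F J \<and> J \<subseteq> P \<and> (\<exists>p\<in>J. \<not> F dvd p)}"
    obtain M where M: "M \<in> ?Y" "\<And>J. J \<in> ?Y \<Longrightarrow> \<not> J \<subset> M"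
      using cprime_minimal[of ?Y P] cp P by blast
    have "minprime ?L F M" unfolding minprime_def using M by blast
    then obtain i where i: "M = pid F i" using F'(3) by blast
    have "hcomp_closed ?L (pid F i)" using M(1) i by (auto simp: gprime_def)
    then obtain i' where i': "homog ?L i'" "pid F i = pid F i'"
      using homogeneous_generator[OF L F(1) F'(1,2)] by blast
    have "\<not> F dvd i'"
    proof
      assume "F dvd i'"
      then have "pid F i' \<subseteq> {p. F dvd p}" by (intro pid_least cideal_multiples) auto
      then show False using M(1) i i'(2) by auto
    qed
    then have "hprime_elem ?L F i'" using M(1) i i' by (auto simp: hprime_elem_def gprime_def)
    moreover have "i' \<in> P" using M(1) i i' pid_gen(1)[of i' F] by auto
    ultimately show ?thesis by blast
  qed
  then have "hfac ?L F y" if "homog ?L y" "\<not> F dvd y" for y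
    using kaplansky[OF L F(1) F'(1) _ that] by blast
  then show ?thesis using factorization_coarsens[OF F'(1) C F(1)] x by blast
qed

section \<open>Homogenization with respect to an additional variable\<close>

text \<open>The exponent of \<open>Tinf\<^sup>l T\<^sup>\<mu>\<close>.\<close>

definition emb :: "nat \<Rightarrow> ('r \<Rightarrow>\<^sub>0 nat) \<Rightarrow> ('r option \<Rightarrow>\<^sub>0 nat)" where
  "emb l \<mu> = single None l + push Some \<mu>"

definition drop_inf :: "('r option \<Rightarrow>\<^sub>0 nat) \<Rightarrow> ('r \<Rightarrow>\<^sub>0 nat)" where
  "drop_inf \<nu> = Poly_Mapping.map_key Some \<nu>"

lemma lookup_push_Some [simp]: "lookup (push Some \<mu>) (Some i) = lookup \<mu> i"
  "lookup (push Some \<mu>) None = 0"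
proof -
  have "lookup (push Some \<mu>) (Some i) = sum (lookup \<mu>) {j \<in> keys \<mu>. j = i}"
    by (simp add: lookup_push)
  also have "{j \<in> keys \<mu>. j = i} = (if i \<in> keys \<mu> then {i} else {})" by auto
  finally show "lookup (push Some \<mu>) (Some i) = lookup \<mu> i" by (auto simp: in_keys_iff)
  show "lookup (push Some \<mu>) None = 0" by (simp add: lookup_push)
qed

lemma lookup_emb [simp]: "lookup (emb l \<mu>) None = l" "lookup (emb l \<mu>) (Some i) = lookup \<mu> i"
  by (simp_all add: emb_def lookup_add lookup_single)

lemma lookup_drop_inf [simp]: "lookup (drop_inf \<nu>) i = lookup \<nu> (Some i)"
  by (simp add: drop_inf_def Poly_Mapping.map_key.rep_eq)

lemma option_exponent_eqI:
  "lookup \<mu> None = lookup \<nu> None \<Longrightarrow> drop_inf \<mu> = drop_inf \<nu> \<Longrightarrow> \<mu> = \<nu>"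
  by (rule poly_mapping_eqI) (metis lookup_drop_inf not_Some_eq)

lemma drop_inf_emb [simp]: "drop_inf (emb l \<mu>) = \<mu>"
  by (rule poly_mapping_eqI) simp

lemma drop_inf_add: "drop_inf (\<mu> + \<nu>) = drop_inf \<mu> + drop_inf \<nu>"
  by (rule poly_mapping_eqI) (simp add: lookup_add)

lemma drop_inf_0 [simp]: "drop_inf 0 = 0"
  by (rule poly_mapping_eqI) simp

lemma drop_inf_single_None [simp]: "drop_inf (single None l) = 0"
  by (rule poly_mapping_eqI) (simp add: lookup_single)

definition proj :: "int^'r option \<Rightarrow> int^'r::finite" where
  "proj x = (\<chi> i. x $ Some i)"

lemma proj_nth [simp]: "proj x $ i = x $ Some i"
  by (simp add: proj_def)

lemma proj_diff: "proj (x - y) = proj x - proj y"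
  by (simp add: vec_eq_iff)

lemma proj_ivec: "proj (ivec \<nu>) = ivec (drop_inf \<nu>)"
  by (simp add: vec_eq_iff)

lemma option_vec_eqI: "x $ None = y $ None \<Longrightarrow> proj x = proj y \<Longrightarrow> x = y"
  by (simp add: vec_eq_iff) (metis not_None_eq)

text \<open>The substitution \<open>Tinf = 1\<close>.\<close>

definition dehom :: "('r option, 'k::comm_ring_1) mpoly \<Rightarrow> ('r, 'k) mpoly" where
  "dehom p = push drop_inf p"

abbreviation Tinf :: "('r option, 'k::comm_ring_1) mpoly" where
  "Tinf \<equiv> Var None"

lemma dehom_mult: "dehom (p * q) = dehom p * dehom q"
  and dehom_add: "dehom (p + q) = dehom p + dehom q"
  and dehom_diff: "dehom (p - q) = dehom p - dehom q"
  and dehom_sum: "dehom (\<Sum>i\<in>I. f i) = (\<Sum>i\<in>I. dehom (f i))"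
  and dehom_0 [simp]: "dehom 0 = 0"
  and dehom_1 [simp]: "dehom 1 = 1"
  and dehom_Const [simp]: "dehom (Const c) = Const c"
  and dehom_Tinf [simp]: "dehom Tinf = 1"
  by (simp_all add: dehom_def push_mult push_add push_diff push_sum push_1 drop_inf_add Const_def Var_def)

lemma dehom_power [simp]: "dehom (p ^ n) = dehom p ^ n"
  by (induction n) (simp_all add: dehom_mult)

lemma dehom_dvd: "F dvd p \<Longrightarrow> dehom F dvd dehom p"
  by (auto simp: dvd_def dehom_mult)

lemma Tinf_power: "Tinf ^ n = single (single None n) 1"
  by (induction n) (simp_all add: Var_def mult_single single_add[symmetric])

lemma Tinf_power_mult: "Tinf ^ n * p = push ((+) (single None n)) p"
  by (simp add: Tinf_power monomial_mult_eq_push)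

lemma dehom_surj: "\<exists>p. dehom p = b"
  by (rule exI[of _ "push (emb 0) b"]) (simp add: dehom_def push_push push_id o_def)

lemma Tinf_dvd_iff: "Tinf dvd p \<longleftrightarrow> part (\<lambda>\<nu>. lookup \<nu> None = 0) p = 0"
proof
  assume "Tinf dvd p"
  then obtain q where q: "p = Tinf ^ 1 * q" by (auto simp: dvd_def)
  show "part (\<lambda>\<nu>. lookup \<nu> None = 0) p = 0"
    unfolding q Tinf_power_mult
  proof (rule part_none)
    fix \<nu> assume "\<nu> \<in> keys (push ((+) (single None 1)) q)"
    then obtain \<nu>' where "\<nu> = single None 1 + \<nu>'" by (rule keys_pushE)
    then show "lookup \<nu> None \<noteq> 0" by (simp add: lookup_add)
  qed
next
  assume *: "part (\<lambda>\<nu>. lookup \<nu> None = 0) p = 0"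
  have "single None 1 + (\<nu> - single None 1) = \<nu>" if "\<nu> \<in> keys p" for \<nu>
  proof -
    have "\<nu> \<notin> keys (part (\<lambda>\<nu>. lookup \<nu> None = 0) p)" unfolding * by simp
    then have "lookup \<nu> None \<noteq> 0" using that by (simp add: keys_part)
    then show ?thesis
      by (intro poly_mapping_eqI) (auto simp: lookup_add lookup_minus lookup_single when_def)
  qed
  then have "push ((+) (single None 1)) (push (\<lambda>\<nu>. \<nu> - single None 1) p) = p"
    unfolding push_push by (intro push_id) simp
  then have "p = Tinf ^ 1 * push (\<lambda>\<nu>. \<nu> - single None 1) p" unfolding Tinf_power_mult by simp
  then show "Tinf dvd p" by (metis dvd_triv_left power_one_right)
qed

text \<open>The part free of \<open>Tinf\<close> is the value at \<open>Tinf = 0\<close>.\<close>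

lemma Tinf_free_part_mult:
  fixes p q :: "('r option, 'k::comm_ring_1) mpoly"
  shows "part (\<lambda>\<nu>. lookup \<nu> None = 0) (p * q) =
    part (\<lambda>\<nu>. lookup \<nu> None = 0) p * part (\<lambda>\<nu>. lookup \<nu> None = 0) q"
    (is "?P (p * q) = _")
proof -
  have "?P (p * q) = ?P (?P p * q) + ?P (part (\<lambda>\<nu>. lookup \<nu> None \<noteq> 0) p * q)"
    by (subst (1) part_split[of p "\<lambda>\<nu>. lookup \<nu> None = 0"]) (simp only: distrib_right part_add)
  also have "?P (part (\<lambda>\<nu>. lookup \<nu> None \<noteq> 0) p * q) = 0"
    by (rule part_none) (auto elim!: keys_multE simp: keys_part lookup_add)
  also have "?P (?P p * q) = ?P p * ?P q"
    by (rule part_mult) (auto simp: keys_part lookup_add)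
  finally show ?thesis by simp
qed

lemma Tinf_prime:
  fixes p q :: "('r::finite option, 'k::idom) mpoly"
  assumes "Tinf dvd p * q"
  shows "Tinf dvd p \<or> Tinf dvd q"
  using assms mpoly_no_zero_divisors by (auto simp: Tinf_dvd_iff Tinf_free_part_mult)

lemma Tinf_nonzero: "Tinf \<noteq> (0 :: ('r option, 'k::comm_ring_1) mpoly)"
  by (metis dehom_0 dehom_Tinf zero_neq_one)

lemma homd_Tinf_power_mult:
  assumes "homd L \<kappa> p"
  shows "homd L (\<kappa> + axis None (int n)) (Tinf ^ n * p)"
  unfolding homd_def
proof
  fix \<nu> assume "\<nu> \<in> keys (Tinf ^ n * p)"
  then obtain \<nu>' where "\<nu>' \<in> keys p" "\<nu> = single None n + \<nu>'"
    unfolding Tinf_power_mult by (rule keys_pushE)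
  moreover have "ivec (single None n) = axis None (int n)"
    by (simp add: vec_eq_iff axis_def lookup_single when_def)
  ultimately have "ivec \<nu> - (\<kappa> + axis None (int n)) = ivec \<nu>' - \<kappa>" and "ivec \<nu>' - \<kappa> \<in> L"
    using assms by (simp_all add: ivec_add homd_def)
  then show "ivec \<nu> - (\<kappa> + axis None (int n)) \<in> L" by metis
qed

text \<open>Bijectivity of the projection \<open>LA \<rightarrow> LB\<close> expresses that the degree of \<open>Tinf\<close> has infinite order
  and that dividing by it turns the grading by \<open>LA\<close> into the one by \<open>LB\<close>.\<close>

locale homogenization =
  fixes LA :: "(int^'r::finite option) set" and LB :: "(int^'r) set"
  assumes LA: "add_subgroup LA" and LB_eq: "LB = proj ` LA"
    and ker_trivial: "\<And>x. x \<in> LA \<Longrightarrow> proj x = 0 \<Longrightarrow> x = 0"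
begin

lemma LB: "add_subgroup LB"
  unfolding add_subgroup_def LB_eq
proof (intro conjI ballI)
  have "proj 0 \<in> proj ` LA" using add_subgroup_0[OF LA] by blast
  moreover have "proj 0 = (0 :: int^'r)" by (simp add: vec_eq_iff)
  ultimately show "0 \<in> proj ` LA" by metis
  fix x y assume "x \<in> proj ` LA" "y \<in> proj ` LA"
  then obtain x' y' where "x' \<in> LA" "y' \<in> LA" "x = proj x'" "y = proj y'" by blast
  then show "x - y \<in> proj ` LA" using add_subgroup_diff[OF LA] by (metis imageI proj_diff)
qed

lemma homog_Tinf: "homog LA Tinf"
  using homd_Tinf_power_mult[OF homd_1[OF LA], of 1] by (auto simp: homog_def)

lemma homd_dehom: "homd LA \<kappa> p \<Longrightarrow> homd LB (proj \<kappa>) (dehom p)"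
  unfolding homd_def LB_eq dehom_def
proof
  fix \<mu> assume *: "\<forall>\<mu>\<in>keys p. ivec \<mu> - \<kappa> \<in> LA" "\<mu> \<in> keys (push drop_inf p)"
  from *(2) obtain \<nu> where "\<nu> \<in> keys p" "\<mu> = drop_inf \<nu>" by (rule keys_pushE)
  then show "ivec \<mu> - proj \<kappa> \<in> proj ` LA" using * by (metis imageI proj_diff proj_ivec)
qed

lemma homog_dehom: "homog LA p \<Longrightarrow> homog LB (dehom p)"
  using homd_dehom unfolding homog_def by blast

text \<open>Two exponents of a homogeneous polynomial that differ in the power of \<open>Tinf\<close> only differ by an
  element of \<open>LA\<close> with trivial projection.\<close>

lemma inj_on_drop_inf:
  assumes "homog LA p"
  shows "inj_on drop_inf (keys p)"
proof (rule inj_onI)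
  fix \<mu> \<nu> assume *: "\<mu> \<in> keys p" "\<nu> \<in> keys p" "drop_inf \<mu> = drop_inf \<nu>"
  obtain \<kappa> where "homd LA \<kappa> p" using assms by (auto simp: homog_def)
  then have "(ivec \<mu> - \<kappa>) - (ivec \<nu> - \<kappa>) \<in> LA"
    using * unfolding homd_def by (metis add_subgroup_diff[OF LA])
  then have "ivec \<mu> - ivec \<nu> \<in> LA" by simp
  then have "ivec \<mu> - ivec \<nu> = 0" by (rule ker_trivial) (simp add: proj_diff proj_ivec *(3))
  then have "int (lookup \<mu> i) = int (lookup \<nu> i)" for i by (metis eq_iff_diff_eq_0 ivec_nth)
  then show "\<mu> = \<nu>" by (intro poly_mapping_eqI) simp
qed

lemma keys_dehom: "homog LA p \<Longrightarrow> keys (dehom p) = drop_inf ` keys p"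
  unfolding dehom_def by (intro keys_push_inj inj_on_drop_inf)

lemma dehom_eq_0: "homog LA p \<Longrightarrow> dehom p = 0 \<Longrightarrow> p = 0"
  using keys_dehom[of p] by (metis image_is_empty keys_eq_empty)

text \<open>Differences of exponents lift uniquely from \<open>LB\<close> to \<open>LA\<close>, and the lifts prescribe the powers
  of \<open>Tinf\<close> up to a common shift, which is chosen such that no negative power occurs.\<close>

lemma homogenize:
  assumes "homog LB b"
  obtains p where "homog LA p" "dehom p = b"
proof (cases "b = 0")
  case True
  then show ?thesis using that[of 0] by simp
next
  case False
  then obtain \<mu>\<^sub>0 where \<mu>0: "\<mu>\<^sub>0 \<in> keys b" using nonzero_key by blast
  obtain \<kappa> where \<kappa>: "homd LB \<kappa> b" using assms by (auto simp: homog_def)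
  have "\<exists>x\<in>LA. proj x = ivec \<mu> - ivec \<mu>\<^sub>0" if "\<mu> \<in> keys b" for \<mu>
  proof -
    have "(ivec \<mu> - \<kappa>) - (ivec \<mu>\<^sub>0 - \<kappa>) \<in> LB"
      using \<kappa> that \<mu>0 unfolding homd_def by (metis add_subgroup_diff[OF LB])
    then have "ivec \<mu> - ivec \<mu>\<^sub>0 \<in> LB" by simp
    then show ?thesis unfolding LB_eq by (metis imageE)
  qed
  then obtain x where x: "\<And>\<mu>. \<mu> \<in> keys b \<Longrightarrow> x \<mu> \<in> LA" "\<And>\<mu>. \<mu> \<in> keys b \<Longrightarrow> proj (x \<mu>) = ivec \<mu> - ivec \<mu>\<^sub>0"
    by metis
  define m where "m = Min ((\<lambda>\<mu>. x \<mu> $ None) ` keys b)"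
  have m: "m \<le> x \<mu> $ None" if "\<mu> \<in> keys b" for \<mu>
    unfolding m_def using that by (intro Min_le) auto
  \<comment> \<open>The exponent \<open>\<mu>\<close> receives the power of \<open>Tinf\<close> that the lift \<open>x \<mu>\<close> demands, relative to the
    smallest one.\<close>
  define s where "s \<mu> = emb (nat (x \<mu> $ None - m)) \<mu>" for \<mu>
  define p where "p = push s b"
  define \<kappa>\<^sub>0 :: "int^'r option" where "\<kappa>\<^sub>0 = (\<chi> i. case i of None \<Rightarrow> - m | Some j \<Rightarrow> int (lookup \<mu>\<^sub>0 j))"
  have "homd LA \<kappa>\<^sub>0 p"
    unfolding homd_def
  proof
    fix \<nu> assume "\<nu> \<in> keys p"
    then obtain \<mu> where \<mu>: "\<mu> \<in> keys b" "\<nu> = s \<mu>" unfolding p_def by (rule keys_pushE)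
    have "ivec \<nu> - \<kappa>\<^sub>0 = x \<mu>"
    proof (rule option_vec_eqI)
      show "(ivec \<nu> - \<kappa>\<^sub>0) $ None = x \<mu> $ None" using m[OF \<mu>(1)] by (simp add: \<mu>(2) s_def \<kappa>\<^sub>0_def)
      have "proj \<kappa>\<^sub>0 = ivec \<mu>\<^sub>0" by (simp add: vec_eq_iff \<kappa>\<^sub>0_def)
      then show "proj (ivec \<nu> - \<kappa>\<^sub>0) = proj (x \<mu>)"
        unfolding proj_diff proj_ivec x(2)[OF \<mu>(1)] by (simp add: \<mu>(2) s_def)
    qed
    then show "ivec \<nu> - \<kappa>\<^sub>0 \<in> LA" using x(1)[OF \<mu>(1)] by simp
  qed
  moreover have "dehom p = b"
    unfolding dehom_def p_def push_push by (rule push_id) (simp add: s_def)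
  ultimately show ?thesis using that homogI by blast
qed

text \<open>Both polynomials have the same exponents after projection. By injectivity of the projection on
  \<open>LA\<close> the powers of \<open>Tinf\<close> on corresponding monomials differ by a constant, which is read off
  from one monomial.\<close>

lemma homogenization_unique:
  fixes p q :: "('r option, 'k::comm_ring_1) mpoly"
  assumes p: "homog LA p" and q: "homog LA q" and eq: "dehom p = dehom q"
  obtains i j where "Tinf ^ i * p = Tinf ^ j * q"
proof (cases "p = 0")
  case True
  then have "q = 0" using dehom_eq_0[OF q] eq by simp
  then show ?thesis using that[of 0 0] True by simp
next
  case False
  then obtain \<nu>p where \<nu>p: "\<nu>p \<in> keys p" using nonzero_key by blast
  have keys: "drop_inf ` keys p = drop_inf ` keys q" using eq keys_dehom[OF p] keys_dehom[OF q] by simp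
  have "drop_inf \<nu>p \<in> drop_inf ` keys q" using \<nu>p unfolding keys[symmetric] by (rule imageI)
  then obtain \<nu>q where \<nu>q: "drop_inf \<nu>q = drop_inf \<nu>p" "\<nu>q \<in> keys q" by (elim imageE) simp
  define i j where "i = lookup \<nu>q None" and "j = lookup \<nu>p None"
  have L: "ivec \<nu> - ivec \<nu>' \<in> LA" if r: "homog LA r" "\<nu> \<in> keys r" "\<nu>' \<in> keys r" for r :: "('r option, 'k) mpoly" and \<nu> \<nu>'
  proof -
    obtain \<kappa> where "homd LA \<kappa> r" using r(1) by (auto simp: homog_def)
    then have "(ivec \<nu> - \<kappa>) - (ivec \<nu>' - \<kappa>) \<in> LA"
      using r unfolding homd_def by (metis add_subgroup_diff[OF LA])
    then show ?thesis by simp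
  qed
  have shift: "single None i + \<nu> = single None j + \<nu>'"
    if "\<nu> \<in> keys p" "\<nu>' \<in> keys q" "drop_inf \<nu> = drop_inf \<nu>'" for \<nu> \<nu>'
  proof (rule option_exponent_eqI)
    have "(ivec \<nu> - ivec \<nu>p) - (ivec \<nu>' - ivec \<nu>q) \<in> LA"
      by (rule add_subgroup_diff[OF LA L[OF p that(1) \<nu>p] L[OF q that(2) \<nu>q(2)]])
    then have "(ivec \<nu> - ivec \<nu>p) - (ivec \<nu>' - ivec \<nu>q) = 0"
      by (rule ker_trivial) (simp add: proj_diff proj_ivec that(3) \<nu>q(1))
    then have "((ivec \<nu> - ivec \<nu>p) - (ivec \<nu>' - ivec \<nu>q)) $ None = 0" by simp
    then show "lookup (single None i + \<nu>) None = lookup (single None j + \<nu>') None"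
      by (simp add: lookup_add i_def j_def)
  qed (simp add: drop_inf_add that(3))
  \<comment> \<open>Both products are images of the common dehomogenization under \<open>s\<close>.\<close>
  define s where "s \<mu> = single None i + (SOME \<nu>. \<nu> \<in> keys p \<and> drop_inf \<nu> = \<mu>)" for \<mu>
  have s: "(SOME \<nu>. \<nu> \<in> keys p \<and> drop_inf \<nu> = \<mu>) \<in> keys p \<and> drop_inf (SOME \<nu>. \<nu> \<in> keys p \<and> drop_inf \<nu> = \<mu>) = \<mu>"
    if \<mu>: "\<mu> \<in> drop_inf ` keys p" for \<mu>
  proof -
    from \<mu> obtain \<nu> where "\<mu> = drop_inf \<nu>" "\<nu> \<in> keys p" by (rule imageE)
    then have "\<nu> \<in> keys p \<and> drop_inf \<nu> = \<mu>" by simp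
    then show ?thesis by (rule someI)
  qed
  have sp: "s (drop_inf \<nu>) = single None i + \<nu>" if "\<nu> \<in> keys p" for \<nu>
  proof -
    note s[OF imageI[OF that]]
    then have "(SOME \<nu>'. \<nu>' \<in> keys p \<and> drop_inf \<nu>' = drop_inf \<nu>) = \<nu>"
      using inj_onD[OF inj_on_drop_inf[OF p]] that by metis
    then show ?thesis by (simp add: s_def)
  qed
  have sq: "s (drop_inf \<nu>') = single None j + \<nu>'" if "\<nu>' \<in> keys q" for \<nu>'
  proof -
    have "drop_inf \<nu>' \<in> drop_inf ` keys p" using that unfolding keys by (rule imageI)
    then obtain \<nu> where \<nu>: "drop_inf \<nu>' = drop_inf \<nu>" "\<nu> \<in> keys p" by (rule imageE)
    then show ?thesis using sp[OF \<nu>(2)] shift[OF \<nu>(2) that] by simp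
  qed
  have "Tinf ^ i * p = push s (dehom p)"
    unfolding Tinf_power_mult dehom_def push_push by (rule push_cong) (simp add: sp)
  also have "\<dots> = push s (dehom q)" by (simp add: eq)
  also have "\<dots> = Tinf ^ j * q"
    unfolding Tinf_power_mult dehom_def push_push by (rule push_cong) (simp add: sq)
  finally show ?thesis using that by blast
qed

text \<open>The degrees of \<open>p\<close> and \<open>q\<close> agree modulo the degree of \<open>Tinf\<close>, so multiplication by powers of
  \<open>Tinf\<close> makes them equal. Sums of such elements are then homogeneous.\<close>

lemma common_degree:
  assumes p: "homog LA p" and q: "homog LA q"
    and deg: "homd LB \<rho> (dehom p)" "homd LB \<rho> (dehom q)"
  obtains i j \<kappa> where "homd LA \<kappa> (Tinf ^ i * p)" "homd LA \<kappa> (Tinf ^ j * q)"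
proof -
  obtain \<kappa> \<kappa>' where \<kappa>: "homd LA \<kappa> p" and \<kappa>': "homd LA \<kappa>' q" using p q by (auto simp: homog_def)
  show ?thesis
  proof (cases "dehom p = 0 \<or> dehom q = 0")
    case True
    then have "p = 0 \<or> q = 0" using dehom_eq_0[OF p] dehom_eq_0[OF q] by metis
    then show ?thesis
    proof
      assume "p = 0"
      then show ?thesis using that[of \<kappa>' 0 0] \<kappa>' by simp
    next
      assume "q = 0"
      then show ?thesis using that[of \<kappa> 0 0] \<kappa> by simp
    qed
  next
    case False
    then have "proj \<kappa> - \<rho> \<in> LB" "proj \<kappa>' - \<rho> \<in> LB"
      using homd_unique[OF LB homd_dehom[OF \<kappa>] deg(1)] homd_unique[OF LB homd_dehom[OF \<kappa>'] deg(2)] by auto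
    from add_subgroup_diff[OF LB this] have "proj \<kappa> - proj \<kappa>' \<in> LB" by simp
    then obtain x where x: "x \<in> LA" "proj x = proj \<kappa> - proj \<kappa>'" unfolding LB_eq by (metis imageE)
    define m where "m = (\<kappa> - \<kappa>' - x) $ None"
    have eq: "(\<kappa> + axis None (int (nat (- m)))) - (\<kappa>' + axis None (int (nat m))) = x"
    proof (rule option_vec_eqI)
      show "proj ((\<kappa> + axis None (int (nat (- m)))) - (\<kappa>' + axis None (int (nat m)))) = proj x"
        unfolding x(2) by (simp add: vec_eq_iff axis_def)
    qed (auto simp: m_def axis_def)
    have "homd LA (\<kappa>' + axis None (int (nat m))) (Tinf ^ nat (- m) * p)"
      by (rule homd_cong[OF LA homd_Tinf_power_mult[OF \<kappa>]]) (unfold eq, rule x(1))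
    then show ?thesis using that homd_Tinf_power_mult[OF \<kappa>'] by blast
  qed
qed

end

text \<open>Together, homogeneity of \<open>F\<close> and \<open>\<not> Tinf dvd F\<close> make \<open>F\<close> the homogenization of \<open>f\<close> without
  superfluous factors \<open>Tinf\<close>; they also make \<open>Tinf\<close> a nonzerodivisor modulo \<open>F\<close>.\<close>

locale homogenized_hypersurface = homogenization LA LB
  for LA :: "(int^'r::finite option) set" and LB :: "(int^'r) set" +
  fixes F :: "('r option, 'k::field) mpoly" and f :: "('r, 'k) mpoly"
  assumes F: "homog LA F" and dehom_F: "dehom F = f" and Tinf_ndvd: "\<not> Tinf dvd F"
begin

lemma f: "homog LB f"
  using homog_dehom[OF F] dehom_F by simp

lemma cancel_Tinf: "F dvd Tinf * p \<Longrightarrow> F dvd p"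
proof -
  assume "F dvd Tinf * p"
  then obtain h where h: "Tinf * p = F * h" by (auto simp: dvd_def)
  then have "Tinf dvd F * h" by (metis dvd_triv_left)
  then obtain h' where "h = Tinf * h'" using Tinf_prime Tinf_ndvd by (auto simp: dvd_def)
  then have "Tinf * p = Tinf * (F * h')" using h by (simp add: algebra_simps)
  then have "p = F * h'" using mpoly_mult_cancel Tinf_nonzero by blast
  then show "F dvd p" by simp
qed

lemma cancel_Tinf_power: "F dvd Tinf ^ n * p \<Longrightarrow> F dvd p"
  by (induction n) (auto simp: mult.assoc dest: cancel_Tinf)

lemma dvd_dehom: "F dvd p \<Longrightarrow> f dvd dehom p"
  using dehom_dvd dehom_F by blast

text \<open>Lift the cofactor; the product with \<open>F\<close> differs from \<open>p\<close> by powers of \<open>Tinf\<close>, which can be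
  cancelled modulo \<open>F\<close>.\<close>

lemma dvd_of_dehom:
  assumes p: "homog LA p" and dvd: "f dvd dehom p"
  shows "F dvd p"
proof -
  obtain b where "dehom p = f * b" using dvd by (auto simp: dvd_def)
  then have "dehom p - f * b \<in> {0}" by simp
  moreover have "hcomp_closed LB {0}" by (auto simp: hcomp_closed_def)
  ultimately obtain b' where b': "homog LB b'" "dehom p - f * b' \<in> {0}"
    using homogeneous_cofactor[OF LB _ homog_dehom[OF p] f] by blast
  obtain h where h: "homog LA h" "dehom h = b'" using homogenize[OF b'(1)] .
  have "dehom p = dehom (F * h)" using b'(2) h(2) by (simp add: dehom_mult dehom_F)
  then obtain i j where "Tinf ^ i * p = Tinf ^ j * (F * h)"
    using homogenization_unique[OF p homog_mult[OF LA F h(1)]] by metis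
  then have "F dvd Tinf ^ i * p" by simp
  then show ?thesis by (rule cancel_Tinf_power)
qed

lemma hprime_transfer:
  assumes "hprime LB {b. f dvd b}"
  shows "hprime LA {p. F dvd p}"
  unfolding hprime_def
proof (intro conjI allI impI)
  show "1 \<notin> {p. F dvd p}" using assms dvd_dehom[of 1] by (auto simp: hprime_def)
  fix p q assume pq: "homog LA p" "homog LA q" "p * q \<in> {p. F dvd p}"
  then have "f dvd dehom p * dehom q" using dvd_dehom[of "p * q"] by (simp add: dehom_mult)
  then have "f dvd dehom p \<or> f dvd dehom q"
    using assms homog_dehom pq(1,2) by (auto simp: hprime_def)
  then show "p \<in> {p. F dvd p} \<or> q \<in> {p. F dvd p}" using dvd_of_dehom pq by auto
qed

end

section \<open>Homogeneous prime ideals under dehomogenization\<close>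

context homogenized_hypersurface
begin

text \<open>Homogeneous prime ideals that avoid \<open>Tinf\<close> are saturated with respect to it, so they are
  determined by their dehomogenizations.\<close>

lemma Tinf_power_gprime:
  assumes J: "gprime LA F J" and X: "Tinf \<notin> J" and p: "homog LA p" "Tinf ^ n * p \<in> J"
  shows "p \<in> J"
  using p(2)
proof (induction n)
  case (Suc n)
  have "Tinf * (Tinf ^ n * p) \<in> J" using Suc.prems by (simp add: mult.assoc)
  moreover have "homog LA (Tinf ^ n * p)" by (rule homog_mult[OF LA homog_power[OF LA homog_Tinf] p(1)])
  ultimately have "Tinf \<in> J \<or> Tinf ^ n * p \<in> J"
    using J homog_Tinf unfolding gprime_def hprime_def by blast
  then show ?case using X Suc.IH by blast
qed simp

text \<open>The homogeneous components of a preimage have degrees that differ by multiples of the degree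
  of \<open>Tinf\<close> as far as they contribute to \<open>b\<close>. Powers of \<open>Tinf\<close> bring them into the same degree.\<close>

lemma homogeneous_preimage:
  assumes J: "cideal J" "hcomp_closed LA J" and b: "b \<in> dehom ` J" "homog LB b"
  obtains p where "p \<in> J" "homog LA p" "dehom p = b"
proof -
  obtain p0 where p0: "p0 \<in> J" "b = dehom p0" using b(1) by blast
  obtain \<rho> where \<rho>: "homd LB \<rho> b" using b(2) by (auto simp: homog_def)
  obtain S where S: "finite S" "p0 = (\<Sum>\<kappa>\<in>S. hcomp LA \<kappa> p0)"
    using hcomp_decomposition[OF LA] by metis
  have *: "\<exists>p\<in>J. homog LA p \<and> dehom p = (\<Sum>\<kappa>\<in>S'. hcomp LB \<rho> (dehom (hcomp LA \<kappa> p0)))" if "finite S'" for S'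
    using that
  proof induction
    case empty
    show ?case by (rule bexI[of _ 0]) (simp_all add: cideal_0[OF J(1)])
  next
    case (insert \<kappa> S')
    let ?c = "hcomp LA \<kappa> p0"
    obtain p where p: "p \<in> J" "homog LA p" "dehom p = (\<Sum>\<kappa>\<in>S'. hcomp LB \<rho> (dehom (hcomp LA \<kappa> p0)))"
      using insert.IH by blast
    have hc: "homd LB (proj \<kappa>) (dehom ?c)" by (rule homd_dehom[OF homd_hcomp])
    show ?case
    proof (cases "proj \<kappa> - \<rho> \<in> LB")
      case False
      then have "hcomp LB \<rho> (dehom ?c) = 0" using hcomp_homd_other[OF LB hc] by simp
      then show ?thesis using p insert.hyps by (intro bexI[of _ p]) auto
    next
      case True
      then have hc': "homd LB \<rho> (dehom ?c)" using homd_cong[OF LB hc] by blast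
      have sum_homd: "homd LB \<rho> (\<Sum>\<kappa>\<in>G. hcomp LB \<rho> (dehom (hcomp LA \<kappa> p0)))" for G
        by (induction G rule: infinite_finite_induct) (simp_all add: homd_add)
      have "homd LB \<rho> (dehom p)" unfolding p(3) by (rule sum_homd)
      then obtain i j \<kappa>' where ij: "homd LA \<kappa>' (Tinf ^ i * p)" "homd LA \<kappa>' (Tinf ^ j * ?c)"
        by (rule common_degree[OF p(2) homog_hcomp _ hc'])
      have "?c \<in> J" using J(2) p0(1) by (auto simp: hcomp_closed_def)
      then have "Tinf ^ i * p + Tinf ^ j * ?c \<in> J"
        by (intro cideal_add[OF J(1)] cideal_mult[OF J(1)] p(1))
      moreover have "homog LA (Tinf ^ i * p + Tinf ^ j * ?c)" using homd_add[OF ij] homogI by blast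
      moreover have "dehom (Tinf ^ i * p + Tinf ^ j * ?c) = (\<Sum>\<kappa>\<in>insert \<kappa> S'. hcomp LB \<rho> (dehom (hcomp LA \<kappa> p0)))"
        using insert.hyps by (simp add: dehom_add dehom_mult p(3) hcomp_homd[OF hc'])
      ultimately show ?thesis by blast
    qed
  qed
  have "b = hcomp LB \<rho> (dehom p0)" using p0(2) hcomp_homd[OF \<rho>] by simp
  also have "\<dots> = hcomp LB \<rho> (\<Sum>\<kappa>\<in>S. dehom (hcomp LA \<kappa> p0))" using S(2) by (metis dehom_sum)
  also have "\<dots> = (\<Sum>\<kappa>\<in>S. hcomp LB \<rho> (dehom (hcomp LA \<kappa> p0)))" by (rule hcomp_sum)
  finally show ?thesis using *[OF S(1)] that by metis
qed

lemma cideal_dehom: "cideal J \<Longrightarrow> cideal (dehom ` J)"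
  unfolding cideal_def
proof (intro conjI ballI allI)
  assume J: "0 \<in> J \<and> (\<forall>a\<in>J. \<forall>b\<in>J. a + b \<in> J) \<and> (\<forall>a\<in>J. \<forall>r. r * a \<in> J)"
  show "0 \<in> dehom ` J" using J by (metis dehom_0 imageI)
  show "a + b \<in> dehom ` J" if "a \<in> dehom ` J" "b \<in> dehom ` J" for a b
    using that J by (auto simp: dehom_add[symmetric])
  show "r * a \<in> dehom ` J" if a: "a \<in> dehom ` J" for r a
  proof -
    obtain p where "p \<in> J" "a = dehom p" using a by blast
    moreover obtain s where "dehom s = r" using dehom_surj by blast
    ultimately show ?thesis using J by (auto simp: dehom_mult[symmetric])
  qed
qed

lemma hcomp_closed_dehom:
  assumes J: "cideal J" "hcomp_closed LA J"
  shows "hcomp_closed LB (dehom ` J)"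
  unfolding hcomp_closed_def
proof (intro ballI allI)
  fix b \<rho> assume "b \<in> dehom ` J"
  then obtain p where p: "p \<in> J" "b = dehom p" by blast
  obtain S where S: "finite S" "p = (\<Sum>\<kappa>\<in>S. hcomp LA \<kappa> p)"
    using hcomp_decomposition[OF LA] by metis
  have "hcomp LB \<rho> (dehom (hcomp LA \<kappa> p)) \<in> dehom ` J" for \<kappa>
  proof (cases "proj \<kappa> - \<rho> \<in> LB")
    case True
    then have "hcomp LB \<rho> (dehom (hcomp LA \<kappa> p)) = dehom (hcomp LA \<kappa> p)"
      by (intro hcomp_homd homd_cong[OF LB homd_dehom[OF homd_hcomp]])
    then show ?thesis using J(2) p(1) by (auto simp: hcomp_closed_def)
  next
    case False
    then have "hcomp LB \<rho> (dehom (hcomp LA \<kappa> p)) = 0"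
      by (intro hcomp_homd_other[OF LB homd_dehom[OF homd_hcomp]])
    then show ?thesis using cideal_0[OF cideal_dehom[OF J(1)]] by simp
  qed
  then have "(\<Sum>\<kappa>\<in>S. hcomp LB \<rho> (dehom (hcomp LA \<kappa> p))) \<in> dehom ` J"
    by (intro cideal_sum[OF cideal_dehom[OF J(1)]])
  moreover have "hcomp LB \<rho> b = (\<Sum>\<kappa>\<in>S. hcomp LB \<rho> (dehom (hcomp LA \<kappa> p)))"
    unfolding p(2) by (metis S(2) dehom_sum hcomp_sum)
  ultimately show "hcomp LB \<rho> b \<in> dehom ` J" by simp
qed

lemma gprime_dehom:
  assumes J: "gprime LA F J" and X: "Tinf \<notin> J"
  shows "gprime LB f (dehom ` J)"
proof -
  have J': "cideal J" "F \<in> J" "hcomp_closed LA J" "1 \<notin> J"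
    "\<And>p q. homog LA p \<Longrightarrow> homog LA q \<Longrightarrow> p * q \<in> J \<Longrightarrow> p \<in> J \<or> q \<in> J"
    using J by (auto simp: gprime_def hprime_def)
  show ?thesis
    unfolding gprime_def hprime_def
  proof (intro conjI allI impI)
    show "cideal (dehom ` J)" by (rule cideal_dehom[OF J'(1)])
    show "hcomp_closed LB (dehom ` J)" by (rule hcomp_closed_dehom[OF J'(1,3)])
    show "f \<in> dehom ` J" using J'(2) dehom_F by blast
    show "1 \<notin> dehom ` J"
    proof
      assume "1 \<in> dehom ` J"
      then obtain p where p: "p \<in> J" "homog LA p" "dehom p = 1"
        using homogeneous_preimage[OF J'(1,3) _ homog_1[OF LB]] by metis
      have "dehom p = dehom 1" using p(3) by simp
      then obtain i j where ij: "Tinf ^ i * p = Tinf ^ j * 1"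
        using homogenization_unique[OF p(2) homog_1[OF LA]] by metis
      have "Tinf ^ j * 1 \<in> J" using cideal_mult[OF J'(1) p(1)] ij by metis
      then show False using Tinf_power_gprime[OF J X homog_1[OF LA]] J'(4) by blast
    qed
    fix b b' assume b: "homog LB b" "homog LB b'" "b * b' \<in> dehom ` J"
    obtain p where p: "p \<in> J" "homog LA p" "dehom p = b * b'"
      using homogeneous_preimage[OF J'(1,3) b(3) homog_mult[OF LB b(1,2)]] .
    obtain q q' where q: "homog LA q" "dehom q = b" "homog LA q'" "dehom q' = b'"
      using homogenize[OF b(1)] homogenize[OF b(2)] by metis
    have "dehom p = dehom (q * q')" using p q by (simp add: dehom_mult)
    then obtain i j where ij: "Tinf ^ i * p = Tinf ^ j * (q * q')"
      using homogenization_unique[OF p(2) homog_mult[OF LA q(1,3)]] by metis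
    then have "Tinf ^ j * (q * q') \<in> J" using cideal_mult[OF J'(1) p(1)] by metis
    then have "q * q' \<in> J" using Tinf_power_gprime[OF J X homog_mult[OF LA q(1,3)]] by blast
    then have "q \<in> J \<or> q' \<in> J" using J'(5) q by blast
    then show "b \<in> dehom ` J \<or> b' \<in> dehom ` J" using q by blast
  qed
qed

lemma minprime_dehom:
  assumes J: "minprime LA F J" and X: "Tinf \<notin> J"
  shows "minprime LB f (dehom ` J)"
proof -
  have g: "gprime LA F J" and min: "\<And>J'. gprime LA F J' \<Longrightarrow> J' \<subseteq> J \<Longrightarrow> \<exists>p\<in>J'. \<not> F dvd p \<Longrightarrow> J' = J"
    and nz: "\<exists>p\<in>J. \<not> F dvd p"
    using J by (auto simp: minprime_def)
  have J': "cideal J" "F \<in> J" "hcomp_closed LA J"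
    using g by (auto simp: gprime_def)
  show ?thesis
    unfolding minprime_def
  proof (intro conjI allI impI)
    show "gprime LB f (dehom ` J)" by (rule gprime_dehom[OF g X])
    obtain p where "p \<in> J" "\<not> F dvd p" using nz by blast
    then obtain q where "q \<in> J" "homog LA q" "\<not> F dvd q"
      using nonzero_homogeneous[OF LA J'(3)] by metis
    then show "\<exists>b\<in>dehom ` J. \<not> f dvd b" using dvd_of_dehom by blast
    fix I assume I: "gprime LB f I" "I \<subseteq> dehom ` J" "\<exists>b\<in>I. \<not> f dvd b"
    have I': "cideal I" "f \<in> I" "hcomp_closed LB I" "1 \<notin> I"
      "\<And>p q. homog LB p \<Longrightarrow> homog LB q \<Longrightarrow> p * q \<in> I \<Longrightarrow> p \<in> I \<or> q \<in> I"
      using I(1) by (auto simp: gprime_def hprime_def)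
    \<comment> \<open>A smaller prime ideal downstairs would give the smaller homogeneous prime ideal \<open>I2\<close>
      upstairs.\<close>
    define I2 where "I2 = {p. \<forall>\<kappa>. dehom (hcomp LA \<kappa> p) \<in> I}"
    have homog_I2: "p \<in> I2 \<longleftrightarrow> dehom p \<in> I" if p: "homog LA p" for p
    proof -
      obtain \<kappa> where \<kappa>: "homd LA \<kappa> p" using p by (auto simp: homog_def)
      have "hcomp LA \<rho> p = p \<or> hcomp LA \<rho> p = 0" for \<rho>
        using hcomp_homd_other[OF LA \<kappa>] hcomp_homd[OF homd_cong[OF LA \<kappa>]] by blast
      moreover have "hcomp LA \<kappa> p = p" by (rule hcomp_homd[OF \<kappa>])
      ultimately show ?thesis unfolding I2_def mem_Collect_eq using cideal_0[OF I'(1)]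
        by (metis dehom_0)
    qed
    have dehom_I2: "dehom p \<in> I" if "p \<in> I2" for p
    proof -
      obtain S where S: "p = (\<Sum>\<kappa>\<in>S. hcomp LA \<kappa> p)" using hcomp_decomposition[OF LA] by metis
      have "(\<Sum>\<kappa>\<in>S. dehom (hcomp LA \<kappa> p)) \<in> I"
        using that by (intro cideal_sum[OF I'(1)]) (simp add: I2_def)
      then show ?thesis using S by (metis dehom_sum)
    qed
    have "cideal {p. dehom p \<in> I}"
      using I'(1) by (auto simp: cideal_def dehom_add dehom_mult)
    from cideal_homogeneous_core[OF LA this] have "cideal I2" by (simp add: I2_def)
    moreover have "F \<in> I2" using homog_I2[OF F] I'(2) dehom_F by simp
    moreover have "hcomp_closed LA I2"
      unfolding hcomp_closed_def using homog_I2[OF homog_hcomp] by (simp add: I2_def)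
    moreover have "hprime LA I2"
      unfolding hprime_def
    proof (intro conjI allI impI)
      show "1 \<notin> I2" using homog_I2[OF homog_1[OF LA]] I'(4) by simp
      show "p \<in> I2 \<or> q \<in> I2" if "homog LA p" "homog LA q" "p * q \<in> I2" for p q
        using that I'(5)[OF homog_dehom homog_dehom] homog_I2 homog_mult[OF LA] by (metis dehom_mult)
    qed
    ultimately have g2: "gprime LA F I2" by (simp add: gprime_def)
    have sub: "I2 \<subseteq> J"
    proof
      fix p assume p: "p \<in> I2"
      obtain S where S: "p = (\<Sum>\<kappa>\<in>S. hcomp LA \<kappa> p)" using hcomp_decomposition[OF LA] by metis
      have "hcomp LA \<kappa> p \<in> J" for \<kappa>
      proof -
        let ?c = "hcomp LA \<kappa> p"
        have "dehom ?c \<in> dehom ` J" using p I(2) by (auto simp: I2_def)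
        then obtain q where q: "q \<in> J" "homog LA q" "dehom q = dehom ?c"
          using homogeneous_preimage[OF J'(1,3) _ homog_dehom[OF homog_hcomp]] by metis
        obtain i j where ij: "Tinf ^ i * q = Tinf ^ j * ?c"
          using homogenization_unique[OF q(2) homog_hcomp q(3)] .
        then have "Tinf ^ j * ?c \<in> J" using cideal_mult[OF J'(1) q(1)] by metis
        then show ?thesis using Tinf_power_gprime[OF g X homog_hcomp] by blast
      qed
      then have "(\<Sum>\<kappa>\<in>S. hcomp LA \<kappa> p) \<in> J" by (intro cideal_sum[OF J'(1)])
      then show "p \<in> J" using S by simp
    qed
    have "\<exists>p\<in>I2. \<not> F dvd p"
    proof -
      obtain b where b: "b \<in> I" "homog LB b" "\<not> f dvd b"
        using I(3) nonzero_homogeneous[OF LB I'(3)] by metis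
      obtain p where p: "homog LA p" "dehom p = b" using homogenize[OF b(2)] .
      then have "p \<in> I2" using homog_I2 b(1) by simp
      moreover have "\<not> F dvd p" using dvd_dehom p(2) b(3) by blast
      ultimately show ?thesis by blast
    qed
    then have "I2 = J" using min g2 sub by blast
    then have "dehom ` J \<subseteq> I" using dehom_I2 by blast
    then show "I = dehom ` J" using I(2) by blast
  qed
qed

text \<open>Nagata's argument. If \<open>Tinf\<close> is in \<open>J\<close> it generates \<open>J\<close> by minimality. Otherwise \<open>J\<close> is
  determined by its dehomogenization, generated by a homogeneous \<open>i\<close>. Let \<open>p\<close> be a lift of \<open>i\<close>
  in \<open>J\<close> which is not divisible by \<open>Tinf\<close> modulo \<open>F\<close>. Each homogeneous \<open>y\<close> in \<open>J\<close> satisfies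
  \<open>Tinf\<^sup>n y \<in> (F, p)\<close> for some \<open>n\<close>, and since \<open>Tinf\<close> is prime and does not divide \<open>p\<close>, it can be
  cancelled.\<close>

theorem minprime_principal:
  assumes f_prime: "prime_mod f" and F_prime: "prime_mod F"
    and X: "hprime LA (pid F Tinf)"
    and gen: "\<And>I. minprime LB f I \<Longrightarrow> \<exists>i. homog LB i \<and> I = pid f i"
    and J: "minprime LA F J"
  shows "\<exists>i. J = pid F i"
proof (cases "Tinf \<in> J")
  case True
  have "\<not> F dvd Tinf"
    using dvd_dehom[of Tinf] f_prime by (auto simp: prime_mod_def)
  moreover have "gprime LA F (pid F Tinf)"
    using X hcomp_closed_pid[OF LA F homog_Tinf] by (simp add: gprime_def)
  moreover have "pid F Tinf \<subseteq> J" using True J by (intro pid_least) (auto simp: minprime_def gprime_def)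
  ultimately have "pid F Tinf = J"
    using J pid_gen(1)[of Tinf F] unfolding minprime_def by blast
  then show ?thesis by blast
next
  case XJ: False
  have g: "gprime LA F J" using J by (simp add: minprime_def)
  have J': "cideal J" "F \<in> J" "hcomp_closed LA J"
    "\<And>p q. homog LA p \<Longrightarrow> homog LA q \<Longrightarrow> p * q \<in> J \<Longrightarrow> p \<in> J \<or> q \<in> J"
    using g by (auto simp: gprime_def hprime_def)
  note mp = minprime_dehom[OF J XJ]
  obtain i where i: "homog LB i" "dehom ` J = pid f i" using gen[OF mp] by blast
  have nz: "\<exists>b\<in>dehom ` J. \<not> f dvd b" using mp by (simp add: minprime_def)
  define T where "T = {p \<in> J. homog LA p \<and> pid f (dehom p) = dehom ` J}"
  obtain p0 where p0: "p0 \<in> J" "homog LA p0" "dehom p0 = i"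
    using homogeneous_preimage[OF J'(1,3) _ i(1)] i(2) pid_gen(1)[of i f] by metis
  then have "pid F p0 \<in> pid F ` T" using i(2) by (auto simp: T_def)
  \<comment> \<open>A factor \<open>Tinf\<close> of \<open>p\<close> modulo \<open>F\<close> could be removed to enlarge the ideal \<open>(F, p)\<close>, so a
    maximal one has a generator without such a factor.\<close>
  then obtain M where M: "M \<in> pid F ` T" "\<And>I. I \<in> pid F ` T \<Longrightarrow> \<not> M \<subset> I"
    by (rule noetherian_maximal[rotated]) auto
  from M(1) obtain p where p: "p \<in> T" "M = pid F p" by blast
  have p': "p \<in> J" "homog LA p" "pid f (dehom p) = dehom ` J" using p(1) by (auto simp: T_def)
  have nX: "\<not> F dvd p - Tinf * q" if q: "homog LA q" for q
  proof
    assume *: "F dvd p - Tinf * q"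
    have "p - Tinf * q \<in> J" using cideal_dvd[OF J'(1,2) *] .
    then have "Tinf * q \<in> J" using cideal_diff_iff[OF J'(1)] p'(1) by blast
    then have qJ: "q \<in> J" using J'(4)[OF homog_Tinf q] XJ by blast
    have "f dvd dehom p - dehom q" using dvd_dehom[OF *] by (simp add: dehom_diff dehom_mult)
    then have pq: "pid f (dehom q) = dehom ` J" using pid_cong p'(3) by metis
    then have "q \<in> T" using qJ q by (simp add: T_def)
    then have "\<not> pid F p \<subset> pid F q" using M(2)[of "pid F q"] p(2) by blast
    moreover have "p \<in> pid F q" using * by (intro pid_memI[of _ _ _ Tinf]) (simp add: mult.commute)
    then have "pid F p \<subseteq> pid F q" by (intro pid_least) auto
    ultimately have "pid F q = pid F p" by (metis psubsetI)
    then have "q \<in> pid F p" using pid_gen(1)[of q F] by simp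
    then obtain b where "F dvd q - p * b" by (auto simp: pid_def)
    then have "F dvd (q - p * b) + (p - Tinf * q) * b" using * by simp
    also have "(q - p * b) + (p - Tinf * q) * b = q * (1 - Tinf * b)" by (simp add: algebra_simps)
    finally have "F dvd q \<or> F dvd 1 - Tinf * b" using F_prime prime_modD by blast
    then show False
    proof
      assume "F dvd q"
      then have "pid f (dehom q) = {b. f dvd b}" by (intro pid_eq_multiples dvd_dehom)
      then show False using pq nz by auto
    next
      assume "F dvd 1 - Tinf * b"
      then show False using X pid_memI unfolding hprime_def by blast
    qed
  qed
  have Xel: "hprime_elem LA F Tinf"
    using X homog_Tinf dvd_dehom[of Tinf] f_prime by (auto simp: hprime_elem_def prime_mod_def)
  have strip: "z \<in> pid F p" if z: "homog LA z" "Tinf * z \<in> pid F p" for z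
  proof -
    obtain q where "F dvd Tinf * z - p * q" using z(2) by (auto simp: pid_def)
    then obtain q' where q': "homog LA q'" "F dvd Tinf * z - p * q'"
      using homogeneous_cofactor[OF LA hcomp_closed_multiples[OF LA F] homog_mult[OF LA homog_Tinf z(1)] p'(2)]
      by blast
    then have "F dvd p * q' - Tinf * z" by (metis dvd_minus_iff minus_diff_eq)
    then have "p * q' \<in> pid F Tinf" by (rule pid_memI)
    with LA F Xel p'(2) q'(1) show ?thesis
    proof (rule hprime_elem_divides)
      fix x' assume "homog LA x'" "F dvd p - Tinf * x'"
      then show ?thesis using nX by blast
    next
      fix y' assume y': "homog LA y'" "F dvd q' - Tinf * y'"
      have "F dvd (Tinf * z - p * q') + p * (q' - Tinf * y')" using q' y' by simp
      also have "(Tinf * z - p * q') + p * (q' - Tinf * y') = Tinf * (z - p * y')"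
        by (simp add: algebra_simps)
      finally have "F dvd z - p * y'" by (rule cancel_Tinf)
      then show ?thesis by (rule pid_memI)
    qed
  qed
  have strip_power: "y \<in> pid F p" if "homog LA y" "Tinf ^ n * y \<in> pid F p" for n y
    using that(2)
  proof (induction n)
    case (Suc n)
    then have "Tinf * (Tinf ^ n * y) \<in> pid F p" by (simp add: mult.assoc)
    then have "Tinf ^ n * y \<in> pid F p"
      using strip homog_mult[OF LA homog_power[OF LA homog_Tinf] that(1)] by blast
    then show ?case by (rule Suc.IH)
  qed simp
  have homog_J: "y \<in> pid F p" if y: "y \<in> J" "homog LA y" for y
  proof -
    obtain \<kappa> where \<kappa>: "homd LA \<kappa> y" using y(2) by (auto simp: homog_def)
    obtain \<rho> where \<rho>: "homd LA \<rho> p" using p'(2) by (auto simp: homog_def)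
    have "dehom y \<in> pid f (dehom p)" using y(1) p'(3) by blast
    then obtain b where "dehom y - dehom p * b \<in> {b. f dvd b}" by (auto simp: pid_def)
    then obtain b' where b': "homd LB (proj \<kappa> - proj \<rho>) b'" "f dvd dehom y - dehom p * b'"
      using homogeneous_cofactor_degree[OF LB hcomp_closed_multiples[OF LB f] homd_dehom[OF \<kappa>] homd_dehom[OF \<rho>]]
      by blast
    obtain q where q: "homog LA q" "dehom q = b'" using homogenize[OF homogI[OF b'(1)]] .
    have "homd LB (proj \<rho> + (proj \<kappa> - proj \<rho>)) (dehom (p * q))"
      unfolding dehom_mult q(2) by (rule homd_mult[OF LB homd_dehom[OF \<rho>] b'(1)])
    then have "homd LB (proj \<kappa>) (dehom (p * q))" by simp
    then obtain i j \<kappa>' where ij: "homd LA \<kappa>' (Tinf ^ i * y)" "homd LA \<kappa>' (Tinf ^ j * (p * q))"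
      by (rule common_degree[OF y(2) homog_mult[OF LA p'(2) q(1)] homd_dehom[OF \<kappa>]])
    have "F dvd Tinf ^ i * y - Tinf ^ j * (p * q)"
    proof (rule dvd_of_dehom)
      show "homog LA (Tinf ^ i * y - Tinf ^ j * (p * q))" using homd_diff[OF ij] homogI by blast
      show "f dvd dehom (Tinf ^ i * y - Tinf ^ j * (p * q))"
        using b'(2) by (simp add: dehom_diff dehom_mult q(2))
    qed
    then have "Tinf ^ i * y \<in> pid F p"
      by (intro pid_memI[of _ _ _ "Tinf ^ j * q"]) (simp add: algebra_simps)
    then show ?thesis using strip_power y(2) by blast
  qed
  have "J \<subseteq> pid F p"
  proof
    fix y assume y: "y \<in> J"
    obtain S where S: "y = (\<Sum>\<kappa>\<in>S. hcomp LA \<kappa> y)" using hcomp_decomposition[OF LA] by metis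
    have "(\<Sum>\<kappa>\<in>S. hcomp LA \<kappa> y) \<in> pid F p"
      using y J'(3) homog_J by (intro cideal_sum[OF cideal_pid]) (auto simp: hcomp_closed_def)
    then show "y \<in> pid F p" using S by simp
  qed
  moreover have "pid F p \<subseteq> J" by (rule pid_least[OF J'(1,2) p'(1)])
  ultimately show ?thesis by blast
qed

end

text \<open>The grading by one integral functional \<open>c\<close> is torsion-free, so being a domain can be tested on
  homogeneous elements. It serves to show that \<open>F\<close> defines a domain with constant units, which a
  grading with torsion cannot show.\<close>

locale weighted_homogenization = homogenized_hypersurface "ker c" LB F f
  for c :: "int^'r::finite option" and LB F and f :: "('r, 'k::field) mpoly" +
  assumes f_prime: "prime_mod f"
begin

lemma cpart_closed_multiples: "cpart_closed c {p. F dvd p}"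
  by (rule cpart_closed_of_hcomp_closed[OF LA _ cideal_multiples hcomp_closed_multiples[OF LA F]]) simp

lemma hprime_multiples: "hprime (ker c) {p. F dvd p}"
proof (rule hprime_transfer)
  show "hprime LB {b. f dvd b}" using f_prime by (auto simp: hprime_def prime_mod_def)
qed

text \<open>Primeness of \<open>f\<close> transfers to homogeneous elements modulo \<open>F\<close> for the grading by \<open>ker c\<close>, and
  from there to all elements.\<close>

lemma prime_homogenization: "prime_mod F"
proof -
  have "hprime UNIV {p. F dvd p}"
    by (rule hprime_coarsen[OF add_subgroup_UNIV cideal_multiples _ cpart_closed_multiples])
      (use hprime_multiples in simp)
  then show ?thesis by (auto simp: hprime_def prime_mod_def)
qed

text \<open>A unit \<open>p'\<close> is homogeneous for the grading by the integers and dehomogenizes to a constant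
  \<open>e\<close>, so \<open>Tinf\<^sup>i p' = Tinf\<^sup>j e\<close> modulo \<open>F\<close>. After cancellation at most one side carries a
  factor \<open>Tinf\<close>, and then \<open>Tinf\<close> would be a unit.\<close>

lemma const_units_homogenization:
  assumes units: "const_units f" and X: "1 \<notin> pid F Tinf"
  shows "const_units F"
  unfolding const_units_def
proof (intro allI impI)
  fix p q assume pq: "F dvd p * q - 1"
  then obtain m where m: "F dvd p - cpart c m p" "F dvd q - cpart c (- m) q"
    using unit_cpart[OF cideal_multiples hprime_multiples cpart_closed_multiples] by auto
  define p' q' where "p' = cpart c m p" and "q' = cpart c (- m) q"
  have p'h: "homog (ker c) p'"
    unfolding p'_def using homog_cpart[OF add_subgroup_UNIV homog_UNIV, of c m p] by simp
  have "F dvd (p * q - 1) - (p - p') * q - p' * (q - q')" using pq m unfolding p'_def q'_def by simp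
  also have "(p * q - 1) - (p - p') * q - p' * (q - q') = p' * q' - 1" by (simp add: algebra_simps)
  finally have p'q': "F dvd p' * q' - 1" .
  then have "f dvd dehom p' * dehom q' - 1" using dvd_dehom by (metis dehom_1 dehom_diff dehom_mult)
  then obtain e where e: "e \<noteq> 0" "f dvd dehom p' - Const e" using units by (auto simp: const_units_def)
  have ne: "\<not> f dvd Const e"
    using dvd_Const_mult_iff[OF e(1), of f 1] f_prime by (simp add: prime_mod_def)
  obtain \<rho> where \<rho>: "homd LB \<rho> (dehom p')" using homog_dehom[OF p'h] by (auto simp: homog_def)
  have "\<rho> - 0 \<in> LB"
  proof (rule ccontr)
    assume "\<rho> - 0 \<notin> LB"
    then have "hcomp LB 0 (dehom p') = 0" by (rule hcomp_homd_other[OF LB \<rho>])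
    then have "hcomp LB 0 (dehom p' - Const e) = - Const e"
      using hcomp_homd[OF homd_Const[OF LB]] by (simp add: hcomp_diff)
    moreover have "f dvd hcomp LB 0 (dehom p' - Const e)"
      using hcomp_closed_multiples[OF LB f] e(2) by (auto simp: hcomp_closed_def)
    ultimately show False using ne by simp
  qed
  then have deg0: "homd LB 0 (dehom p')" by (rule homd_cong[OF LB \<rho>])
  have "homd LB 0 (dehom (Const e))" using homd_Const[OF LB] by simp
  then obtain i j \<kappa> where ij: "homd (ker c) \<kappa> (Tinf ^ i * p')" "homd (ker c) \<kappa> (Tinf ^ j * Const e)"
    by (rule common_degree[OF p'h homogI[OF homd_Const[OF LA]] deg0])
  have main: "F dvd Tinf ^ i * p' - Tinf ^ j * Const e"
  proof (rule dvd_of_dehom)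
    show "homog (ker c) (Tinf ^ i * p' - Tinf ^ j * Const e)" using homd_diff[OF ij] homogI by blast
    show "f dvd dehom (Tinf ^ i * p' - Tinf ^ j * Const e)" using e(2) by (simp add: dehom_diff dehom_mult)
  qed
  have nunit: False if "F dvd 1 - Tinf * b" for b using X that pid_memI by blast
  consider "i = j" | k where "i = j + Suc k" | k where "j = i + Suc k"
    by (metis less_imp_Suc_add linorder_neqE_nat add_Suc_right)
  then have "F dvd p' - Const e"
  proof cases
    case 1
    then have "F dvd Tinf ^ j * (p' - Const e)" using main by (simp add: algebra_simps)
    then show ?thesis by (rule cancel_Tinf_power)
  next
    case (2 k)
    have "Tinf ^ i * p' - Tinf ^ j * Const e = Tinf ^ j * (Tinf * (Tinf ^ k * p') - Const e)"
      unfolding 2 by (simp add: power_add algebra_simps)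
    then have "F dvd Tinf * (Tinf ^ k * p') - Const e" using main cancel_Tinf_power by metis
    then have "F dvd - (Const (inverse e) * (Tinf * (Tinf ^ k * p') - Const e))" by simp
    also have "- (Const (inverse e) * (Tinf * (Tinf ^ k * p') - Const e)) =
        Const e * Const (inverse e) - Tinf * (Const (inverse e) * (Tinf ^ k * p'))"
      by (simp add: algebra_simps)
    also have "Const e * Const (inverse e) = (1 :: ('r option, 'k) mpoly)" by (rule Const_inverse[OF e(1)])
    finally show ?thesis using nunit by blast
  next
    case (3 k)
    have "Tinf ^ i * p' - Tinf ^ j * Const e = Tinf ^ i * (p' - Tinf * (Tinf ^ k * Const e))"
      unfolding 3 by (simp add: power_add algebra_simps)
    then have "F dvd p' - Tinf * (Tinf ^ k * Const e)" using main cancel_Tinf_power by metis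
    from dvd_diff[OF dvd_mult2[OF this] p'q']
    have "F dvd (p' - Tinf * (Tinf ^ k * Const e)) * q' - (p' * q' - 1)" .
    also have "(p' - Tinf * (Tinf ^ k * Const e)) * q' - (p' * q' - 1) = 1 - Tinf * (Tinf ^ k * Const e * q')"
      by (simp add: algebra_simps)
    finally show ?thesis using nunit by blast
  qed
  then have "F dvd (p - p') + (p' - Const e)" using m(1) unfolding p'_def by (intro dvd_add)
  then show "\<exists>e. e \<noteq> 0 \<and> F dvd p - Const e" using e(1) by (intro exI[of _ e]) simp
qed

end

section \<open>The quotient ring as a ring record\<close>

lemma mpoly_ring_simps [simp]:
  "carrier mpoly_ring = UNIV" "p \<otimes>\<^bsub>mpoly_ring\<^esub> q = p * q" "p \<oplus>\<^bsub>mpoly_ring\<^esub> q = p + q"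
  "\<one>\<^bsub>mpoly_ring\<^esub> = 1" "\<zero>\<^bsub>mpoly_ring\<^esub> = 0"
  by (simp_all add: mpoly_ring_def ring_of_type_algebra_def)

lemma cring_mpoly_ring: "cring (mpoly_ring :: ('v, 'k::comm_ring_1) mpoly ring)"
  unfolding mpoly_ring_def by (rule cring_from_type_algebra)

lemma PIdl_mpoly_ring: "PIdl\<^bsub>mpoly_ring\<^esub> F = {p. F dvd p}"
  by (auto simp: cgenideal_def dvd_def mult.commute)

lemma ideal_multiples: "ideal {p. F dvd p} (mpoly_ring :: ('v, 'k::comm_ring_1) mpoly ring)"
  using cring.cgenideal_ideal[OF cring_mpoly_ring, of F] by (simp add: PIdl_mpoly_ring)

lemma quot_ring_eq: "quot_ring F = mpoly_ring Quot {p. F dvd p}"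
  by (simp add: quot_ring_def PIdl_mpoly_ring)

text \<open>Since the classes are literally cosets, every statement about the quotient becomes a
  divisibility by \<open>F\<close>.\<close>

lemma quot_class_eq_set: "quot_class F p = {q. F dvd q - p}"
proof -
  have "quot_class F p = (\<lambda>h. h + p) ` {q. F dvd q}"
    by (auto simp: quot_class_def PIdl_mpoly_ring a_r_coset_def r_coset_def)
  also have "\<dots> = {q. F dvd q - p}"
  proof (intro equalityI subsetI)
    fix q assume "q \<in> {q. F dvd q - p}"
    then show "q \<in> (\<lambda>h. h + p) ` {q. F dvd q}" by (intro image_eqI[of _ _ "q - p"]) simp_all
  qed auto
  finally show ?thesis .
qed

lemma quot_class_eq_iff: "quot_class F p = quot_class F q \<longleftrightarrow> F dvd p - q"
proof
  assume "quot_class F p = quot_class F q"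
  moreover have "p \<in> quot_class F p" by (simp add: quot_class_eq_set)
  ultimately have "p \<in> quot_class F q" by simp
  then show "F dvd p - q" by (simp add: quot_class_eq_set)
next
  assume "F dvd p - q"
  then have "F dvd r - p \<longleftrightarrow> F dvd r - q" for r
    using cideal_diff_iff[OF cideal_multiples, of "r - q" "r - p" F] by (auto simp: algebra_simps)
  then show "quot_class F p = quot_class F q" by (simp add: quot_class_eq_set)
qed

lemma quot_class_hom: "quot_class F \<in> ring_hom mpoly_ring (quot_ring F)"
  using ideal.rcos_ring_hom[OF ideal_multiples, of F]
  by (simp add: quot_ring_eq quot_class_def[abs_def] PIdl_mpoly_ring)

lemma carrier_quot_ring: "carrier (quot_ring F) = range (quot_class F)"
  by (auto simp: quot_ring_eq FactRing_def A_RCOSETS_def RCOSETS_def a_r_coset_def quot_class_def PIdl_mpoly_ring)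

lemma cring_quot_ring: "cring (quot_ring F)"
  unfolding quot_ring_eq by (rule ideal.quotient_is_cring[OF ideal_multiples cring_mpoly_ring])

lemma quot_class_simps [simp]:
  "quot_class F p \<in> carrier (quot_ring F)"
  "quot_class F p \<otimes>\<^bsub>quot_ring F\<^esub> quot_class F q = quot_class F (p * q)"
  "quot_class F p \<oplus>\<^bsub>quot_ring F\<^esub> quot_class F q = quot_class F (p + q)"
  "\<one>\<^bsub>quot_ring F\<^esub> = quot_class F 1"
  using ring_hom_mult[OF quot_class_hom, of p q F] ring_hom_add[OF quot_class_hom, of p q F]
    ring_hom_one[OF quot_class_hom, of F]
  by (auto simp: carrier_quot_ring)

lemma zero_quot_ring [simp]: "\<zero>\<^bsub>quot_ring F\<^esub> = quot_class F 0"
  by (simp add: quot_class_eq_set quot_ring_eq FactRing_def)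

lemma quot_ringE:
  assumes "x \<in> carrier (quot_ring F)"
  obtains p where "x = quot_class F p"
  using assms by (auto simp: carrier_quot_ring)

lemma quot_class_uminus: "\<ominus>\<^bsub>quot_ring F\<^esub> quot_class F p = quot_class F (- p)"
proof -
  interpret cring "quot_ring F" by (rule cring_quot_ring)
  show ?thesis by (rule minus_equality) simp_all
qed

lemma quot_class_finsum:
  assumes "finite S"
  shows "(\<Oplus>\<^bsub>quot_ring F\<^esub>g\<in>S. quot_class F (a g)) = quot_class F (\<Sum>g\<in>S. a g)"
proof -
  interpret cring "quot_ring F" by (rule cring_quot_ring)
  show ?thesis using assms by induction simp_all
qed

lemma divides_quot_ring:
  "quot_class F p divides\<^bsub>quot_ring F\<^esub> quot_class F q \<longleftrightarrow> q \<in> pid F p"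
  by (auto simp: factor_def carrier_quot_ring quot_class_eq_iff pid_def)

lemma domain_quot_ring_iff: "domain (quot_ring F) \<longleftrightarrow> prime_mod F"
proof
  assume "domain (quot_ring F)"
  then interpret domain "quot_ring F" .
  show "prime_mod F"
    unfolding prime_mod_def
  proof (intro conjI allI impI)
    show "\<not> F dvd 1" using one_not_zero by (simp add: quot_class_eq_iff)
    show "F dvd p \<or> F dvd q" if "F dvd p * q" for p q
      using integral[of "quot_class F p" "quot_class F q"] that by (simp add: quot_class_eq_iff)
  qed
next
  assume F: "prime_mod F"
  interpret cring "quot_ring F" by (rule cring_quot_ring)
  show "domain (quot_ring F)"
  proof
    show "\<one>\<^bsub>quot_ring F\<^esub> \<noteq> \<zero>\<^bsub>quot_ring F\<^esub>" using F by (simp add: quot_class_eq_iff prime_mod_def)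
    fix x y assume xy: "x \<otimes>\<^bsub>quot_ring F\<^esub> y = \<zero>\<^bsub>quot_ring F\<^esub>"
      and carr: "x \<in> carrier (quot_ring F)" "y \<in> carrier (quot_ring F)"
    obtain p q where pq: "x = quot_class F p" "y = quot_class F q" using carr by (metis quot_ringE)
    then have "F dvd p * q" using xy by (simp add: quot_class_eq_iff)
    then show "x = \<zero>\<^bsub>quot_ring F\<^esub> \<or> y = \<zero>\<^bsub>quot_ring F\<^esub>"
      using F unfolding pq prime_mod_def by (simp add: quot_class_eq_iff)
  qed
qed

lemma Units_quot_ring: "quot_class F p \<in> Units (quot_ring F) \<longleftrightarrow> (\<exists>q. F dvd p * q - 1)"
proof -
  interpret cring "quot_ring F" by (rule cring_quot_ring)
  show ?thesis
    by (auto simp: Units_def carrier_quot_ring quot_class_eq_iff mult.commute)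
qed

lemma Units_quot_ring_const_iff:
  fixes F :: "('v, 'k::field) mpoly"
  shows "Units (quot_ring F) = quot_const F ` (UNIV - {0}) \<longleftrightarrow> const_units F"
proof
  assume *: "Units (quot_ring F) = quot_const F ` (UNIV - {0})"
  show "const_units F"
    unfolding const_units_def
  proof (intro allI impI)
    fix p q assume "F dvd p * q - 1"
    then have "quot_class F p \<in> quot_const F ` (UNIV - {0})" using Units_quot_ring * by blast
    then show "\<exists>c. c \<noteq> 0 \<and> F dvd p - Const c" by (auto simp: quot_const_def quot_class_eq_iff)
  qed
next
  assume F: "const_units F"
  show "Units (quot_ring F) = quot_const F ` (UNIV - {0})"
  proof (intro equalityI subsetI)
    fix x assume x: "x \<in> Units (quot_ring F)"
    then obtain p where p: "x = quot_class F p" by (auto simp: Units_def elim: quot_ringE)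
    then obtain c where "c \<noteq> 0" "F dvd p - Const c"
      using x F Units_quot_ring unfolding const_units_def by blast
    then show "x \<in> quot_const F ` (UNIV - {0})"
      using p by (auto simp: quot_const_def quot_class_eq_iff)
  next
    fix x assume "x \<in> quot_const F ` (UNIV - {0})"
    then obtain c where c: "c \<noteq> 0" "x = quot_class F (Const c)" by (auto simp: quot_const_def)
    have "F dvd Const c * Const (inverse c) - 1" unfolding Const_inverse[OF c(1)] by simp
    then show "x \<in> Units (quot_ring F)" using Units_quot_ring c(2) by blast
  qed
qed

lemma ideal_quot_preimage:
  assumes "ideal I (quot_ring F)"
  shows "cideal {p. quot_class F p \<in> I}" "F \<in> {p. quot_class F p \<in> I}"
    "I = quot_class F ` {p. quot_class F p \<in> I}"
proof -
  interpret ideal I "quot_ring F" by fact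
  show "F \<in> {p. quot_class F p \<in> I}"
  proof -
    have "\<zero>\<^bsub>quot_ring F\<^esub> = quot_class F F" by (simp add: quot_class_eq_iff)
    then show ?thesis using additive_subgroup.zero_closed[OF additive_subgroup_axioms] by simp
  qed
  show "cideal {p. quot_class F p \<in> I}"
    unfolding cideal_def
  proof (intro conjI ballI allI)
    show "0 \<in> {p. quot_class F p \<in> I}"
      using additive_subgroup.zero_closed[OF additive_subgroup_axioms] by simp
    show "p + q \<in> {p. quot_class F p \<in> I}" if "p \<in> {p. quot_class F p \<in> I}" "q \<in> {p. quot_class F p \<in> I}" for p q
      using additive_subgroup.a_closed[OF additive_subgroup_axioms, of "quot_class F p" "quot_class F q"] that
      by simp
    show "r * p \<in> {p. quot_class F p \<in> I}" if "p \<in> {p. quot_class F p \<in> I}" for p r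
      using I_l_closed[of "quot_class F p" "quot_class F r"] that by simp
  qed
  show "I = quot_class F ` {p. quot_class F p \<in> I}"
  proof (intro equalityI subsetI)
    fix x assume x: "x \<in> I"
    then obtain p where "x = quot_class F p" using a_subset by (auto elim: quot_ringE)
    then show "x \<in> quot_class F ` {p. quot_class F p \<in> I}" using x by blast
  qed blast
qed

lemma quot_class_in_image:
  assumes "cideal J" "F \<in> J"
  shows "quot_class F p \<in> quot_class F ` J \<longleftrightarrow> p \<in> J"
proof
  assume "quot_class F p \<in> quot_class F ` J"
  then obtain q where "q \<in> J" "F dvd p - q" by (auto simp: quot_class_eq_iff)
  then show "p \<in> J" using cideal_diff_iff[OF assms(1) cideal_dvd[OF assms]] by blast
qed simp

lemma quot_class_in_multiples: "quot_class F p \<in> quot_class F ` {q. F dvd q} \<longleftrightarrow> F dvd p"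
  using quot_class_in_image[OF cideal_multiples, of F F p] by simp

lemma ideal_quot_image:
  assumes "cideal J" "F \<in> J"
  shows "ideal (quot_class F ` J) (quot_ring F)"
proof -
  interpret cring "quot_ring F" by (rule cring_quot_ring)
  show ?thesis
  proof (rule idealI)
    show "ring (quot_ring F)" by (rule ring_axioms)
    show "subgroup (quot_class F ` J) (add_monoid (quot_ring F))"
    proof (rule add.subgroupI)
      show "quot_class F ` J \<subseteq> carrier (quot_ring F)" by auto
      show "quot_class F ` J \<noteq> {}" using assms(2) by blast
      show "\<ominus>\<^bsub>quot_ring F\<^esub> x \<in> quot_class F ` J" if "x \<in> quot_class F ` J" for x
        using that cideal_uminus[OF assms(1)] by (auto simp: quot_class_uminus)
      show "x \<oplus>\<^bsub>quot_ring F\<^esub> y \<in> quot_class F ` J" if "x \<in> quot_class F ` J" "y \<in> quot_class F ` J" for x y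
        using that cideal_add[OF assms(1)] by auto
    qed
    show "y \<otimes>\<^bsub>quot_ring F\<^esub> x \<in> quot_class F ` J" if "x \<in> quot_class F ` J" "y \<in> carrier (quot_ring F)" for x y
      using that cideal_mult[OF assms(1)] by (auto elim!: quot_ringE)
    show "x \<otimes>\<^bsub>quot_ring F\<^esub> y \<in> quot_class F ` J" if "x \<in> quot_class F ` J" "y \<in> carrier (quot_ring F)" for x y
      using that cideal_mult2[OF assms(1)] by (auto elim!: quot_ringE)
  qed
qed

text \<open>Ideals containing \<open>F\<close> are determined by their images in the quotient.\<close>

lemma principalideal_quot_image_iff:
  assumes "cideal J" "F \<in> J"
  shows "principalideal (quot_class F ` J) (quot_ring F) \<longleftrightarrow> (\<exists>i. J = pid F i)"
proof -
  interpret cring "quot_ring F" by (rule cring_quot_ring)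
  have Idl: "Idl\<^bsub>quot_ring F\<^esub> {quot_class F i} = quot_class F ` pid F i" for i
  proof -
    have "Idl\<^bsub>quot_ring F\<^esub> {quot_class F i} = PIdl\<^bsub>quot_ring F\<^esub> (quot_class F i)"
      by (rule cgenideal_eq_genideal[symmetric]) simp
    also have "\<dots> = {quot_class F (b * i) | b. True}"
      unfolding cgenideal_def carrier_quot_ring by (auto simp del: quot_class_simps(1)) force+
    also have "\<dots> = quot_class F ` pid F i"
    proof (intro equalityI subsetI)
      fix x assume "x \<in> {quot_class F (b * i) | b. True}"
      then obtain b where "x = quot_class F (b * i)" by blast
      moreover have "b * i \<in> pid F i" by (intro pid_memI[of _ _ _ b]) (simp add: mult.commute)
      ultimately show "x \<in> quot_class F ` pid F i" by blast
    next
      fix x assume "x \<in> quot_class F ` pid F i"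
      then obtain p where p: "x = quot_class F p" "p \<in> pid F i" by (rule imageE)
      then obtain b where "F dvd p - i * b" by (auto simp: pid_def)
      then have "x = quot_class F (b * i)" using p(1) by (simp add: quot_class_eq_iff mult.commute)
      then show "x \<in> {quot_class F (b * i) | b. True}" by blast
    qed
    finally show ?thesis .
  qed
  show ?thesis
  proof
    assume "principalideal (quot_class F ` J) (quot_ring F)"
    then obtain x where x: "x \<in> carrier (quot_ring F)" "quot_class F ` J = Idl\<^bsub>quot_ring F\<^esub> {x}"
      using principalideal.generate by blast
    then obtain i where "x = quot_class F i" by (auto elim: quot_ringE)
    then have "quot_class F ` J = quot_class F ` pid F i" using x(2) Idl by simp
    then have "p \<in> J \<longleftrightarrow> p \<in> pid F i" for p
      using quot_class_in_image[OF assms, of p] quot_class_in_image[of "pid F i" F p] by simp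
    then show "\<exists>i. J = pid F i" by blast
  next
    assume "\<exists>i. J = pid F i"
    then obtain i where i: "J = pid F i" ..
    show "principalideal (quot_class F ` J) (quot_ring F)"
      by (rule principalidealI[OF ideal_quot_image[OF assms]])
        (use Idl[of i] i in \<open>auto intro!: bexI[of _ "quot_class F i"]\<close>)
  qed
qed

section \<open>Gradings by a group presented by a lattice of exponents\<close>

text \<open>Presents the grading by an abstract group \<open>G\<close> through the lattice of relations between the
  degrees of the variables. The degrees of monomials need not exhaust \<open>G\<close>; other components are
  0.\<close>

locale lattice_graded =
  fixes G :: "'g monoid" and w :: "'v::finite \<Rightarrow> 'g" and L :: "(int^'v) set"
  assumes fg: "fg_abelian_group G" and w: "w i \<in> carrier G" and L: "add_subgroup L"
    and degree_eq_iff: "monom_degree G w \<mu> = monom_degree G w \<nu> \<longleftrightarrow> ivec \<mu> - ivec \<nu> \<in> L"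
begin

lemma comm_group: "comm_group G"
  using fg by (simp add: fg_abelian_group_def)

lemma degree_closed: "monom_degree G w \<mu> \<in> carrier G"
proof -
  interpret comm_group G by (rule comm_group)
  show ?thesis unfolding monom_degree_def by (intro finprod_closed) (auto intro: w nat_pow_closed)
qed

lemma monom_degree_superset:
  assumes "finite S" "keys \<mu> \<subseteq> S"
  shows "monom_degree G w \<mu> = (\<Otimes>\<^bsub>G\<^esub>i\<in>S. w i [^]\<^bsub>G\<^esub> lookup \<mu> i)"
proof -
  interpret comm_group G by (rule comm_group)
  show ?thesis
    unfolding monom_degree_def
    by (rule finprod_mono_neutral_cong_left[OF assms]) (auto simp: in_keys_iff w)
qed

lemma degree_add: "monom_degree G w (\<mu> + \<nu>) = monom_degree G w \<mu> \<otimes>\<^bsub>G\<^esub> monom_degree G w \<nu>"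
proof -
  interpret comm_group G by (rule comm_group)
  have "monom_degree G w \<rho> = (\<Otimes>\<^bsub>G\<^esub>i\<in>UNIV. w i [^]\<^bsub>G\<^esub> lookup \<rho> i)" for \<rho>
    by (rule monom_degree_superset) auto
  then show ?thesis
    by (simp add: lookup_add nat_pow_mult[symmetric] w finprod_multf)
qed

text \<open>Agrees with \<open>hcomp\<close> on degrees of monomials and is 0 on all other elements of \<open>G\<close>.\<close>

definition gcomp :: "'g \<Rightarrow> ('v, 'k::comm_ring_1) mpoly \<Rightarrow> ('v, 'k) mpoly" where
  "gcomp g p = part (\<lambda>\<mu>. monom_degree G w \<mu> = g) p"

lemma gcomp_eq: "gcomp (monom_degree G w \<nu>) p = hcomp L (ivec \<nu>) p"
  unfolding gcomp_def hcomp_def by (simp add: degree_eq_iff)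

lemma gcomp_cases: "(\<exists>\<kappa>. gcomp g p = hcomp L \<kappa> p) \<or> gcomp g p = 0"
proof (cases "\<exists>\<nu>. monom_degree G w \<nu> = g")
  case True
  then show ?thesis using gcomp_eq by blast
next
  case False
  then show ?thesis unfolding gcomp_def by (intro disjI2 part_none) blast
qed

lemma poly_component_iff: "p \<in> poly_component G w g \<longleftrightarrow> gcomp g p = p"
proof
  assume "p \<in> poly_component G w g"
  then show "gcomp g p = p" unfolding gcomp_def by (intro part_all) (simp add: poly_component_def)
next
  assume "gcomp g p = p"
  then have "keys p = keys (gcomp g p)" by simp
  then show "p \<in> poly_component G w g" by (auto simp: gcomp_def keys_part poly_component_def)
qed

lemma gcomp_in_component: "gcomp g p \<in> poly_component G w g"
  by (auto simp: poly_component_def gcomp_def keys_part)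

lemma gcomp_other: "p \<in> poly_component G w h \<Longrightarrow> h \<noteq> g \<Longrightarrow> gcomp g p = 0"
  unfolding gcomp_def by (intro part_none) (auto simp: poly_component_def)

lemma homog_iff: "homog L p \<longleftrightarrow> (\<exists>g\<in>carrier G. p \<in> poly_component G w g)"
proof (cases "p = 0")
  case True
  interpret comm_group G by (rule comm_group)
  show ?thesis using True by (auto simp: poly_component_def)
next
  case False
  then obtain \<nu> where \<nu>: "\<nu> \<in> keys p" using nonzero_key by blast
  show ?thesis
  proof
    assume "homog L p"
    then obtain \<kappa> where \<kappa>: "homd L \<kappa> p" by (auto simp: homog_def)
    have "monom_degree G w \<mu> = monom_degree G w \<nu>" if "\<mu> \<in> keys p" for \<mu>
    proof -
      have "(ivec \<mu> - \<kappa>) - (ivec \<nu> - \<kappa>) \<in> L"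
        using \<kappa> that \<nu> unfolding homd_def by (metis add_subgroup_diff[OF L])
      then show ?thesis by (simp add: degree_eq_iff)
    qed
    then have "p \<in> poly_component G w (monom_degree G w \<nu>)" by (simp add: poly_component_def)
    then show "\<exists>g\<in>carrier G. p \<in> poly_component G w g" using degree_closed by blast
  next
    assume "\<exists>g\<in>carrier G. p \<in> poly_component G w g"
    then have "monom_degree G w \<mu> = monom_degree G w \<nu>" if "\<mu> \<in> keys p" for \<mu>
      using that \<nu> by (auto simp: poly_component_def)
    then have "homd L (ivec \<nu>) p" by (simp add: homd_def degree_eq_iff[symmetric])
    then show "homog L p" by (rule homogI)
  qed
qed

lemma homogeneous_elems_poly: "homogeneous_elems G (poly_component G w) = {p. homog L p}"
  by (auto simp: homogeneous_elems_def homog_iff)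

lemma homogeneous_elems_quot: "homogeneous_elems G (quot_component G w F) = quot_class F ` {p. homog L p}"
  by (auto simp: homogeneous_elems_def quot_component_def homog_iff)

lemma graded_prime_ideal_image:
  assumes J: "gprime L F J"
  shows "graded_prime_ideal G (quot_ring F) (quot_component G w F) (quot_class F ` J)"
proof -
  interpret cring "quot_ring F" by (rule cring_quot_ring)
  have J': "cideal J" "F \<in> J" "hcomp_closed L J" "1 \<notin> J"
    "\<And>p q. homog L p \<Longrightarrow> homog L q \<Longrightarrow> p * q \<in> J \<Longrightarrow> p \<in> J \<or> q \<in> J"
    using J by (auto simp: gprime_def hprime_def)
  note mem = quot_class_in_image[OF J'(1,2)]
  let ?I = "quot_class F ` J" and ?H = "homogeneous_elems G (quot_component G w F)"
  have ideal: "ideal ?I (quot_ring F)" by (rule ideal_quot_image[OF J'(1,2)])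
  have "?I = Idl\<^bsub>quot_ring F\<^esub> (?I \<inter> ?H)"
  proof
    show "Idl\<^bsub>quot_ring F\<^esub> (?I \<inter> ?H) \<subseteq> ?I" by (rule genideal_minimal[OF ideal]) blast
    have sub: "?I \<inter> ?H \<subseteq> carrier (quot_ring F)" by auto
    note I2 = ideal_quot_preimage[OF genideal_ideal[OF sub]]
    show "?I \<subseteq> Idl\<^bsub>quot_ring F\<^esub> (?I \<inter> ?H)"
    proof
      fix x assume "x \<in> ?I"
      then obtain p where p: "p \<in> J" "x = quot_class F p" by blast
      obtain S where S: "p = (\<Sum>\<kappa>\<in>S. hcomp L \<kappa> p)" using hcomp_decomposition[OF L] by metis
      have "quot_class F (hcomp L \<kappa> p) \<in> ?I \<inter> ?H" for \<kappa>
        using p(1) J'(3) by (auto simp: hcomp_closed_def homogeneous_elems_quot)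
      then have "hcomp L \<kappa> p \<in> {p. quot_class F p \<in> Idl\<^bsub>quot_ring F\<^esub> (?I \<inter> ?H)}" for \<kappa>
        using genideal_self[OF sub] by blast
      then have "(\<Sum>\<kappa>\<in>S. hcomp L \<kappa> p) \<in> {p. quot_class F p \<in> Idl\<^bsub>quot_ring F\<^esub> (?I \<inter> ?H)}"
        by (intro cideal_sum[OF I2(1)])
      then show "x \<in> Idl\<^bsub>quot_ring F\<^esub> (?I \<inter> ?H)" using S p(2) by simp
    qed
  qed
  then have "homogeneous_ideal G (quot_ring F) (quot_component G w F) ?I"
    using ideal by (simp add: homogeneous_ideal_def)
  moreover have "?I \<noteq> carrier (quot_ring F)" using mem[of 1] J'(4) by auto
  moreover have "x \<in> ?I \<or> y \<in> ?I" if "x \<in> ?H" "y \<in> ?H" "x \<otimes>\<^bsub>quot_ring F\<^esub> y \<in> ?I" for x y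
  proof -
    obtain p q where "homog L p" "homog L q" "x = quot_class F p" "y = quot_class F q"
      using \<open>x \<in> ?H\<close> \<open>y \<in> ?H\<close> by (auto simp: homogeneous_elems_quot)
    then show ?thesis using that(3) J'(5) mem by simp
  qed
  ultimately show ?thesis by (auto simp: graded_prime_ideal_def)
qed

text \<open>Generation by homogeneous elements is turned into closure under components: the homogeneous
  core of the preimage has an image that contains all homogeneous elements of \<open>I\<close>, hence \<open>I\<close>.\<close>

lemma graded_prime_ideal_preimage:
  assumes I: "graded_prime_ideal G (quot_ring F) (quot_component G w F) I" and F: "homog L F"
  shows "gprime L F {p. quot_class F p \<in> I}" "I = quot_class F ` {p. quot_class F p \<in> I}"
proof -
  interpret cring "quot_ring F" by (rule cring_quot_ring)
  let ?H = "homogeneous_elems G (quot_component G w F)" and ?J = "{p. quot_class F p \<in> I}"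
  have ideal: "ideal I (quot_ring F)" and gen: "I = Idl\<^bsub>quot_ring F\<^esub> (I \<inter> ?H)" and ne: "I \<noteq> carrier (quot_ring F)"
    and pr: "\<And>x y. x \<in> ?H \<Longrightarrow> y \<in> ?H \<Longrightarrow> x \<otimes>\<^bsub>quot_ring F\<^esub> y \<in> I \<Longrightarrow> x \<in> I \<or> y \<in> I"
    using I by (auto simp: graded_prime_ideal_def homogeneous_ideal_def)
  note J = ideal_quot_preimage[OF ideal]
  show "I = quot_class F ` ?J" by (rule J(3))
  define K where "K = {p. \<forall>\<kappa>. hcomp L \<kappa> p \<in> ?J}"
  have K: "cideal K" unfolding K_def by (rule cideal_homogeneous_core[OF L J(1)])
  have FK: "F \<in> K"
    unfolding K_def mem_Collect_eq
  proof
    fix \<kappa>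
    have "F dvd hcomp L \<kappa> F" using hcomp_closed_multiples[OF L F] by (auto simp: hcomp_closed_def)
    then show "quot_class F (hcomp L \<kappa> F) \<in> I" using cideal_dvd[OF J(1,2)] by blast
  qed
  have "I \<inter> ?H \<subseteq> quot_class F ` K"
  proof
    fix x assume x: "x \<in> I \<inter> ?H"
    then obtain p where p: "x = quot_class F p" "homog L p" by (auto simp: homogeneous_elems_quot)
    then obtain \<kappa> where \<kappa>: "homd L \<kappa> p" by (auto simp: homog_def)
    have "hcomp L \<rho> p = p \<or> hcomp L \<rho> p = 0" for \<rho>
      using hcomp_homd_other[OF L \<kappa>] hcomp_homd[OF homd_cong[OF L \<kappa>]] by blast
    then have "hcomp L \<rho> p \<in> ?J" for \<rho>
      using x p(1) cideal_0[OF J(1)] by (metis IntD1 mem_Collect_eq)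
    then show "x \<in> quot_class F ` K" using p(1) by (auto simp: K_def)
  qed
  from genideal_minimal[OF ideal_quot_image[OF K FK] this]
  have "I \<subseteq> quot_class F ` K" using gen by simp
  then have JK: "?J \<subseteq> K" using quot_class_in_image[OF K FK] by blast
  have "hcomp_closed L ?J" unfolding hcomp_closed_def using JK by (auto simp: K_def)
  moreover have "1 \<notin> ?J" using ne ideal.one_imp_carrier[OF ideal] by auto
  moreover have "p \<in> ?J \<or> q \<in> ?J" if "homog L p" "homog L q" "p * q \<in> ?J" for p q
    using pr[of "quot_class F p" "quot_class F q"] that by (auto simp: homogeneous_elems_quot)
  ultimately show "gprime L F ?J" using J by (simp add: gprime_def hprime_def)
qed

lemma gprime_multiples:
  assumes "homog L F" "prime_mod F"
  shows "gprime L F {p. F dvd p}"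
  using assms hcomp_closed_multiples[OF L] cideal_multiples
  by (auto simp: gprime_def hprime_def prime_mod_def)

text \<open>The chain from the zero ideal shows that the height is at least 1. In a chain of length 2 the
  middle ideal would be nonzero and smaller than \<open>J\<close>.\<close>

lemma minprime_height:
  assumes F: "homog L F" "prime_mod F" and J: "minprime L F J"
  shows "graded_height G (quot_ring F) (quot_component G w F) (quot_class F ` J) = 1"
proof -
  let ?gp = "graded_prime_ideal G (quot_ring F) (quot_component G w F)" and ?I = "quot_class F ` J"
  have g: "gprime L F J" using J by (simp add: minprime_def)
  have J': "cideal J" "F \<in> J" using g by (auto simp: gprime_def)
  let ?D = "{enat d | d. \<exists>C. (\<forall>i\<le>d. ?gp (C i)) \<and> (\<forall>i<d. C i \<subset> C (Suc i)) \<and> C d = ?I}"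
  have "d \<le> 1" if C: "\<forall>i\<le>d. ?gp (C i)" "\<forall>i<d. C i \<subset> C (Suc i)" "C d = ?I" for d C
  proof (rule ccontr)
    assume "\<not> d \<le> 1"
    then obtain e where d: "d = Suc (Suc e)" by (metis One_nat_def not_less_eq_eq not0_implies_Suc le0 Suc_le_mono le_SucE)
    let ?P = "\<lambda>i. {p. quot_class F p \<in> C i}"
    have P: "gprime L F (?P e)" "gprime L F (?P (Suc e))"
      and CP: "C e = quot_class F ` ?P e" "C (Suc e) = quot_class F ` ?P (Suc e)"
      using graded_prime_ideal_preimage[OF _ F(1)] C(1) d by auto
    have lt: "C e \<subset> C (Suc e)" "C (Suc e) \<subset> ?I" using C(2,3) d by auto
    obtain x where "x \<in> C (Suc e)" "x \<notin> C e" using lt(1) by blast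
    then have "x \<in> quot_class F ` ?P (Suc e)" using CP(2) by simp
    then obtain p where "x = quot_class F p" "p \<in> ?P (Suc e)" by (rule imageE)
    then have p: "p \<in> ?P (Suc e)" "p \<notin> ?P e" using \<open>x \<notin> C e\<close> by simp_all
    then have "\<not> F dvd p" using P(1) cideal_dvd by (auto simp: gprime_def)
    moreover have "?P (Suc e) \<subseteq> J" using lt(2) quot_class_in_image[OF J'] by blast
    ultimately have "?P (Suc e) = J" using J P(2) p(1) unfolding minprime_def by blast
    then show False using lt(2) CP(2) by simp
  qed
  then have le: "x \<le> 1" if "x \<in> ?D" for x using that by (auto simp: one_enat_def)
  have "1 \<in> ?D"
  proof -
    let ?C = "\<lambda>i::nat. if i = 0 then quot_class F ` {p. F dvd p} else ?I"
    obtain p where p: "p \<in> J" "\<not> F dvd p" using J by (auto simp: minprime_def)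
    have "quot_class F ` {p. F dvd p} \<subset> ?I"
    proof
      show "quot_class F ` {p. F dvd p} \<subseteq> ?I" using cideal_dvd[OF J'] by blast
      show "quot_class F ` {p. F dvd p} \<noteq> ?I"
        using p quot_class_in_multiples[of F p] by (metis imageI)
    qed
    then have "(\<forall>i\<le>1. ?gp (?C i)) \<and> (\<forall>i<1. ?C i \<subset> ?C (Suc i)) \<and> ?C 1 = ?I"
      using graded_prime_ideal_image[OF gprime_multiples[OF F]] graded_prime_ideal_image[OF g] by simp
    from exI[of "\<lambda>C. (\<forall>i\<le>1. ?gp (C i)) \<and> (\<forall>i<1. C i \<subset> C (Suc i)) \<and> C 1 = ?I", OF this]
    show ?thesis unfolding one_enat_def by (intro CollectI exI[of _ 1] conjI refl)
  qed
  then have "Sup ?D = 1" using le by (intro antisym Sup_least Sup_upper)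
  then show ?thesis by (simp add: graded_height_def)
qed

text \<open>If \<open>I\<close> were 0, only the trivial chain would end in it; a nonzero homogeneous prime strictly
  inside \<open>I\<close> would give a chain of length 2 starting with the zero ideal.\<close>

lemma height_one_minprime:
  assumes F: "homog L F" "prime_mod F"
    and I: "graded_prime_ideal G (quot_ring F) (quot_component G w F) I"
      "graded_height G (quot_ring F) (quot_component G w F) I = 1"
  shows "minprime L F {p. quot_class F p \<in> I}"
proof -
  let ?gp = "graded_prime_ideal G (quot_ring F) (quot_component G w F)"
  let ?J = "{p. quot_class F p \<in> I}"
  let ?D = "{enat d | d. \<exists>C. (\<forall>i\<le>d. ?gp (C i)) \<and> (\<forall>i<d. C i \<subset> C (Suc i)) \<and> C d = I}"
  note g = graded_prime_ideal_preimage[OF I(1) F(1)]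
  have J: "cideal ?J" "F \<in> ?J" using g(1) by (auto simp: gprime_def)
  have Sup: "Sup ?D = 1" using I(2) by (simp add: graded_height_def)
  note zero = gprime_multiples[OF F]
  show ?thesis
    unfolding minprime_def
  proof (intro conjI allI impI)
    show "gprime L F ?J" by (rule g)
    show "\<exists>p\<in>?J. \<not> F dvd p"
    proof (rule ccontr)
      assume *: "\<not> (\<exists>p\<in>?J. \<not> F dvd p)"
      have "d = 0" if C: "\<forall>i\<le>d. ?gp (C i)" "\<forall>i<d. C i \<subset> C (Suc i)" "C d = I" for d C
      proof (rule ccontr)
        assume "d \<noteq> 0"
        then obtain e where d: "d = Suc e" by (metis not0_implies_Suc)
        have gp: "?gp (C e)" "C e \<subset> I" using C d by auto
        note P = graded_prime_ideal_preimage[OF gp(1) F(1)]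
        have "?J \<subseteq> {p. quot_class F p \<in> C e}"
          using * P(1) cideal_dvd unfolding gprime_def by blast
        then have "quot_class F ` ?J \<subseteq> quot_class F ` {p. quot_class F p \<in> C e}" by (rule image_mono)
        then have "I \<subseteq> C e" unfolding g(2)[symmetric] P(2)[symmetric] .
        then show False using gp(2) by (metis psubsetE)
      qed
      then have "Sup ?D \<le> 0" by (intro Sup_least) (auto simp: zero_enat_def)
      then show False using Sup by simp
    qed
    fix J' assume J': "gprime L F J'" "J' \<subseteq> ?J" "\<exists>p\<in>J'. \<not> F dvd p"
    show "J' = ?J"
    proof (rule ccontr)
      assume ne: "J' \<noteq> ?J"
      have J'': "cideal J'" "F \<in> J'" using J'(1) by (auto simp: gprime_def)
      let ?C = "\<lambda>i::nat. if i = 0 then quot_class F ` {p. F dvd p} else if i = 1 then quot_class F ` J' else I"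
      have 1: "quot_class F ` {p. F dvd p} \<subset> quot_class F ` J'"
      proof
        show "quot_class F ` {p. F dvd p} \<subseteq> quot_class F ` J'" using cideal_dvd[OF J''] by blast
        obtain p where "p \<in> J'" "\<not> F dvd p" using J'(3) by blast
        then show "quot_class F ` {p. F dvd p} \<noteq> quot_class F ` J'"
          using quot_class_in_multiples[of F p] by (metis imageI)
      qed
      have 2: "quot_class F ` J' \<subset> I"
      proof
        show "quot_class F ` J' \<subseteq> I" using J'(2) by blast
        obtain p where "p \<in> ?J" "p \<notin> J'" using J'(2) ne by blast
        then show "quot_class F ` J' \<noteq> I" using quot_class_in_image[OF J'', of p] by (metis mem_Collect_eq)
      qed
      have "?gp (?C i)" for i
        using graded_prime_ideal_image[OF zero] graded_prime_ideal_image[OF J'(1)] I(1) by simp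
      moreover have "?C i \<subset> ?C (Suc i)" if "i < 2" for i
        using 1 2 that by (auto simp: less_2_cases_iff)
      ultimately have "(\<forall>i\<le>2. ?gp (?C i)) \<and> (\<forall>i<2. ?C i \<subset> ?C (Suc i)) \<and> ?C 2 = I" by simp
      from exI[of "\<lambda>C. (\<forall>i\<le>2. ?gp (C i)) \<and> (\<forall>i<2. C i \<subset> C (Suc i)) \<and> C 2 = I", OF this]
      have "enat 2 \<in> ?D" by (intro CollectI exI[of _ 2] conjI refl)
      then have "enat 2 \<le> Sup ?D" by (rule Sup_upper)
      then show False unfolding Sup by (simp add: one_enat_def)
    qed
  qed
qed

text \<open>The components of the quotient are the images of the components of the polynomial ring; their
  sum is direct because \<open>F\<close> is homogeneous.\<close>

lemma graded_algebra_quot_ring: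
  fixes F :: "('v, 'k::field) mpoly"
  assumes F: "homog L F"
  shows "graded_algebra G (quot_ring F) (quot_const F) (quot_component G w F)"
proof -
  interpret G: comm_group G by (rule comm_group)
  interpret Q: cring "quot_ring F" by (rule cring_quot_ring)
  have gcomp_dvd: "F dvd gcomp g p" if "F dvd p" for g p
    using gcomp_cases[of g p] hcomp_closed_multiples[OF L F] that by (auto simp: hcomp_closed_def)
  have gcomp_diff: "gcomp g (p - q) = gcomp g p - gcomp g q"
    and gcomp_sum: "gcomp g (\<Sum>i\<in>S. f i) = (\<Sum>i\<in>S. gcomp g (f i))" for g S p q and f :: "'g \<Rightarrow> ('v, 'k) mpoly"
    by (simp_all add: gcomp_def part_diff part_sum)
  show ?thesis
    unfolding graded_algebra_def
  proof (intro conjI ballI allI)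
    show "fg_abelian_group G" by (rule fg)
    show "cring (quot_ring F)" by (rule cring_quot_ring)
    show "quot_const F \<in> ring_hom ring_of_type_algebra (quot_ring F)"
      by (rule ring_hom_memI) (simp_all add: ring_of_type_algebra_def quot_const_def Const_mult Const_add)
  next
    fix g assume g: "g \<in> carrier G"
    show "additive_subgroup (quot_component G w F g) (quot_ring F)"
    proof (rule additive_subgroup.intro, rule Q.add.subgroupI)
      show "quot_component G w F g \<subseteq> carrier (quot_ring F)" by (auto simp: quot_component_def)
      have "0 \<in> poly_component G w g" by (simp add: poly_component_def)
      then show "quot_component G w F g \<noteq> {}" by (auto simp: quot_component_def)
      show "\<ominus>\<^bsub>quot_ring F\<^esub> x \<in> quot_component G w F g" if "x \<in> quot_component G w F g" for x
        using that by (auto simp: quot_component_def quot_class_uminus poly_component_def intro!: imageI)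
      show "x \<oplus>\<^bsub>quot_ring F\<^esub> y \<in> quot_component G w F g"
        if "x \<in> quot_component G w F g" "y \<in> quot_component G w F g" for x y
      proof -
        obtain p q where pq: "p \<in> poly_component G w g" "q \<in> poly_component G w g" "x = quot_class F p" "y = quot_class F q"
          using \<open>x \<in> quot_component G w F g\<close> \<open>y \<in> quot_component G w F g\<close> by (auto simp: quot_component_def)
        then have "p + q \<in> poly_component G w g" by (simp add: poly_component_iff gcomp_def part_add)
        then show ?thesis using pq by (auto simp: quot_component_def)
      qed
    qed
    fix c x assume "x \<in> quot_component G w F g"
    then obtain p where p: "p \<in> poly_component G w g" "x = quot_class F p" by (auto simp: quot_component_def)
    have "Const c * p \<in> poly_component G w g"
      using p(1) by (auto simp: poly_component_def in_keys_iff lookup_Const_mult)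
    then show "quot_const F c \<otimes>\<^bsub>quot_ring F\<^esub> x \<in> quot_component G w F g"
      using p(2) by (auto simp: quot_const_def quot_component_def)
  next
    fix g h x y assume gh: "g \<in> carrier G" "h \<in> carrier G"
      and xy: "x \<in> quot_component G w F g" "y \<in> quot_component G w F h"
    obtain p q where pq: "p \<in> poly_component G w g" "q \<in> poly_component G w h" "x = quot_class F p" "y = quot_class F q"
      using xy by (auto simp: quot_component_def)
    have "p * q \<in> poly_component G w (g \<otimes>\<^bsub>G\<^esub> h)"
      using pq by (auto simp: poly_component_def degree_add elim!: keys_multE)
    then show "x \<otimes>\<^bsub>quot_ring F\<^esub> y \<in> quot_component G w F (g \<otimes>\<^bsub>G\<^esub> h)"
      using pq by (auto simp: quot_component_def)
  next
    fix x assume "x \<in> carrier (quot_ring F)"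
    then obtain p where p: "x = quot_class F p" by (rule quot_ringE)
    let ?supp = "\<lambda>c. {g \<in> carrier G. c g \<noteq> \<zero>\<^bsub>quot_ring F\<^esub>}"
    let ?P = "\<lambda>c. c \<in> (\<Pi>\<^sub>E g\<in>carrier G. quot_component G w F g) \<and> finite (?supp c) \<and>
        x = (\<Oplus>\<^bsub>quot_ring F\<^esub>g\<in>?supp c. c g)"
    \<comment> \<open>Homogeneous parts can be read off from any decomposition of \<open>x\<close>.\<close>
    have determined: "c g = quot_class F (gcomp g p)" if c: "?P c" and g: "g \<in> carrier G" for c g
    proof -
      have "\<forall>g\<in>carrier G. \<exists>a. a \<in> poly_component G w g \<and> c g = quot_class F a"
        using c by (auto simp: quot_component_def PiE_iff)
      then obtain a where a: "\<And>g. g \<in> carrier G \<Longrightarrow> a g \<in> poly_component G w g"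
        "\<And>g. g \<in> carrier G \<Longrightarrow> c g = quot_class F (a g)" by metis
      have "x = (\<Oplus>\<^bsub>quot_ring F\<^esub>g\<in>?supp c. c g)" using c by blast
      also have "\<dots> = (\<Oplus>\<^bsub>quot_ring F\<^esub>g\<in>?supp c. quot_class F (a g))"
        by (rule Q.finsum_cong') (use a(2) in auto)
      also have "\<dots> = quot_class F (\<Sum>g\<in>?supp c. a g)" using c by (intro quot_class_finsum) blast
      finally have "F dvd p - (\<Sum>g\<in>?supp c. a g)" using p by (simp add: quot_class_eq_iff)
      from gcomp_dvd[OF this, of g]
      have dvd: "F dvd gcomp g p - gcomp g (\<Sum>g\<in>?supp c. a g)" unfolding gcomp_diff .
      have "gcomp g (\<Sum>g\<in>?supp c. a g) = (\<Sum>h\<in>?supp c. if h = g then a g else 0)"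
        unfolding gcomp_sum
      proof (rule sum.cong[OF refl])
        fix h assume "h \<in> ?supp c"
        then have "a h \<in> poly_component G w h" using a(1) by simp
        then show "gcomp g (a h) = (if h = g then a g else 0)"
          using gcomp_other[of "a h" h g] poly_component_iff[of "a h" h] by auto
      qed
      also have "\<dots> = (if c g \<noteq> \<zero>\<^bsub>quot_ring F\<^esub> then a g else 0)" using c g by simp
      finally have "quot_class F (gcomp g p) = quot_class F (if c g \<noteq> \<zero>\<^bsub>quot_ring F\<^esub> then a g else 0)"
        using dvd by (simp add: quot_class_eq_iff)
      then show ?thesis using a(2)[OF g] by (auto split: if_splits)
    qed
    show "\<exists>!c. ?P c"
    proof (rule ex_ex1I)
      let ?c = "\<lambda>g\<in>carrier G. quot_class F (gcomp g p)"
      have sub: "?supp ?c \<subseteq> monom_degree G w ` keys p"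
      proof
        fix g assume "g \<in> ?supp ?c"
        then have "gcomp g p \<noteq> 0" by auto
        then obtain \<mu> where "\<mu> \<in> keys (gcomp g p)" using nonzero_key by blast
        then show "g \<in> monom_degree G w ` keys p" by (auto simp: gcomp_def keys_part)
      qed
      have fin: "finite (?supp ?c)" by (rule finite_subset[OF sub]) simp
      have "p = (\<Sum>g\<in>monom_degree G w ` keys p. gcomp g p)"
        unfolding gcomp_def by (rule part_fibres) auto
      then have "x = quot_class F (\<Sum>g\<in>monom_degree G w ` keys p. gcomp g p)" using p by simp
      also have "\<dots> = (\<Oplus>\<^bsub>quot_ring F\<^esub>g\<in>monom_degree G w ` keys p. quot_class F (gcomp g p))"
        by (rule quot_class_finsum[symmetric]) simp
      also have "\<dots> = (\<Oplus>\<^bsub>quot_ring F\<^esub>g\<in>?supp ?c. ?c g)"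
        using sub degree_closed
        by (intro Q.add.finprod_mono_neutral_cong_right) auto
      finally show "\<exists>c. ?P c"
        using fin by (intro exI[of _ ?c]) (auto simp: quot_component_def gcomp_in_component)
      fix c c' assume c: "?P c" and c': "?P c'"
      have "c g = c' g" if "g \<in> carrier G" for g
        using determined[OF c that] determined[OF c' that] by simp
      then show "c = c'" by (rule PiE_ext[OF conjunct1[OF c] conjunct1[OF c']])
    qed
  qed
qed

theorem factorially_graded_iff:
  fixes F :: "('v, 'k::field) mpoly"
  assumes F: "homog L F"
  shows "factorially_graded G (quot_ring F) (quot_const F) (quot_component G w F) \<longleftrightarrow> gfactorial L F"
proof
  assume fact: "factorially_graded G (quot_ring F) (quot_const F) (quot_component G w F)"
  then have pm: "prime_mod F" and cu: "const_units F"
    by (auto simp: factorially_graded_def domain_quot_ring_iff Units_quot_ring_const_iff)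
  have "\<exists>i. J = pid F i" if J: "minprime L F J" for J
  proof -
    have g: "gprime L F J" using J by (simp add: minprime_def)
    then have J': "cideal J" "F \<in> J" by (auto simp: gprime_def)
    have "principalideal (quot_class F ` J) (quot_ring F)"
      using fact graded_prime_ideal_image[OF g] minprime_height[OF F pm J] by (auto simp: factorially_graded_def)
    then show ?thesis using principalideal_quot_image_iff[OF J'] by simp
  qed
  then show "gfactorial L F" using pm cu by (simp add: gfactorial_def)
next
  assume fact: "gfactorial L F"
  then have pm: "prime_mod F" and cu: "const_units F" by (auto simp: gfactorial_def)
  have "principalideal I (quot_ring F)"
    if I: "graded_prime_ideal G (quot_ring F) (quot_component G w F) I"
      "graded_height G (quot_ring F) (quot_component G w F) I = 1" for I
  proof -
    let ?J = "{p. quot_class F p \<in> I}"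
    have "\<exists>i. ?J = pid F i"
      using fact height_one_minprime[OF F pm I] by (simp add: gfactorial_def)
    moreover have J': "cideal ?J" "F \<in> ?J"
      using graded_prime_ideal_preimage(1)[OF I(1) F] by (auto simp: gprime_def)
    ultimately have "principalideal (quot_class F ` ?J) (quot_ring F)"
      using principalideal_quot_image_iff[OF J'] by simp
    then show ?thesis using graded_prime_ideal_preimage(2)[OF I(1) F] by simp
  qed
  then show "factorially_graded G (quot_ring F) (quot_const F) (quot_component G w F)"
    using graded_algebra_quot_ring[OF F] pm cu
    by (auto simp: factorially_graded_def domain_quot_ring_iff Units_quot_ring_const_iff)
qed

end

section \<open>Factoriality of the quotient ring\<close>

text \<open>Existence of factorizations is the hypothesis, as prime elements are irreducible. Uniqueness
  follows since a factorization of an irreducible element has a single prime factor, so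
  irreducible elements are prime.\<close>

theorem factorial_domain_quot_ring:
  fixes F :: "('v::finite, 'k::field) mpoly"
  assumes F: "prime_mod F" and fac: "\<And>x. \<not> F dvd x \<Longrightarrow> hfac UNIV F x"
  shows "factorial_domain (quot_ring F)"
proof -
  interpret domain "quot_ring F" using F by (simp add: domain_quot_ring_iff)
  let ?M = "mult_of (quot_ring F)"
  have units: "Units ?M = Units (quot_ring F)" by simp
  have carr: "quot_class F x \<in> carrier ?M \<longleftrightarrow> \<not> F dvd x" for x
    by (simp add: quot_class_eq_iff)
  have repr: "\<exists>y. a = quot_class F y \<and> \<not> F dvd y" if a: "a \<in> carrier ?M" for a
  proof -
    have "a \<in> carrier (quot_ring F)" using a by simp
    then obtain y where "a = quot_class F y" by (rule quot_ringE)
    then show ?thesis using a carr[of y] by blast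
  qed
  have prime: "Divisibility.prime ?M (quot_class F p)" if p: "hprime_elem UNIV F p" for p
  proof -
    have p': "\<not> F dvd p" "1 \<notin> pid F p" "\<And>x y. x * y \<in> pid F p \<Longrightarrow> x \<in> pid F p \<or> y \<in> pid F p"
      using p by (auto simp: hprime_elem_def hprime_def)
    have "Divisibility.prime (quot_ring F) (quot_class F p)"
      unfolding Divisibility.prime_def
    proof (intro conjI ballI impI)
      show "quot_class F p \<notin> Units (quot_ring F)"
      proof
        assume "quot_class F p \<in> Units (quot_ring F)"
        then obtain q where "F dvd p * q - 1" using Units_quot_ring by blast
        then have "F dvd 1 - p * q" by (metis dvd_minus_iff minus_diff_eq)
        then show False using p'(2) pid_memI by blast
      qed
      fix x y assume xy: "x \<in> carrier (quot_ring F)" "y \<in> carrier (quot_ring F)"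
        "quot_class F p divides\<^bsub>quot_ring F\<^esub> x \<otimes>\<^bsub>quot_ring F\<^esub> y"
      obtain r s where rs: "x = quot_class F r" "y = quot_class F s" using xy(1,2) by (metis quot_ringE)
      then have "r * s \<in> pid F p" using xy(3) by (simp add: divides_quot_ring)
      then show "quot_class F p divides\<^bsub>quot_ring F\<^esub> x \<or> quot_class F p divides\<^bsub>quot_ring F\<^esub> y"
        unfolding rs divides_quot_ring by (rule p'(3))
    qed
    then show ?thesis using prime_eq_prime_mult[of "quot_class F p"] p'(1) by (simp add: quot_class_eq_iff)
  qed
  have wf: "\<exists>fs. set fs \<subseteq> carrier ?M \<and> wfactors ?M fs (quot_class F x)" if "hfac UNIV F x" "\<not> F dvd x" for x
    using that
  proof (induction rule: hfac.induct)
    case (unit u v)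
    then have "quot_class F u \<in> Units ?M" using Units_quot_ring units by blast
    then show ?case using mult_of.unit_wfactors by (intro exI[of _ "[]"]) auto
  next
    case (mult x p y)
    have y: "quot_class F y = quot_class F p \<otimes>\<^bsub>quot_ring F\<^esub> quot_class F x"
      using mult.hyps by (simp add: quot_class_eq_iff mult.commute)
    have p: "\<not> F dvd p" using mult.hyps by (simp add: hprime_elem_def)
    have "F dvd y - x * p" by (rule mult.hyps)
    then have x: "\<not> F dvd x"
      using mult.prems cideal_diff_iff[OF cideal_multiples, of y "x * p" F] by auto
    obtain fs where fs: "set fs \<subseteq> carrier ?M" "wfactors ?M fs (quot_class F x)" using mult.IH[OF x] by blast
    have "irreducible ?M (quot_class F p)"
      using mult_of.prime_irreducible[OF prime[OF mult.hyps(2)]] .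
    from mult_of.wfactors_mult_single[OF this fs(2)]
    have "wfactors ?M (quot_class F p # fs) (quot_class F p \<otimes>\<^bsub>quot_ring F\<^esub> quot_class F x)"
      using fs(1) p x carr by blast
    then show ?case using fs(1) p carr y by (intro exI[of _ "quot_class F p # fs"]) auto
  qed
  have pc: "primeness_condition_monoid ?M"
  proof
    fix a assume a: "a \<in> carrier ?M" "irreducible ?M a"
    then obtain y where y: "a = quot_class F y" "\<not> F dvd y" using repr by metis
    from fac[OF y(2)] show "Divisibility.prime ?M a"
    proof cases
      case (unit v)
      then have "a \<in> Units ?M" using Units_quot_ring units y(1) by blast
      then show ?thesis using a(2) by (simp add: irreducible_def)
    next
      case (mult x p)
      have eq: "a = quot_class F p \<otimes>\<^bsub>?M\<^esub> quot_class F x"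
        using mult y(1) by (simp add: quot_class_eq_iff mult.commute)
      have p: "\<not> F dvd p" using mult by (simp add: hprime_elem_def)
      have x: "\<not> F dvd x"
        using mult(4) y(2) cideal_diff_iff[OF cideal_multiples, of y "x * p" F] by auto
      have pr: "Divisibility.prime ?M (quot_class F p)" using prime mult by blast
      have dv: "quot_class F p divides\<^bsub>?M\<^esub> a" unfolding factor_def using eq x carr by blast
      have "a divides\<^bsub>?M\<^esub> quot_class F p"
        using a(2) dv p carr pr unfolding irreducible_def properfactor_def Divisibility.prime_def by blast
      then have "quot_class F p \<sim>\<^bsub>?M\<^esub> a" using dv by (simp add: associated_def)
      then show ?thesis using mult_of.prime_cong[OF pr] p carr a(1) by blast
    qed
  qed
  have "factorial_monoid ?M"
  proof (rule mult_of.factorial_monoidI)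
    fix a assume "a \<in> carrier ?M" "a \<notin> Units ?M"
    then obtain y where y: "a = quot_class F y" "\<not> F dvd y" using repr by metis
    then show "\<exists>fs. set fs \<subseteq> carrier ?M \<and> wfactors ?M fs a" using wf fac by blast
  qed (rule primeness_condition_monoid.wfactors_unique[OF pc])
  then show ?thesis unfolding factorial_domain_def using domain_axioms by blast
qed

section \<open>The lattices of the Cox construction\<close>

lemma add_subgroup_cox: "add_subgroup (range (cox_dual_map v))"
  unfolding add_subgroup_def
proof (intro conjI ballI)
  have "cox_dual_map v 0 = 0" by (simp add: cox_dual_map_def pairing_def vec_eq_iff)
  then show "0 \<in> range (cox_dual_map v)" by (metis rangeI)
  fix x y assume "x \<in> range (cox_dual_map v)" "y \<in> range (cox_dual_map v)"
  then obtain s t where st: "x = cox_dual_map v s" "y = cox_dual_map v t" by blast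
  have "x - y = cox_dual_map v (s - t)"
    unfolding st by (simp add: cox_dual_map_def pairing_def vec_eq_iff algebra_simps sum_subtractf)
  then show "x - y \<in> range (cox_dual_map v)" by simp
qed

lemma comm_group_additive_group: "comm_group (additive_group :: 'a::ab_group_add monoid)"
proof (rule comm_groupI)
  fix x :: 'a
  show "\<exists>y\<in>carrier additive_group. y \<otimes>\<^bsub>additive_group\<^esub> x = \<one>\<^bsub>additive_group\<^esub>"
    by (rule bexI[of _ "- x"]) (simp_all add: additive_group_def)
qed (simp_all add: additive_group_def add.assoc add.commute)

lemma normal_additive_group:
  assumes "add_subgroup (L :: 'a::ab_group_add set)"
  shows "L \<lhd> additive_group"
proof -
  interpret comm_group "additive_group :: 'a monoid" by (rule comm_group_additive_group)
  have inv: "inv\<^bsub>additive_group\<^esub> x = - x" for x :: 'a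
    by (rule inv_equality) (simp_all add: additive_group_def)
  have "subgroup L additive_group"
  proof (rule subgroupI)
    show "L \<subseteq> carrier additive_group" by (simp add: additive_group_def)
    show "L \<noteq> {}" using add_subgroup_0[OF assms] by blast
    show "inv\<^bsub>additive_group\<^esub> x \<in> L" if "x \<in> L" for x
      unfolding inv by (rule add_subgroup_uminus[OF assms that])
    show "x \<otimes>\<^bsub>additive_group\<^esub> y \<in> L" if "x \<in> L" "y \<in> L" for x y
      using add_subgroup_add[OF assms that] by (simp add: additive_group_def)
  qed
  then show ?thesis by (rule subgroup_imp_normal)
qed

lemma additive_coset_eq_iff:
  assumes "add_subgroup (L :: 'a::ab_group_add set)"
  shows "L #>\<^bsub>additive_group\<^esub> x = L #>\<^bsub>additive_group\<^esub> y \<longleftrightarrow> x - y \<in> L"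
proof -
  have mem: "z \<in> L #>\<^bsub>additive_group\<^esub> x \<longleftrightarrow> z - x \<in> L" for x z
  proof
    assume "z - x \<in> L"
    then show "z \<in> L #>\<^bsub>additive_group\<^esub> x"
      by (auto simp: r_coset_def additive_group_def intro!: bexI[of _ "z - x"])
  qed (auto simp: r_coset_def additive_group_def)
  show ?thesis
  proof
    assume "L #>\<^bsub>additive_group\<^esub> x = L #>\<^bsub>additive_group\<^esub> y"
    then show "x - y \<in> L" using mem[of x x] mem[of x y] add_subgroup_0[OF assms] by simp
  next
    assume "x - y \<in> L"
    then have "z - x \<in> L \<longleftrightarrow> z - y \<in> L" for z
      using add_subgroup_diff_iff[OF assms, of "z - y" "z - x"] by simp
    then show "L #>\<^bsub>additive_group\<^esub> x = L #>\<^bsub>additive_group\<^esub> y"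
      using mem by (intro equalityI subsetI) simp_all
  qed
qed

text \<open>The projection of the lattice of exponents to \<open>G\<close>.\<close>

lemma cokernel_degree_map:
  fixes L :: "(int^'r::finite) set" and G :: "'g monoid"
  assumes L: "add_subgroup L" and fg: "fg_abelian_group G"
    and \<phi>: "\<phi> \<in> iso (additive_group Mod L) G"
    and w: "\<And>i. \<phi> (L #>\<^bsub>additive_group\<^esub> axis i 1) = w i"
  obtains h where "\<And>x. h x \<in> carrier G" "\<And>x y. h (x + y) = h x \<otimes>\<^bsub>G\<^esub> h y"
    "\<And>i. h (axis i 1) = w i" "\<And>x y. h x = h y \<longleftrightarrow> x - y \<in> L"
proof -
  interpret N: normal L "additive_group :: (int^'r) monoid" by (rule normal_additive_group[OF L])
  define h where "h x = \<phi> (L #>\<^bsub>additive_group\<^esub> x)" for x :: "int^'r"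
  have hom: "\<phi> \<in> Group.hom (additive_group Mod L) G" and bij: "bij_betw \<phi> (carrier (additive_group Mod L)) (carrier G)"
    using \<phi> by (auto simp: iso_def)
  have coset: "L #>\<^bsub>additive_group\<^esub> x \<in> carrier (additive_group Mod L)" for x :: "int^'r"
    by (auto simp: FactGroup_def RCOSETS_def additive_group_def)
  show ?thesis
  proof (rule that[of h])
    show "h x \<in> carrier G" for x unfolding h_def using hom coset by (rule hom_in_carrier)
    show "h (x + y) = h x \<otimes>\<^bsub>G\<^esub> h y" for x y
    proof -
      have "(L #>\<^bsub>additive_group\<^esub> x) \<otimes>\<^bsub>additive_group Mod L\<^esub> (L #>\<^bsub>additive_group\<^esub> y) =
          L #>\<^bsub>additive_group\<^esub> (x + y)"
        using N.rcos_sum[of x y] by (simp add: FactGroup_def additive_group_def)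
      then show ?thesis unfolding h_def using hom_mult[OF hom coset coset, of x y] by simp
    qed
    show "h (axis i 1) = w i" for i by (simp add: h_def w)
    show "h x = h y \<longleftrightarrow> x - y \<in> L" for x y
      unfolding h_def additive_coset_eq_iff[OF L, symmetric]
      using inj_on_eq_iff[OF bij_betw_imp_inj_on[OF bij] coset coset] .
  qed
qed

lemma degree_map_ivec:
  assumes G: "comm_group G" and h: "\<And>x. h x \<in> carrier G" "\<And>x y. h (x + y) = h x \<otimes>\<^bsub>G\<^esub> h y"
  shows "h (ivec \<mu>) = monom_degree G (\<lambda>i. h (axis i 1)) \<mu>"
proof -
  interpret comm_group G by (rule G)
  have h0: "h 0 = \<one>\<^bsub>G\<^esub>" using h(2)[of 0 0] h(1)[of 0] by (simp add: l_cancel_one')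
  have pow: "h (int n *s x) = h x [^]\<^bsub>G\<^esub> n" for n x
  proof (induction n)
    case (Suc n)
    have "int (Suc n) *s x = int n *s x + x" by (simp add: vec_eq_iff algebra_simps)
    then show ?case using Suc h by simp
  qed (simp add: h0)
  have sum: "h (\<Sum>i\<in>S. int (n i) *s axis i 1) = (\<Otimes>\<^bsub>G\<^esub>i\<in>S. h (axis i 1) [^]\<^bsub>G\<^esub> n i)" if "finite S" for S n
    using that by induction (simp_all add: h0 h pow)
  have "ivec \<mu> = (\<Sum>i\<in>keys \<mu>. int (lookup \<mu> i) *s axis i 1)"
    by (auto simp: vec_eq_iff axis_def in_keys_iff if_distrib cong: if_cong)
  then show ?thesis using sum[of "keys \<mu>" "lookup \<mu>"] by (simp add: monom_degree_def)
qed

text \<open>The degrees of the variables are the classes of the basis vectors in the cokernel, so two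
  monomials have the same degree iff their exponents differ by an element of the image of the
  dual lattice.\<close>

lemma toric_cox_lattice_graded:
  fixes G :: "'g monoid"
  assumes "toric_cox_data \<Sigma> v G w"
  shows "lattice_graded G w (range (cox_dual_map v))"
proof -
  have fg: "fg_abelian_group G" using assms by (simp add: toric_cox_data_def)
  then have G: "comm_group G" by (simp add: fg_abelian_group_def)
  obtain \<phi> where \<phi>: "\<phi> \<in> iso (additive_group Mod range (cox_dual_map v)) G"
    "\<And>i. \<phi> (range (cox_dual_map v) #>\<^bsub>additive_group\<^esub> axis i 1) = w i"
    using assms by (auto simp: toric_cox_data_def)
  obtain h where h: "\<And>x. h x \<in> carrier G" "\<And>x y. h (x + y) = h x \<otimes>\<^bsub>G\<^esub> h y"
    "\<And>i. h (axis i 1) = w i" "\<And>x y. h x = h y \<longleftrightarrow> x - y \<in> range (cox_dual_map v)"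
    using cokernel_degree_map[OF add_subgroup_cox fg \<phi>] by blast
  have deg: "monom_degree G w \<mu> = h (ivec \<mu>)" for \<mu>
    using degree_map_ivec[OF G h(1,2), of \<mu>] h(3) by simp
  show ?thesis
  proof
    show "fg_abelian_group G" by (rule fg)
    show "w i \<in> carrier G" for i using h(1)[of "axis i 1"] h(3) by simp
    show "add_subgroup (range (cox_dual_map v))" by (rule add_subgroup_cox)
    show "monom_degree G w \<mu> = monom_degree G w \<nu> \<longleftrightarrow> ivec \<mu> - ivec \<nu> \<in> range (cox_dual_map v)" for \<mu> \<nu>
      unfolding deg by (rule h(4))
  qed
qed

lemma torsion_free_saturated:
  fixes G :: "'g monoid"
  assumes data: "toric_cox_data \<Sigma> v G w" and tf: "torsion_free_group G"
    and x: "int n *s x \<in> range (cox_dual_map v)" "n > 0"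
  shows "x \<in> range (cox_dual_map v)"
proof -
  have fg: "fg_abelian_group G" using data by (simp add: toric_cox_data_def)
  interpret comm_group G using fg by (simp add: fg_abelian_group_def)
  obtain \<phi> where \<phi>: "\<phi> \<in> iso (additive_group Mod range (cox_dual_map v)) G"
    "\<And>i. \<phi> (range (cox_dual_map v) #>\<^bsub>additive_group\<^esub> axis i 1) = w i"
    using data by (auto simp: toric_cox_data_def)
  obtain h where h: "\<And>x. h x \<in> carrier G" "\<And>x y. h (x + y) = h x \<otimes>\<^bsub>G\<^esub> h y"
    "\<And>i. h (axis i 1) = w i" "\<And>x y. h x = h y \<longleftrightarrow> x - y \<in> range (cox_dual_map v)"
    using cokernel_degree_map[OF add_subgroup_cox fg \<phi>] by blast
  have h0: "h 0 = \<one>\<^bsub>G\<^esub>" using h(2)[of 0 0] h(1)[of 0] by (simp add: l_cancel_one')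
  have pow: "h (int n *s x) = h x [^]\<^bsub>G\<^esub> n" for n
  proof (induction n)
    case (Suc n)
    have "int (Suc n) *s x = int n *s x + x" by (simp add: vec_eq_iff algebra_simps)
    then show ?case using Suc h by simp
  qed (simp add: h0)
  have "h (int n *s x) = h 0" using h(4)[of "int n *s x" 0] x(1) by simp
  then have "h x [^]\<^bsub>G\<^esub> n = \<one>\<^bsub>G\<^esub>" using pow h0 by simp
  then have "h x = h 0" using tf h(1) x(2) h0 by (auto simp: torsion_free_group_def)
  then show ?thesis using h(4)[of x 0] by simp
qed

lemma pairing_scale: "pairing u (k *s x) = k * pairing u x"
  by (simp add: pairing_def sum_distrib_left algebra_simps)

lemma pairing_sum: "pairing u (\<Sum>i\<in>S. f i) = (\<Sum>i\<in>S. pairing u (f i))"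
  by (induction S rule: infinite_finite_induct) (simp_all add: pairing_add)

lemma pairing_rat_vec: "pairing (rat_vec u) (rat_vec x) = of_int (pairing u x)"
  by (simp add: pairing_def rat_vec_def)

text \<open>A functional that vanishes on a spanning set is 0.\<close>

lemma cox_dual_map_injective:
  assumes span: "vec.span (range (\<lambda>i. rat_vec (v i))) = UNIV" and u: "cox_dual_map v u = 0"
  shows "u = 0"
proof -
  have "pairing u (v i) = 0" for i using u by (simp add: cox_dual_map_def vec_eq_iff)
  then have "range (\<lambda>i. rat_vec (v i)) \<subseteq> {x. pairing (rat_vec u) x = 0}"
    by (auto simp: pairing_rat_vec)
  moreover have "vec.subspace {x. pairing (rat_vec u) x = 0}"
    by (auto simp: vec.subspace_def pairing_add pairing_scale)
  ultimately have "vec.span (range (\<lambda>i. rat_vec (v i))) \<subseteq> {x. pairing (rat_vec u) x = 0}"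
    by (rule vec.span_minimal)
  then have "pairing (rat_vec u) (rat_vec u) = 0" using span by blast
  then have "pairing u u = 0" unfolding pairing_rat_vec by (simp only: of_int_eq_0_iff)
  then have "(\<Sum>i\<in>UNIV. u $ i * u $ i) = 0" by (simp only: pairing_def)
  then have "\<forall>i. u $ i * u $ i = 0" by (subst (asm) sum_nonneg_eq_0_iff) auto
  then show ?thesis by (simp add: vec_eq_iff)
qed

lemma proj_cox_dual_map: "proj (cox_dual_map (case_option z v) u) = cox_dual_map v u"
  by (simp add: vec_eq_iff cox_dual_map_def)

text \<open>The projection forgets the value at the additional ray, which is determined by the values at
  the others because they span.\<close>

lemma homogenization_cox:
  assumes "vec.span (range (\<lambda>i. rat_vec (v i))) = UNIV"
  shows "homogenization (range (cox_dual_map (case_option z v))) (range (cox_dual_map v))"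
proof
  show "add_subgroup (range (cox_dual_map (case_option z v)))" by (rule add_subgroup_cox)
  show "range (cox_dual_map v) = proj ` range (cox_dual_map (case_option z v))"
    by (simp add: image_image proj_cox_dual_map)
  fix x assume "x \<in> range (cox_dual_map (case_option z v))" "proj x = 0"
  then obtain u where u: "x = cox_dual_map (case_option z v) u" by blast
  then have "u = 0" using \<open>proj x = 0\<close> cox_dual_map_injective[OF assms] by (simp add: proj_cox_dual_map)
  then show "x = 0" using u by (simp add: cox_dual_map_def pairing_def vec_eq_iff)
qed

text \<open>If \<open>n *s x\<close> comes from \<open>u\<close> and the projection of \<open>x\<close> from \<open>t\<close>, then \<open>u = n *s t\<close> by
  injectivity over the old rays, so \<open>x\<close> comes from \<open>t\<close>.\<close>

lemma saturated_extension:
  assumes span: "vec.span (range (\<lambda>i. rat_vec (v i))) = UNIV"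
    and sat: "\<And>n x. int n *s x \<in> range (cox_dual_map v) \<Longrightarrow> n > 0 \<Longrightarrow> x \<in> range (cox_dual_map v)"
    and x: "int n *s x \<in> range (cox_dual_map (case_option z v))" "n > 0"
  shows "x \<in> range (cox_dual_map (case_option z v))"
proof -
  obtain u where u: "int n *s x = cox_dual_map (case_option z v) u" using x(1) by blast
  have "int n *s proj x = cox_dual_map v u"
    using u by (metis proj_cox_dual_map vec_eq_iff vector_smult_component proj_nth)
  then have "proj x \<in> range (cox_dual_map v)" using sat x(2) by (metis rangeI)
  then obtain t where t: "proj x = cox_dual_map v t" by blast
  have "cox_dual_map v (u - int n *s t) = cox_dual_map v u - int n *s cox_dual_map v t"
    by (simp add: vec_eq_iff cox_dual_map_def pairing_def algebra_simps sum_subtractf sum_distrib_left)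
  also have "\<dots> = 0" using \<open>int n *s proj x = cox_dual_map v u\<close> t by simp
  finally have "u - int n *s t = 0" by (rule cox_dual_map_injective[OF span])
  then have "u = int n *s t" by simp
  then have "int n *s x = int n *s cox_dual_map (case_option z v) t"
    using u by (simp add: vec_eq_iff cox_dual_map_def pairing_def sum_distrib_left algebra_simps)
  then have "x = cox_dual_map (case_option z v) t" using x(2) by (simp add: vec_eq_iff)
  then show ?thesis by blast
qed

lemma common_denominator:
  fixes q :: "'i \<Rightarrow> rat"
  assumes "finite S"
  obtains N :: int and z where "N > 0" "\<And>i. i \<in> S \<Longrightarrow> of_int N * q i = of_int (z i)"
proof -
  have "\<exists>N>0. \<forall>i\<in>S. \<exists>z. of_int N * q i = of_int z"
    using assms
  proof induction
    case empty
    show ?case by (rule exI[of _ 1]) simp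
  next
    case (insert i S)
    then obtain N where N: "N > 0" "\<forall>i\<in>S. \<exists>z. of_int N * q i = of_int z" by blast
    obtain a b where ab: "quotient_of (q i) = (a, b)" by (cases "quotient_of (q i)")
    then have b: "b > 0" "q i = of_int a / of_int b"
      using quotient_of_denom_pos quotient_of_div by blast+
    show ?case
    proof (rule exI[of _ "N * b"], intro conjI ballI)
      show "N * b > 0" using N b by simp
      fix j assume j: "j \<in> insert i S"
      show "\<exists>z. of_int (N * b) * q j = of_int z"
      proof (cases "j = i")
        case True
        then have "of_int (N * b) * q j = of_int (N * a)" using b by simp
        then show ?thesis by blast
      next
        case False
        then obtain z where "of_int N * q j = of_int z" using N(2) j by blast
        then have "of_int (N * b) * q j = of_int (z * b)" by (simp add: mult.commute mult.left_commute)
        then show ?thesis by blast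
      qed
    qed
  qed
  then obtain N where "N > 0" "\<forall>i\<in>S. \<exists>z. of_int N * q i = of_int z" by blast
  then show ?thesis using that by metis
qed

text \<open>The functionals are coordinates that complement a basis of \<open>V\<close>, multiplied by common
  denominators of their values at the standard basis.\<close>

lemma subspace_functionals:
  fixes V :: "(rat^'m::finite) set"
  assumes V: "vec.subspace V"
  obtains C where "finite C" "\<And>x. rat_vec x \<in> V \<longleftrightarrow> x \<in> kers C"
proof -
  obtain B where B: "B \<subseteq> V" "vec.independent B" "vec.span B = V"
    using vec.basis_exists[of V] vec.span_eq_iff V by (metis vec.span_subspace)
  define B' where "B' = vec.extend_basis B"
  have B': "B \<subseteq> B'" "vec.independent B'" "vec.span B' = UNIV"
    unfolding B'_def using vec.extend_basis_superset vec.independent_extend_basis vec.span_extend_basis B(2) by auto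
  have fin: "finite B'" using B'(2) by (rule vec.finiteI_independent)
  have memV: "y \<in> V \<longleftrightarrow> (\<forall>b\<in>B' - B. vec.representation B' y b = 0)" for y
  proof
    assume "y \<in> V"
    then have "vec.representation B' y = vec.representation B y"
      using vec.representation_extend[OF B'(2) _ B'(1)] B(3) by simp
    then show "\<forall>b\<in>B' - B. vec.representation B' y b = 0" using vec.representation_ne_zero by fastforce
  next
    assume 0: "\<forall>b\<in>B' - B. vec.representation B' y b = 0"
    have "y = (\<Sum>b\<in>B'. vec.representation B' y b *s b)"
      using vec.sum_representation_eq[OF B'(2) _ fin] B'(3) by simp
    also have "\<dots> = (\<Sum>b\<in>B. vec.representation B' y b *s b)"
      using 0 fin B'(1) by (intro sum.mono_neutral_right) auto
    also have "\<dots> \<in> vec.span B" by (intro vec.span_sum vec.span_scale vec.span_base)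
    finally show "y \<in> V" using B(3) by simp
  qed
  have ex: "\<exists>c. \<forall>x :: int^'m. vec.representation B' (rat_vec x) b = 0 \<longleftrightarrow> pairing c x = 0" for b
  proof -
    let ?q = "\<lambda>i. vec.representation B' (axis i 1) b"
    obtain N :: int and z where N: "N > 0" "\<And>i. of_int N * ?q i = of_int (z i)"
      using common_denominator[of UNIV ?q] by auto
    have "vec.representation B' (rat_vec x) b = (\<Sum>i\<in>UNIV. of_int (x $ i) * ?q i)" for x :: "int^'m"
    proof -
      have "rat_vec x = (\<Sum>i\<in>UNIV. of_int (x $ i) *s axis i 1)"
        by (simp add: vec_eq_iff rat_vec_def axis_def if_distrib cong: if_cong)
      then have "vec.representation B' (rat_vec x) b = vec.representation B' (\<Sum>i\<in>UNIV. of_int (x $ i) *s axis i 1) b" by simp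
      also have "\<dots> = (\<Sum>i\<in>UNIV. vec.representation B' (of_int (x $ i) *s axis i 1) b)"
        by (simp add: vec.representation_sum[OF B'(2)] B'(3))
      also have "\<dots> = (\<Sum>i\<in>UNIV. of_int (x $ i) * ?q i)"
        by (simp add: vec.representation_scale[OF B'(2)] B'(3))
      finally show ?thesis .
    qed
    then have "of_int N * vec.representation B' (rat_vec x) b = of_int (pairing (\<chi> i. z i) x)" for x :: "int^'m"
      by (simp add: pairing_def sum_distrib_left N(2)[symmetric] algebra_simps)
    then show ?thesis using N(1) by (intro exI[of _ "\<chi> i. z i"]) (metis mult_eq_0_iff of_int_0_eq_iff less_irrefl)
  qed
  then obtain c where c: "\<And>b x. vec.representation B' (rat_vec x) b = 0 \<longleftrightarrow> pairing (c b) x = 0" by metis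
  show ?thesis
  proof (rule that[of "c ` (B' - B)"])
    show "finite (c ` (B' - B))" using fin by simp
    show "rat_vec x \<in> V \<longleftrightarrow> x \<in> kers (c ` (B' - B))" for x
      unfolding memV kers_def using c by simp
  qed
qed

text \<open>A saturated lattice consists of the integral points of the rational subspace that it spans.\<close>

lemma saturated_lattice_functionals:
  fixes v :: "'m::finite \<Rightarrow> int^'n::finite"
  assumes sat: "\<And>n x. int n *s x \<in> range (cox_dual_map v) \<Longrightarrow> n > 0 \<Longrightarrow> x \<in> range (cox_dual_map v)"
  obtains C where "finite C" "range (cox_dual_map v) = kers C"
proof -
  define P where "P u = (\<chi> i. pairing u (rat_vec (v i)))" for u :: "rat^'n"
  have "vec.subspace (range P)"
  proof (unfold vec.subspace_def, intro conjI ballI allI)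
    have "P 0 = 0" by (simp add: P_def pairing_def vec_eq_iff)
    then show "0 \<in> range P" by (metis rangeI)
    show "x + y \<in> range P" if xy: "x \<in> range P" "y \<in> range P" for x y
    proof -
      obtain s t where st: "x = P s" "y = P t" using xy by blast
      have "x + y = P (s + t)" unfolding st
        by (simp add: P_def pairing_def vec_eq_iff algebra_simps sum.distrib)
      then show ?thesis by simp
    qed
    show "k *s x \<in> range P" if x: "x \<in> range P" for k x
    proof -
      obtain s where s: "x = P s" using x by blast
      have "k *s x = P (k *s s)" unfolding s
        by (simp add: P_def pairing_def vec_eq_iff sum_distrib_left mult.assoc)
      then show ?thesis by simp
    qed
  qed
  then obtain C where C: "finite C" "\<And>x. rat_vec x \<in> range P \<longleftrightarrow> x \<in> kers C"
    by (rule subspace_functionals) blast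
  have P_rat: "P (rat_vec u) = rat_vec (cox_dual_map v u)" for u
    by (simp add: P_def pairing_rat_vec vec_eq_iff) (simp add: rat_vec_def cox_dual_map_def)
  have "x \<in> range (cox_dual_map v) \<longleftrightarrow> rat_vec x \<in> range P" for x
  proof
    assume "x \<in> range (cox_dual_map v)"
    then show "rat_vec x \<in> range P" using P_rat by (metis rangeE rangeI)
  next
    assume "rat_vec x \<in> range P"
    then obtain u where u: "rat_vec x = P u" by blast
    obtain N :: int and z where N: "N > 0" "\<And>i. of_int N * u $ i = of_int (z i)"
      using common_denominator[of UNIV "\<lambda>i. u $ i"] by auto
    have "of_int N *s u = rat_vec (\<chi> i. z i)" using N(2) by (simp add: vec_eq_iff rat_vec_def)
    moreover have "P (of_int N *s u) = of_int N *s P u"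
      by (simp add: P_def pairing_def vec_eq_iff sum_distrib_left mult.assoc)
    ultimately have "rat_vec (cox_dual_map v (\<chi> i. z i)) = of_int N *s rat_vec x" using P_rat u by metis
    then have "cox_dual_map v (\<chi> i. z i) = N *s x"
      by (simp add: vec_eq_iff rat_vec_def of_int_mult[symmetric] del: of_int_mult)
    then have "int (nat N) *s x \<in> range (cox_dual_map v)" using N(1) by (metis int_nat_eq less_imp_le rangeI)
    then show "x \<in> range (cox_dual_map v)" using sat[of "nat N" x] N(1) by simp
  qed
  then have "range (cox_dual_map v) = kers C" using C(2) by (intro equalityI subsetI) simp_all
  then show ?thesis using that C(1) by blast
qed

text \<open>The least number in the definition exists: a rational point of the cone becomes a nonnegative
  integral combination after multiplication with a common denominator.\<close>

lemma stellar_index_positive: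
  fixes v :: "'r::finite \<Rightarrow> int^'n::finite"
  assumes "inj v" and z: "rat_vec z \<in> cone_of ((\<lambda>i. rat_vec (v i)) ` D)"
  shows "stellar_index v D z > 0"
proof -
  have inj: "inj_on (\<lambda>i. rat_vec (v i)) D"
  proof (rule inj_onI)
    fix i j assume "rat_vec (v i) = rat_vec (v j)"
    then have "v i = v j" by (simp add: vec_eq_iff rat_vec_def)
    then show "i = j" using assms(1) by (simp add: inj_eq)
  qed
  obtain t where t: "rat_vec z = (\<Sum>x\<in>(\<lambda>i. rat_vec (v i)) ` D. t x *s x)" "\<And>x. x \<in> (\<lambda>i. rat_vec (v i)) ` D \<Longrightarrow> 0 \<le> t x"
    using z by (auto simp: cone_of_def)
  define q where "q i = t (rat_vec (v i))" for i
  have q: "rat_vec z = (\<Sum>i\<in>D. q i *s rat_vec (v i))" "\<And>i. i \<in> D \<Longrightarrow> 0 \<le> q i"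
    using t by (auto simp: q_def sum.reindex[OF inj])
  obtain N :: int and y where N: "N > 0" "\<And>i. i \<in> D \<Longrightarrow> of_int N * q i = of_int (y i)"
    using common_denominator[of D q] by auto
  have y0: "0 \<le> y i" if "i \<in> D" for i
  proof -
    have "0 \<le> of_int N * q i" using N(1) q(2)[OF that] by simp
    then show ?thesis using N(2)[OF that] by simp
  qed
  have "N *s z = (\<Sum>i\<in>D. int (nat (y i)) *s v i)"
  proof -
    have "(of_int ((N *s z) $ j) :: rat) = of_int ((\<Sum>i\<in>D. int (nat (y i)) *s v i) $ j)" for j
    proof -
      have "(of_int (z $ j) :: rat) = rat_vec z $ j" by (simp add: rat_vec_def)
      also have "\<dots> = (\<Sum>i\<in>D. q i * of_int (v i $ j))" unfolding q(1) by (simp add: rat_vec_def)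
      finally have "(of_int ((N *s z) $ j) :: rat) = (\<Sum>i\<in>D. of_int N * q i * of_int (v i $ j))"
        by (simp add: sum_distrib_left mult.assoc)
      also have "\<dots> = (\<Sum>i\<in>D. of_int (int (nat (y i)) * v i $ j))"
        using N(2) y0 by (intro sum.cong) auto
      finally show ?thesis by simp
    qed
    then show ?thesis by (simp only: vec_eq_iff of_int_eq_iff) simp
  qed
  then have "\<exists>m. 0 < m \<and> (\<exists>a :: 'r \<Rightarrow> nat. int m *s z = (\<Sum>i\<in>D. int (a i) *s v i))"
    using N(1) by (intro exI[of _ "nat N"] conjI exI[of _ "\<lambda>i. nat (y i)"]) simp_all
  from LeastI_ex[OF this] show ?thesis by (simp add: stellar_index_def)
qed

section \<open>The ambient modification\<close>

lemma power_monomial: "single e 1 ^ n = (single (\<Sum>k<n. e) 1 :: 'a::comm_monoid_add \<Rightarrow>\<^sub>0 'k::comm_semiring_1)"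
  by (induction n) (simp_all add: mult_single add.commute)

lemma prod_monomial:
  "(\<Prod>i\<in>S. single (e i) 1) = (single (\<Sum>i\<in>S. e i) 1 :: 'a::comm_monoid_add \<Rightarrow>\<^sub>0 'k::comm_semiring_1)"
  by (induction S rule: infinite_finite_induct) (simp_all add: mult_single)

lemma poly_subst_monomial:
  fixes p :: "('r::finite, 'k::comm_ring_1) mpoly" and e :: "'r \<Rightarrow> 's \<Rightarrow>\<^sub>0 nat"
  shows "poly_subst (\<lambda>i. single (e i) 1) p = push (\<lambda>\<mu>. \<Sum>i\<in>UNIV. \<Sum>k<lookup \<mu> i. e i) p"
proof (induction p rule: mpoly_induct)
  case (add p \<mu> c)
  have "mev (\<lambda>i. single (e i) 1) \<mu> = (single (\<Sum>i\<in>UNIV. \<Sum>k<lookup \<mu> i. e i) 1 :: ('s, 'k) mpoly)"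
    by (subst mev_superset[of UNIV]) (simp_all add: power_monomial prod_monomial)
  then show ?case
    using add by (simp add: poly_subst_add push_add poly_subst_single Const_def mult_single)
qed simp

lemma poly_subst_Var_Some:
  fixes p :: "('r::finite, 'k::comm_ring_1) mpoly"
  shows "poly_subst (\<lambda>i. Var (Some i)) p = push (emb 0) p"
proof -
  have "(\<Sum>i\<in>UNIV. \<Sum>k<lookup \<mu> i. single (Some i) 1) = emb 0 \<mu>" for \<mu> :: "'r \<Rightarrow>\<^sub>0 nat"
  proof (rule poly_mapping_eqI)
    fix j show "lookup (\<Sum>i\<in>UNIV. \<Sum>k<lookup \<mu> i. single (Some i) 1) j = lookup (emb 0 \<mu>) j"
      by (cases j) (simp_all add: lookup_sum lookup_single when_def if_distrib[of "\<lambda>x. _ * x"] cong: if_cong)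
  qed
  then show ?thesis unfolding Var_def poly_subst_monomial by simp
qed

lemma poly_subst_ambient:
  fixes p :: "('r::finite, 'k::comm_ring_1) mpoly"
  shows "poly_subst (\<lambda>i. if i \<in> D then Tinf ^ a i * Var (Some i) else Var (Some i)) p =
    push (\<lambda>\<mu>. emb (weight D a \<mu>) \<mu>) p"
proof -
  define e where "e i = (if i \<in> D then single None (a i) + single (Some i) 1 else single (Some i) (1::nat))" for i
  have "(\<lambda>i. if i \<in> D then Tinf ^ a i * Var (Some i) else Var (Some i)) = (\<lambda>i. single (e i) (1::'k))"
    by (rule ext) (simp add: e_def Tinf_power, simp add: Var_def mult_single)
  moreover have "(\<Sum>i\<in>UNIV. \<Sum>k<lookup \<mu> i. e i) = emb (weight D a \<mu>) \<mu>" for \<mu>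
  proof (rule poly_mapping_eqI)
    fix j show "lookup (\<Sum>i\<in>UNIV. \<Sum>k<lookup \<mu> i. e i) j = lookup (emb (weight D a \<mu>) \<mu>) j"
    proof (cases j)
      case None
      have "(\<Sum>i\<in>UNIV. lookup \<mu> i * lookup (e i) None) = (\<Sum>i\<in>UNIV. if i \<in> D then a i * lookup \<mu> i else 0)"
        by (rule sum.cong) (simp_all add: e_def lookup_add lookup_single)
      also have "\<dots> = weight D a \<mu>" by (simp add: weight_def sum.If_cases)
      finally show ?thesis by (simp add: None lookup_sum)
    next
      case (Some s)
      have "(\<Sum>i\<in>UNIV. lookup \<mu> i * lookup (e i) (Some s)) = (\<Sum>i\<in>UNIV. if i = s then lookup \<mu> i else 0)"
        by (rule sum.cong) (simp_all add: e_def lookup_add lookup_single when_def)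
      then show ?thesis by (simp add: Some lookup_sum)
    qed
  qed
  ultimately show ?thesis by (simp add: poly_subst_monomial)
qed

lemma lowest_weight_le: "\<mu> \<in> keys f \<Longrightarrow> lowest_weight D a f \<le> weight D a \<mu>"
  unfolding lowest_weight_def by (intro Min_le) auto

lemma lowest_weight_attained:
  assumes "f \<noteq> 0"
  obtains \<mu> where "\<mu> \<in> keys f" "weight D a \<mu> = lowest_weight D a f"
proof -
  have "Min (weight D a ` keys f) \<in> weight D a ` keys f"
    using nonzero_key[OF assms] by (intro Min_in) auto
  then show ?thesis using that unfolding lowest_weight_def by force
qed

text \<open>Every monomial is divisible by the power of \<open>Tinf\<close> in the denominator, and the quotient is
  unique as polynomials form a domain.\<close>

lemma ambient_lift_eq:
  fixes f :: "('r::finite, 'k::field) mpoly"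
  shows "ambient_lift D a f = push (\<lambda>\<mu>. emb (weight D a \<mu> - lowest_weight D a f) \<mu>) f"
  unfolding ambient_lift_def poly_subst_ambient
proof (rule the_equality)
  let ?k = "lowest_weight D a f"
  have "single None ?k + emb (weight D a \<mu> - ?k) \<mu> = emb (weight D a \<mu>) \<mu>" if "\<mu> \<in> keys f" for \<mu>
    using lowest_weight_le[OF that, of D a]
    by (intro option_exponent_eqI) (simp_all add: lookup_add drop_inf_add)
  then show *: "push (\<lambda>\<mu>. emb (weight D a \<mu> - ?k) \<mu>) f * Tinf ^ ?k = push (\<lambda>\<mu>. emb (weight D a \<mu>) \<mu>) f"
    unfolding mult.commute[of _ "Tinf ^ ?k"] Tinf_power_mult push_push by (intro push_cong) simp
  fix q assume "q * Tinf ^ ?k = push (\<lambda>\<mu>. emb (weight D a \<mu>) \<mu>) f"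
  then have "Tinf ^ ?k * q = Tinf ^ ?k * push (\<lambda>\<mu>. emb (weight D a \<mu> - ?k) \<mu>) f"
    using * by (simp add: mult.commute)
  moreover have "Tinf ^ ?k \<noteq> (0 :: ('r option, 'k) mpoly)"
    by (metis dehom_0 dehom_Tinf dehom_power power_one zero_neq_one)
  ultimately show "q = push (\<lambda>\<mu>. emb (weight D a \<mu> - ?k) \<mu>) f" by (rule mpoly_mult_cancel)
qed

lemma take_root_eq: "take_root m p = push (\<lambda>\<nu>. emb (lookup \<nu> None div m) (drop_inf \<nu>)) p"
proof -
  have "Poly_Mapping.update None (lookup \<nu> None div m) \<nu> = emb (lookup \<nu> None div m) (drop_inf \<nu>)" for \<nu> :: "'a option \<Rightarrow>\<^sub>0 nat"
  proof (rule poly_mapping_eqI)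
    fix j show "lookup (Poly_Mapping.update None (lookup \<nu> None div m) \<nu>) j = lookup (emb (lookup \<nu> None div m) (drop_inf \<nu>)) j"
      by (cases j) (simp_all add: lookup_update)
  qed
  then show ?thesis by (simp add: take_root_def push_def)
qed

text \<open>This is why only powers of \<open>Tinf\<close> divisible by \<open>m\<close> occur and why the remaining exponents are
  compatible with the new ray: pair \<open>u\<close> with the relation \<open>m *s z = \<Sum>i\<in>D. a i *s v i\<close>.\<close>

lemma weight_difference:
  fixes v :: "'r::finite \<Rightarrow> int^'n::finite"
  assumes z: "int m *s z = (\<Sum>i\<in>D. int (a i) *s v i)" and u: "ivec \<mu> - ivec \<nu> = cox_dual_map v u"
  shows "int (weight D a \<mu>) - int (weight D a \<nu>) = int m * pairing u z"
proof -
  have "int (lookup \<mu> i) - int (lookup \<nu> i) = pairing u (v i)" for i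
    using u by (simp add: vec_eq_iff cox_dual_map_def)
  then have "int (weight D a \<mu>) - int (weight D a \<nu>) = (\<Sum>i\<in>D. int (a i) * pairing u (v i))"
    by (simp add: weight_def sum_subtractf[symmetric] right_diff_distrib[symmetric])
  also have "\<dots> = pairing u (int m *s z)" unfolding z by (simp add: pairing_sum pairing_scale)
  finally show ?thesis by (simp add: pairing_scale)
qed

locale ambient_modification =
  fixes v :: "'r::finite \<Rightarrow> int^'n::finite" and z :: "int^'n" and D :: "'r set"
    and a :: "'r \<Rightarrow> nat" and m :: nat and f :: "('r, 'k::field) mpoly"
  assumes span: "vec.span (range (\<lambda>i. rat_vec (v i))) = UNIV"
    and m: "m > 0" and z: "int m *s z = (\<Sum>i\<in>D. int (a i) *s v i)"
    and f: "f \<noteq> 0" "homog (range (cox_dual_map v)) f"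
begin

abbreviation "k\<^sub>0 \<equiv> lowest_weight D a f"

text \<open>The power of \<open>Tinf\<close> on the monomial \<open>\<mu>\<close> after division by \<open>Tinf\<close> to the power \<open>k\<^sub>0\<close> and
  extraction of the root.\<close>

definition ltinf :: "('r \<Rightarrow>\<^sub>0 nat) \<Rightarrow> nat" where
  "ltinf \<mu> = (weight D a \<mu> - k\<^sub>0) div m"

definition F :: "('r option, 'k) mpoly" where
  "F = push (\<lambda>\<mu>. emb (ltinf \<mu>) \<mu>) f"

lemma keys_difference:
  assumes "\<mu> \<in> keys f" "\<nu> \<in> keys f"
  obtains u where "ivec \<mu> - ivec \<nu> = cox_dual_map v u"
proof -
  obtain \<kappa> where \<kappa>: "homd (range (cox_dual_map v)) \<kappa> f" using f(2) by (auto simp: homog_def)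
  have "(ivec \<mu> - \<kappa>) - (ivec \<nu> - \<kappa>) \<in> range (cox_dual_map v)"
    using \<kappa> assms unfolding homd_def by (metis add_subgroup_diff[OF add_subgroup_cox])
  then show ?thesis using that by auto
qed

lemma weight_eq:
  assumes \<mu>: "\<mu> \<in> keys f"
  shows "weight D a \<mu> = k\<^sub>0 + m * ltinf \<mu>"
proof -
  obtain \<nu> where \<nu>: "\<nu> \<in> keys f" "weight D a \<nu> = k\<^sub>0" by (rule lowest_weight_attained[OF f(1)])
  obtain u where u: "ivec \<mu> - ivec \<nu> = cox_dual_map v u" by (rule keys_difference[OF \<mu> \<nu>(1)])
  have le: "k\<^sub>0 \<le> weight D a \<mu>" by (rule lowest_weight_le[OF \<mu>])
  have "int (weight D a \<mu> - k\<^sub>0) = int m * pairing u z"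
    using weight_difference[OF z u] \<nu>(2) le by (simp add: of_nat_diff)
  then have "int m dvd int (weight D a \<mu> - k\<^sub>0)" by simp
  then have "m dvd weight D a \<mu> - k\<^sub>0" by simp
  then show ?thesis using le by (simp add: ltinf_def)
qed

lemma keys_ambient_lift_dvd:
  "\<nu> \<in> keys (ambient_lift D a f) \<Longrightarrow> m dvd lookup \<nu> None"
proof -
  assume "\<nu> \<in> keys (ambient_lift D a f)"
  then obtain \<mu> where "\<mu> \<in> keys f" "\<nu> = emb (weight D a \<mu> - k\<^sub>0) \<mu>"
    unfolding ambient_lift_eq by (rule keys_pushE)
  then show ?thesis using weight_eq by simp
qed

lemma take_root_ambient_lift: "take_root m (ambient_lift D a f) = F"
  unfolding take_root_eq ambient_lift_eq push_push F_def by (rule push_cong) (simp add: ltinf_def)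

text \<open>If two exponents of \<open>f\<close> differ by the image of \<open>u\<close>, then the powers of \<open>Tinf\<close> added to them
  differ by the value of \<open>u\<close> at the new ray.\<close>

lemma homog_F: "homog (range (cox_dual_map (case_option z v))) F"
proof -
  obtain \<nu> where \<nu>: "\<nu> \<in> keys f" using nonzero_key[OF f(1)] by blast
  have "homd (range (cox_dual_map (case_option z v))) (ivec (emb (ltinf \<nu>) \<nu>)) F"
    unfolding homd_def
  proof
    fix \<beta> assume "\<beta> \<in> keys F"
    then obtain \<mu> where \<mu>: "\<mu> \<in> keys f" "\<beta> = emb (ltinf \<mu>) \<mu>" unfolding F_def by (rule keys_pushE)
    obtain u where u: "ivec \<mu> - ivec \<nu> = cox_dual_map v u" by (rule keys_difference[OF \<mu>(1) \<nu>])
    have "int m * (int (ltinf \<mu>) - int (ltinf \<nu>)) = int m * pairing u z"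
      using weight_difference[OF z u] weight_eq[OF \<mu>(1)] weight_eq[OF \<nu>] by (simp add: algebra_simps)
    then have l: "int (ltinf \<mu>) - int (ltinf \<nu>) = pairing u z" using m by simp
    have "ivec \<beta> - ivec (emb (ltinf \<nu>) \<nu>) = cox_dual_map (case_option z v) u"
    proof (rule option_vec_eqI)
      show "(ivec \<beta> - ivec (emb (ltinf \<nu>) \<nu>)) $ None = cox_dual_map (case_option z v) u $ None"
        using l by (simp add: \<mu>(2) cox_dual_map_def)
      show "proj (ivec \<beta> - ivec (emb (ltinf \<nu>) \<nu>)) = proj (cox_dual_map (case_option z v) u)"
        using u by (simp add: \<mu>(2) proj_diff proj_ivec proj_cox_dual_map)
    qed
    then show "ivec \<beta> - ivec (emb (ltinf \<nu>) \<nu>) \<in> range (cox_dual_map (case_option z v))" by simp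
  qed
  then show ?thesis by (rule homogI)
qed

lemma dehom_F: "dehom F = f"
  unfolding dehom_def F_def push_push by (rule push_id) simp

text \<open>At \<open>Tinf = 0\<close> only the monomials without \<open>Tinf\<close> survive, and these are the ones of lowest
  weight.\<close>

lemma part_F: "part (\<lambda>\<nu>. lookup \<nu> None = 0) F = push (emb 0) (weight_part D a f k\<^sub>0)"
proof -
  have wp: "weight_part D a f k\<^sub>0 = part (\<lambda>\<mu>. weight D a \<mu> = k\<^sub>0) f"
    unfolding weight_part_def
    by (rule poly_mapping_eqI) (auto simp: lookup_sum lookup_single lookup_part when_def in_keys_iff)
  have "part (\<lambda>\<nu>. lookup \<nu> None = 0) F =
    (\<Sum>\<mu>\<in>keys f. part (\<lambda>\<nu>. lookup \<nu> None = 0) (single (emb (ltinf \<mu>) \<mu>) (lookup f \<mu>)))"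
    by (simp add: F_def push_def part_sum)
  also have "\<dots> = (\<Sum>\<mu>\<in>keys f. if weight D a \<mu> = k\<^sub>0 then single (emb 0 \<mu>) (lookup f \<mu>) else 0)"
  proof (rule sum.cong[OF refl])
    fix \<mu> assume \<mu>: "\<mu> \<in> keys f"
    have "ltinf \<mu> = 0 \<longleftrightarrow> weight D a \<mu> = k\<^sub>0" using weight_eq[OF \<mu>] m by simp
    moreover have "part (\<lambda>\<nu>. lookup \<nu> None = 0) (single (emb l \<mu>) c) = (if l = 0 then single (emb l \<mu>) c else 0)" for l and c :: 'k
      by (rule poly_mapping_eqI) (auto simp: lookup_part lookup_single when_def)
    ultimately show "part (\<lambda>\<nu>. lookup \<nu> None = 0) (single (emb (ltinf \<mu>) \<mu>) (lookup f \<mu>)) =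
        (if weight D a \<mu> = k\<^sub>0 then single (emb 0 \<mu>) (lookup f \<mu>) else 0)" by auto
  qed
  also have "\<dots> = push (emb 0) (weight_part D a f k\<^sub>0)"
    unfolding wp push_def keys_part
    by (simp add: sum.inter_filter[symmetric] lookup_part)
  finally show ?thesis .
qed

lemma Tinf_ndvd_F: "\<not> Tinf dvd F"
proof -
  obtain \<nu> where \<nu>: "\<nu> \<in> keys f" "weight D a \<nu> = k\<^sub>0" by (rule lowest_weight_attained[OF f(1)])
  have inj: "inj_on (\<lambda>\<mu>. emb (ltinf \<mu>) \<mu>) (keys f)"
    by (rule inj_onI) (metis drop_inf_emb)
  have "emb (ltinf \<nu>) \<nu> \<in> keys F" unfolding F_def keys_push_inj[OF inj] using \<nu>(1) by (rule imageI)
  moreover have "ltinf \<nu> = 0" by (simp add: ltinf_def \<nu>(2))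
  ultimately have "emb (ltinf \<nu>) \<nu> \<in> keys (part (\<lambda>\<nu>. lookup \<nu> None = 0) F)" by (simp add: keys_part)
  then show ?thesis unfolding Tinf_dvd_iff by auto
qed

text \<open>For these weights the monomial of \<open>F\<close> coming from \<open>\<mu>\<close> has degree
  \<open>m * ltinf \<mu> - weight D a \<mu> = - k\<^sub>0\<close>, so \<open>F\<close> is homogeneous for a grading by the integers.\<close>

definition c :: "int^'r option" where
  "c = (\<chi> j. case j of None \<Rightarrow> int m | Some i \<Rightarrow> if i \<in> D then - int (a i) else 0)"

lemma pairing_c: "pairing c x = int m * x $ None - (\<Sum>i\<in>D. int (a i) * x $ Some i)"
proof -
  have "pairing c x = (\<Sum>j\<in>insert None (range Some). c $ j * x $ j)"
    unfolding pairing_def by (simp add: UNIV_option_conv)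
  also have "\<dots> = int m * x $ None + (\<Sum>i\<in>UNIV. c $ Some i * x $ Some i)"
    by (simp add: sum.reindex c_def)
  also have "(\<Sum>i\<in>UNIV. c $ Some i * x $ Some i) = (\<Sum>i\<in>UNIV. if i \<in> D then - (int (a i) * x $ Some i) else 0)"
    by (rule sum.cong) (simp_all add: c_def)
  also have "\<dots> = - (\<Sum>i\<in>D. int (a i) * x $ Some i)" by (simp add: sum.If_cases sum_negf)
  finally show ?thesis by simp
qed

lemma homog_F_weight: "homog (ker c) F"
proof -
  obtain \<nu> where \<nu>: "\<nu> \<in> keys f" using nonzero_key[OF f(1)] by blast
  have const: "pairing c (ivec (emb (ltinf \<mu>) \<mu>)) = - int k\<^sub>0" if "\<mu> \<in> keys f" for \<mu>
  proof -
    have "(\<Sum>i\<in>D. int (a i) * int (lookup \<mu> i)) = int (weight D a \<mu>)" by (simp add: weight_def)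
    then show ?thesis using weight_eq[OF that] by (simp add: pairing_c)
  qed
  have "homd (ker c) (ivec (emb (ltinf \<nu>) \<nu>)) F"
    unfolding homd_def
  proof
    fix \<beta> assume "\<beta> \<in> keys F"
    then obtain \<mu> where \<mu>: "\<mu> \<in> keys f" "\<beta> = emb (ltinf \<mu>) \<mu>" unfolding F_def by (rule keys_pushE)
    then show "ivec \<beta> - ivec (emb (ltinf \<nu>) \<nu>) \<in> ker c"
      using const[OF \<mu>(1)] const[OF \<nu>] by (simp add: ker_def pairing_diff)
  qed
  then show ?thesis by (rule homogI)
qed

sublocale L: homogenized_hypersurface
  "range (cox_dual_map (case_option z v))" "range (cox_dual_map v)" F f
  using homogenization_cox[OF span, of z] homog_F dehom_F Tinf_ndvd_F
  by (simp add: homogenized_hypersurface_def homogenized_hypersurface_axioms_def)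

lemma weighted:
  assumes "prime_mod f"
  shows "weighted_homogenization c (proj ` ker c) F f"
proof -
  have "homogenization (ker c) (proj ` ker c)"
  proof
    show "add_subgroup (ker c)" by (rule add_subgroup_ker)
    fix x assume x: "x \<in> ker c" "proj x = 0"
    then have "x $ Some i = 0" for i by (metis proj_nth zero_index)
    then have "int m * x $ None = 0" using x(1) by (simp add: ker_def pairing_c)
    then have "x $ None = 0" using m by simp
    then show "x = 0" using x(2) by (intro option_vec_eqI) (simp_all add: vec_eq_iff)
  qed simp
  then show ?thesis using homog_F_weight dehom_F Tinf_ndvd_F assms
    by (simp add: weighted_homogenization_def weighted_homogenization_axioms_def
        homogenized_hypersurface_def homogenized_hypersurface_axioms_def)
qed

text \<open>The quotient by \<open>F\<close> and \<open>Tinf\<close> is the quotient of the polynomial ring in the old variables by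
  the part of \<open>f\<close> of lowest weight.\<close>

lemma pid_Tinf_iff:
  "p \<in> pid F Tinf \<longleftrightarrow>
    push (emb 0) (weight_part D a f k\<^sub>0) dvd part (\<lambda>\<nu>. lookup \<nu> None = 0) p"
proof -
  let ?P = "part (\<lambda>\<nu> :: 'r option \<Rightarrow>\<^sub>0 nat. lookup \<nu> None = 0) :: ('r option, 'k) mpoly \<Rightarrow> _"
  note mult = Tinf_free_part_mult[of F]
  show ?thesis
    unfolding part_F[symmetric]
  proof
    assume "p \<in> pid F Tinf"
    then obtain b h where "p - Tinf * b = F * h" by (auto simp: pid_def dvd_def)
    then have "p = Tinf * b + F * h" by (simp add: algebra_simps)
    moreover have "?P (Tinf * b) = 0" using Tinf_dvd_iff by (metis dvd_triv_left)
    ultimately show "?P F dvd ?P p" by (simp add: part_add mult)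
  next
    assume "?P F dvd ?P p"
    then obtain h where h: "?P p = ?P F * h" by (auto simp: dvd_def)
    \<comment> \<open>Only the part of \<open>h\<close> free of \<open>Tinf\<close> matters.\<close>
    have "?P p = ?P (?P F * h)" using h by (simp add: part_part[of _ _ p] flip: h)
    also have "\<dots> = ?P F * ?P h" by (rule part_mult) (auto simp: keys_part lookup_add)
    finally have "?P (p - F * h) = 0" by (simp add: part_diff mult)
    then obtain b where "p - F * h = Tinf * b" using Tinf_dvd_iff by (metis dvd_def)
    then have "p - Tinf * b = F * h" by (simp add: algebra_simps)
    then show "p \<in> pid F Tinf" by (intro pid_memI[of _ _ _ b]) simp
  qed
qed

end

section \<open>Factoriality of ambient modifications\<close>

theorem corollary7p4:
  fixes G\<^sub>0 :: "'g monoid" and w\<^sub>0 :: "'r::finite \<Rightarrow> 'g"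
    and G\<^sub>1 :: "'h monoid" and w\<^sub>1 :: "'r option \<Rightarrow> 'h"
    and \<Sigma>\<^sub>0 \<Sigma>\<^sub>1 :: "(rat^'n::finite) set set" and \<sigma>\<^sub>0 :: "(rat^'n) set"
    and v :: "'r \<Rightarrow> int^'n" and v_inf :: "int^'n" and D :: "'r set"
    and m_inf :: nat and a :: "'r \<Rightarrow> nat"
    and f\<^sub>0 :: "('r, 'k::{alg_closed_field, field_char_0}) mpoly"
    and f\<^sub>1 f\<^sub>1' :: "('r option, 'k) mpoly"
  assumes "toric_cox_data \<Sigma>\<^sub>0 v G\<^sub>0 w\<^sub>0"
    and "\<forall>\<sigma>\<in>\<Sigma>\<^sub>0. simplicial_cone \<sigma>"
    and "maximal_projectable_fan G\<^sub>0 w\<^sub>0 (cox_fan \<Sigma>\<^sub>0 v)"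
    and "f\<^sub>0 \<in> homogeneous_elems G\<^sub>0 (poly_component G\<^sub>0 w\<^sub>0)"
    and "normal_domain (quot_ring f\<^sub>0)"
    and "factorially_graded G\<^sub>0 (quot_ring f\<^sub>0) (quot_const f\<^sub>0) (quot_component G\<^sub>0 w\<^sub>0 f\<^sub>0)"
    and "\<And>i. graded_prime_elem G\<^sub>0 (quot_ring f\<^sub>0) (quot_component G\<^sub>0 w\<^sub>0 f\<^sub>0) (quot_class f\<^sub>0 (Var i))"
    and "\<And>i j. i \<noteq> j \<Longrightarrow> \<not> quot_class f\<^sub>0 (Var i) \<sim>\<^bsub>quot_ring f\<^sub>0\<^esub> quot_class f\<^sub>0 (Var j)"
    and "2 \<le> card D"
    and "\<sigma>\<^sub>0 = cone_of ((\<lambda>i. rat_vec (v i)) ` D)" and "\<sigma>\<^sub>0 \<in> \<Sigma>\<^sub>0"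
    and "primitive_vec v_inf" and "rat_vec v_inf \<in> relint \<sigma>\<^sub>0"
    and "\<Sigma>\<^sub>1 = stellar_subdivision \<Sigma>\<^sub>0 \<sigma>\<^sub>0 v_inf"
    and "toric_cox_data \<Sigma>\<^sub>1 (case_option v_inf v) G\<^sub>1 w\<^sub>1"
    and "m_inf = stellar_index v D v_inf"
    and "int m_inf *s v_inf = (\<Sum>i\<in>D. int (a i) *s v i)"
    and "admissible G\<^sub>1 w\<^sub>1 D a f\<^sub>0"
    and "f\<^sub>1 = ambient_lift D a f\<^sub>0"
    and "f\<^sub>1' = take_root m_inf f\<^sub>1"
  shows "(\<forall>\<mu>\<in>Poly_Mapping.keys f\<^sub>1. m_inf dvd Poly_Mapping.lookup \<mu> None) \<and>
         factorially_graded G\<^sub>1 (quot_ring f\<^sub>1') (quot_const f\<^sub>1')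
           (quot_component G\<^sub>1 w\<^sub>1 f\<^sub>1') \<and>
         (torsion_free_group G\<^sub>0 \<longrightarrow> factorial_domain (quot_ring f\<^sub>1'))"
proof -
  let ?L0 = "range (cox_dual_map v)" and ?L1 = "range (cox_dual_map (case_option v_inf v))"
  interpret G0: lattice_graded G\<^sub>0 w\<^sub>0 ?L0 by (rule toric_cox_lattice_graded[OF assms(1)])
  interpret G1: lattice_graded G\<^sub>1 w\<^sub>1 ?L1 by (rule toric_cox_lattice_graded[OF assms(15)])
  have span: "vec.span (range (\<lambda>i. rat_vec (v i))) = UNIV" and inj: "inj v"
    using assms(1) by (auto simp: toric_cox_data_def primitive_ray_generators_def)
  have m: "m_inf > 0"
    unfolding assms(16) using assms(10,13) inj by (intro stellar_index_positive) (auto simp: relint_def)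
  have f0: "f\<^sub>0 \<noteq> 0" "homog ?L0 f\<^sub>0"
    using assms(4,18) by (auto simp: G0.homogeneous_elems_poly admissible_def)
  interpret ambient_modification v v_inf D a m_inf f\<^sub>0
    by unfold_locales (fact span m assms(17) f0)+
  have F: "f\<^sub>1' = F" unfolding assms(19,20) by (rule take_root_ambient_lift)
  have fact0: "gfactorial ?L0 f\<^sub>0" using assms(6) G0.factorially_graded_iff[OF f0(2)] by simp
  then have pm0: "prime_mod f\<^sub>0" and cu0: "const_units f\<^sub>0"
    and min0: "\<And>J. minprime ?L0 f\<^sub>0 J \<Longrightarrow> \<exists>i. J = pid f\<^sub>0 i" by (auto simp: gfactorial_def)
  interpret W: weighted_homogenization c "proj ` ker c" F f\<^sub>0 by (rule weighted[OF pm0])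
  let ?g = "push (emb 0) (weight_part D a f\<^sub>0 k\<^sub>0)"
  have g: "graded_prime_elem G\<^sub>1 mpoly_ring (poly_component G\<^sub>1 w\<^sub>1) ?g"
    using assms(18) by (simp add: admissible_def Let_def poly_subst_Var_Some)
  have divides: "p divides\<^bsub>mpoly_ring\<^esub> q \<longleftrightarrow> p dvd q" for p q :: "('r option, 'k) mpoly"
    by (auto simp: factor_def dvd_def)
  \<comment> \<open>Admissibility makes the lowest part \<open>g\<close> of \<open>f\<^sub>0\<close> prime for the grading by \<open>K\<^sub>1\<close>, and \<open>Tinf\<close>
    inherits this.\<close>
  have Tinf: "hprime ?L1 (pid F Tinf)"
    unfolding hprime_def
  proof (intro conjI allI impI)
    show "1 \<notin> pid F Tinf"
    proof
      assume "1 \<in> pid F Tinf"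
      moreover have "part (\<lambda>\<nu> :: 'r option \<Rightarrow>\<^sub>0 nat. lookup \<nu> None = 0) 1 = (1 :: ('r option, 'k) mpoly)"
        by (rule part_all) simp
      ultimately have "?g dvd 1" by (simp add: pid_Tinf_iff)
      then obtain h where "1 = ?g * h" by (auto simp: dvd_def)
      then have "?g \<in> Units mpoly_ring" unfolding Units_def by (auto intro!: exI[of _ h] simp: mult.commute)
      then show False using g by (simp add: graded_prime_elem_def)
    qed
    fix p q :: "('r option, 'k) mpoly"
    let ?P = "part (\<lambda>\<nu> :: 'r option \<Rightarrow>\<^sub>0 nat. lookup \<nu> None = 0) :: ('r option, 'k) mpoly \<Rightarrow> _"
    assume pq: "homog ?L1 p" "homog ?L1 q" "p * q \<in> pid F Tinf"
    have P: "homog ?L1 (?P r)" if "homog ?L1 r" for r using that homd_part unfolding homog_def by blast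
    have "?g dvd ?P p * ?P q" using pq(3) by (simp add: pid_Tinf_iff Tinf_free_part_mult)
    then have "?g dvd ?P p \<or> ?g dvd ?P q"
      using g P[OF pq(1)] P[OF pq(2)]
      by (simp add: graded_prime_elem_def G1.homogeneous_elems_poly divides)
    then show "p \<in> pid F Tinf \<or> q \<in> pid F Tinf" by (simp add: pid_Tinf_iff)
  qed
  have pm: "prime_mod F" by (rule W.prime_homogenization)
  have cu: "const_units F"
    using W.const_units_homogenization[OF cu0] Tinf by (simp add: hprime_def)
  \<comment> \<open>The hypothesis only provides some generator; dehomogenization needs a homogeneous one.\<close>
  have gen: "\<exists>i. homog ?L0 i \<and> I = pid f\<^sub>0 i" if I: "minprime ?L0 f\<^sub>0 I" for I
  proof -
    obtain i where i: "I = pid f\<^sub>0 i" using min0[OF I] by blast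
    have "hcomp_closed ?L0 (pid f\<^sub>0 i)" using I i by (simp add: minprime_def gprime_def)
    then obtain i' where "homog ?L0 i'" "pid f\<^sub>0 i = pid f\<^sub>0 i'"
      using homogeneous_generator[OF G0.L f0(2) pm0 cu0] by blast
    then show ?thesis using i by blast
  qed
  have fact1: "gfactorial ?L1 F"
    unfolding gfactorial_def using pm cu L.minprime_principal[OF pm0 pm Tinf gen] by blast
  have "m_inf dvd lookup \<mu> None" if "\<mu> \<in> keys f\<^sub>1" for \<mu>
    using keys_ambient_lift_dvd that unfolding assms(19) by blast
  moreover have "factorially_graded G\<^sub>1 (quot_ring f\<^sub>1') (quot_const f\<^sub>1') (quot_component G\<^sub>1 w\<^sub>1 f\<^sub>1')"
    unfolding F using G1.factorially_graded_iff[OF homog_F] fact1 by simp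
  moreover have "factorial_domain (quot_ring f\<^sub>1')" if tf: "torsion_free_group G\<^sub>0"
  proof -
    have sat: "\<And>n x. int n *s x \<in> ?L1 \<Longrightarrow> n > 0 \<Longrightarrow> x \<in> ?L1"
      by (rule saturated_extension[OF span torsion_free_saturated[OF assms(1) tf]])
    obtain C where C: "finite C" "?L1 = kers C" by (rule saturated_lattice_functionals[OF sat])
    have "hfac UNIV F x" if "\<not> F dvd x" for x
      using torsionfree_factorization[OF C(1) _ _ that] homog_F fact1 unfolding C(2) by blast
    then show ?thesis unfolding F by (rule factorial_domain_quot_ring[OF pm])
  qed
  ultimately show ?thesis by blast
qed

end
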